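(* Let $\psi\in \mathcal{O}_M(\mathbb{R})$ be a real-valued, non-surjective function $\psi:\mathbb{R}\to\mathbb{R}$. Then the following conditions are equivalent. (i) The operator $C_\psi\colon\mathcal{O}_M(\mathbb{R})\to \mathcal{O}_M(\mathbb{R})$, $f\mapsto f \circ \psi$, is mixing. (ii) $\psi$ is injective with $\psi'(x)\neq 0$ for all $x\in\mathbb{R}$ and without fixed points, and for every $a\in\mathbb{R}$, each $k\in\mathbb{N}$ and every $v\in \mathcal{S}(\mathbb{R})$ it holds $$\lim_{n\to\infty} \sup_{x\in\psi_n\left([\min\{a,\psi(a)\},\max\{a,\psi(a)\}]\right)}\left|v(x)(\psi_{-n})^{(k)}(x)\right|=0.$$ (iii) $\psi$ is injective with $\psi'(x)\neq 0$ for all $x\in\mathbb{R}$ and without fixed points, and there is $a\in\mathbb{R}$ such that for each $k\in\mathbb{N}$ and every $v\in \mathcal{S}(\mathbb{R})$ it holds $$\lim_{n\to\infty} \sup_{x\in\psi_n\left([\min\{a,\psi(a)\},\max\{a,\psi(a)\}]\right)}\left|v(x)(\psi_{-n})^{(k)}(x)\right|=0.$$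
   Context: $\mathbb{N}=\{1,2,3,\ldots\}$. $\mathcal{S}(\mathbb{R})$ is the Schwartz space of rapidly decreasing smooth functions. For $m,n\in\mathbb{N}$ let $\mathcal{O}_n^m(\mathbb{R})=\{f\in C^m(\mathbb{R}): |f|_{m,n}:=\sup_{x\in\mathbb{R},\,0\le j\le m}(1+|x|^2)^{-n}|f^{(j)}(x)|<\infty\}$, a Banach space under $|\cdot|_{m,n}$, and $\mathcal{O}_M(\mathbb{R})=\bigcap_{m=1}^\infty\bigcup_{n=1}^\infty\mathcal{O}_n^m(\mathbb{R})$ (slowly increasing smooth functions, the multipliers of $\mathcal{S}(\mathbb{R})$). It carries the locally convex topology of the projective limit over $m$ of the (LB)-spaces $\operatorname{ind}_{n\to\infty}\mathcal{O}_n^m(\mathbb{R})$; equivalently, the topology given by the seminorms $p_{m,v}(f)=\sup_{x\in\mathbb{R}}\max_{0\le j\le m}|v(x)f^{(j)}(x)|$, $m\ge 0$, $v\in\mathcal{S}(\mathbb{R})$. For a smooth $\psi:\mathbb{R}\to\mathbb{R}$, the operator $C_\psi$ is well defined (and then continuous) on $\mathcal{O}_M(\mathbb{R})$ if and only if $\psi\in\mathcal{O}_M(\mathbb{R})$. Iterates: $\psi_0(x)=x$, $\psi_n=\psi\circ\psi_{n-1}$ for $n\in\mathbb{N}$; for injective $\psi$ and $n\in\mathbb{N}$, $\psi_{-n}:\psi_n(\mathbb{R})\to\mathbb{R}$ is the inverse of $\psi_n$. $(\psi_{-n})^{(k)}$ denotes the $k$-th derivative of $\psi_{-n}$. A continuous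 linear operator $T$ on a topological vector space $E$ is mixing if for every pair of non-empty open sets $U,V\subseteq E$ one has $T^n(U)\cap V\neq\emptyset$ for all sufficiently large $n\in\mathbb{N}$. *)

theory Defs
  imports "HOL-Analysis.Analysis"
begin

definition nth_deriv :: "nat \<Rightarrow> (real \<Rightarrow> 'a::real_normed_vector) \<Rightarrow> real \<Rightarrow> 'a" where
  "nth_deriv k f = ((\<lambda>g x. vector_derivative g (at x)) ^^ k) f"

definition C_m :: "nat \<Rightarrow> (real \<Rightarrow> 'a::real_normed_vector) set" where
  "C_m m = {f. (\<forall>j<m. \<forall>x. nth_deriv j f differentiable (at x)) \<and> continuous_on UNIV (nth_deriv m f)}"

definition schwartz :: "(real \<Rightarrow> 'a::real_normed_vector) set" where
  "schwartz = {v. (\<forall>m. v \<in> C_m m) \<and>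
     (\<forall>j l. bdd_above (range (\<lambda>x. \<bar>x\<bar> ^ l * norm (nth_deriv j v x))))}"

definition O_mn :: "nat \<Rightarrow> nat \<Rightarrow> (real \<Rightarrow> 'a::real_normed_vector) set" where
  "O_mn m n = {f \<in> C_m m.
     bdd_above {norm (nth_deriv j f x) / (1 + \<bar>x\<bar>\<^sup>2) ^ n | x j. j \<le> m}}"

definition O_M :: "(real \<Rightarrow> 'a::real_normed_vector) set" where
  "O_M = (\<Inter>m\<in>{1..}. \<Union>n\<in>{1..}. O_mn m n)"

text \<open>For f in \<open>O_M\<close> and v in \<open>schwartz\<close> the supremum below is over a bounded set of reals,
  so \<open>SUP\<close> has its usual meaning.\<close>

definition O_M_seminorm :: "nat \<Rightarrow> (real \<Rightarrow> complex) \<Rightarrow> (real \<Rightarrow> complex) \<Rightarrow> real" where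
  "O_M_seminorm m v f = (SUP x. Max ((\<lambda>j. cmod (v x * nth_deriv j f x)) ` {..m}))"

text \<open>The locally convex topology given by the seminorms; its underlying set is \<open>O_M\<close>.\<close>

definition O_M_topology :: "(real \<Rightarrow> complex) topology" where
  "O_M_topology = topology_generated_by
     {{g \<in> O_M. O_M_seminorm m v (\<lambda>x. g x - f x) < \<epsilon>} | m v f \<epsilon>.
        v \<in> schwartz \<and> f \<in> O_M \<and> \<epsilon> > 0}"

definition comp_op :: "(real \<Rightarrow> real) \<Rightarrow> (real \<Rightarrow> complex) \<Rightarrow> (real \<Rightarrow> complex)" where
  "comp_op \<psi> f = f \<circ> \<psi>"

text \<open>Linearity is not part of this predicate: it refers to the topology only, and the operators
  \<open>comp_op \<psi>\<close> are linear for the pointwise operations.\<close>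

definition mixing :: "'a topology \<Rightarrow> ('a \<Rightarrow> 'a) \<Rightarrow> bool" where
  "mixing X T \<longleftrightarrow> continuous_map X X T \<and>
     (\<forall>U V. openin X U \<and> U \<noteq> {} \<and> openin X V \<and> V \<noteq> {} \<longrightarrow>
        (\<forall>\<^sub>F n in sequentially. (T ^^ n) ` U \<inter> V \<noteq> {}))"

text \<open>The inverse of the n-th iterate on the range of that iterate; only arguments in this range
  are relevant. If \<open>\<psi>\<close> is injective and differentiable with non-vanishing derivative, the range is
  open, so the values outside it do not influence the derivatives at its points.\<close>

definition inv_iter :: "(real \<Rightarrow> real) \<Rightarrow> nat \<Rightarrow> real \<Rightarrow> real" where
  "inv_iter \<psi> n = inv_into UNIV (\<psi> ^^ n)"

end

theory Submission
  imports Defs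
begin

text \<open>
  A sequence of values attached to points of \<open>\<real>\<close> stays bounded against every Schwartz weight only if it grows
  at most polynomially, since a rapidly decreasing function on a set of points is dominated by a Schwartz function.
  As \<open>\<psi>\<close> is not surjective and has no fixed point, the ranges of the iterates escape to infinity, so the limit
  condition says that the derivatives of \<open>\<psi>\<^sub>-\<^sub>n\<close> on \<open>\<psi>\<^sub>n(K)\<close> grow polynomially, uniformly in \<open>n\<close>. This
  property passes from \<open>K\<close> to \<open>\<psi>(K)\<close> and back by the chain rule, hence from one fundamental interval to all
  compact sets. It then suffices to approximate by compactly supported \<open>f\<close> and \<open>g\<close> and to take
  \<open>f + g \<circ> \<psi>\<^sub>-\<^sub>n\<close>, whose composition with \<open>\<psi>\<^sub>n\<close> is \<open>g\<close> for large \<open>n\<close>. Conversely, mixing yields a small \<open>f\<close>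
  with \<open>f \<circ> \<psi>\<^sub>n\<close> close to the identity, which controls the derivatives of \<open>\<psi>\<^sub>-\<^sub>n\<close> one order at a time.
\<close>

section \<open>Iterated derivatives\<close>

text \<open>The topology sees growth only through Schwartz weights, while the chain rule needs
  explicit polynomial bounds. The bridge is a domination principle for values attached to arbitrary
  points, which may repeat or cluster; it also yields the directedness of the seminorms and the
  continuity of composition. All estimates must be uniform in \<open>n\<close> although the domains
  of the inverse iterates shrink with \<open>n\<close>: hence differentiability relative to an open
  set, and growth of families indexed by pairs of \<open>n\<close> and a point of \<open>K\<close>.
  The limit 0 amounts to mere boundedness because boundedness against all weights leaves a spare
  power of decay, which the escape of the ranges turns into smallness. For necessity, the highest
  derivative of the inverse iterate enters the chain rule linearly, with the factor
  \<open>h'\<close>, and everything else has lower order; the identity is the test function because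
  its derivative 1 allows division. For sufficiency, the ranges also leave the support of
  \<open>f\<close>, so \<open>f\<close> drops out of the composition.\<close>

lemma nth_deriv_0 [simp]: "nth_deriv 0 f = f"
  by (simp add: nth_deriv_def)

lemma nth_deriv_Suc: "nth_deriv (Suc k) f = (\<lambda>x. vector_derivative (nth_deriv k f) (at x))"
  by (simp add: nth_deriv_def)

lemma nth_deriv_Suc_shift: "nth_deriv (Suc k) f = nth_deriv k (nth_deriv (Suc 0) f)"
  by (simp add: nth_deriv_def funpow_Suc_right del: funpow.simps(2))

lemma nth_deriv_cong:
  assumes "open S" "\<And>x. x \<in> S \<Longrightarrow> f x = g x" "x \<in> S"
  shows "nth_deriv k f x = nth_deriv k g x"
  using assms(3)
proof (induction k arbitrary: x)
  case 0 then show ?case by (simp add: assms)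
next
  case (Suc k)
  have "eventually (\<lambda>y. y \<in> S) (nhds x)"
    using assms(1) Suc.prems by (rule eventually_nhds_in_open)
  then have "eventually (\<lambda>y. y \<in> UNIV \<longrightarrow> nth_deriv k f y = nth_deriv k g y) (nhds x)"
    by eventually_elim (use Suc.IH in auto)
  then show ?case unfolding nth_deriv_Suc
    by (intro vector_derivative_cong_eq) auto
qed

text \<open>The derivatives are two-sided, so the set is meant to be open; a domain is carried along
  because the inverse iterates are meaningful only on the ranges of the iterates. Continuity of the
  last derivative is left out, which makes induction on the order exact.\<close>

definition kdiff :: "nat \<Rightarrow> real set \<Rightarrow> (real \<Rightarrow> 'a::real_normed_vector) \<Rightarrow> bool" where
  "kdiff k S f \<longleftrightarrow> (\<forall>j<k. \<forall>x\<in>S. nth_deriv j f differentiable (at x))"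

lemma kdiff_0 [simp]: "kdiff 0 S f"
  by (simp add: kdiff_def)

lemma kdiff_mono: "kdiff k S f \<Longrightarrow> j \<le> k \<Longrightarrow> kdiff j S f"
  by (auto simp: kdiff_def)

lemma kdiff_subset: "kdiff k S f \<Longrightarrow> T \<subseteq> S \<Longrightarrow> kdiff k T f"
  by (auto simp: kdiff_def)

lemma kdiff_Suc: "kdiff (Suc k) S f \<longleftrightarrow>
    (\<forall>x\<in>S. f differentiable (at x)) \<and> kdiff k S (nth_deriv (Suc 0) f)"
  by (auto simp: kdiff_def less_Suc_eq_0_disj nth_deriv_Suc_shift[symmetric])

lemma kdiff_SucD: "kdiff (Suc k) S f \<Longrightarrow> kdiff k S f"
  and kdiff_deriv: "kdiff (Suc k) S f \<Longrightarrow> kdiff k S (nth_deriv (Suc 0) f)"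
  by (auto simp: kdiff_Suc intro: kdiff_mono[of "Suc k"])

lemma kdiff_Suc_0: "kdiff (Suc k) S f \<Longrightarrow> kdiff (Suc 0) S f"
  by (auto simp: kdiff_def)

lemma has_nth_deriv:
  assumes "kdiff k S f" "j < k" "x \<in> S"
  shows "(nth_deriv j f has_vector_derivative nth_deriv (Suc j) f x) (at x)"
  using assms by (simp add: kdiff_def nth_deriv_Suc vector_derivative_works[symmetric])

lemma nth_deriv_1I: "(f has_vector_derivative f') (at x) \<Longrightarrow> nth_deriv (Suc 0) f x = f'"
  by (simp add: nth_deriv_Suc vector_derivative_at)

text \<open>Guessing the whole sequence of derivatives leaves only one-step derivatives to be
  checked; linear images, sums, products and function series are all treated this way.\<close>

lemma nth_deriv_family:
  assumes "open S" and F0: "\<And>x. x \<in> S \<Longrightarrow> f x = F 0 x"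
    and F: "\<And>j x. j < k \<Longrightarrow> x \<in> S \<Longrightarrow> (F j has_vector_derivative F (Suc j) x) (at x)"
  shows "kdiff k S f" and "j \<le> k \<Longrightarrow> x \<in> S \<Longrightarrow> nth_deriv j f x = F j x"
proof -
  have *: "nth_deriv j f x = F j x" if "j \<le> k" "x \<in> S" for j x
    using that
  proof (induction j arbitrary: x)
    case 0 then show ?case by (simp add: F0)
  next
    case (Suc j)
    have "(nth_deriv j f has_vector_derivative F (Suc j) x) (at x)"
      by (rule has_vector_derivative_transform_within_open[OF F assms(1)]) (use Suc in auto)
    then show ?case by (simp add: nth_deriv_Suc vector_derivative_at)
  qed
  then show "j \<le> k \<Longrightarrow> x \<in> S \<Longrightarrow> nth_deriv j f x = F j x" by blast
  have "(nth_deriv j f has_vector_derivative F (Suc j) x) (at x)" if "j < k" "x \<in> S" for j x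
    by (rule has_vector_derivative_transform_within_open[OF F assms(1)]) (use that * in auto)
  then show "kdiff k S f"
    by (auto simp: kdiff_def intro: differentiableI_vector)
qed

lemma kdiff_cong:
  assumes "open S" "\<And>x. x \<in> S \<Longrightarrow> f x = g x" "kdiff k S g"
  shows "kdiff k S f"
  by (rule nth_deriv_family[where F = "\<lambda>j. nth_deriv j g"])
     (use assms has_nth_deriv in auto)

lemma kdiff_SucI:
  assumes "open S" "\<And>x. x \<in> S \<Longrightarrow> (f has_vector_derivative f' x) (at x)" "kdiff k S f'"
  shows "kdiff (Suc k) S f"
  unfolding kdiff_Suc
proof
  show "\<forall>x\<in>S. f differentiable (at x)"
    using assms(2) differentiableI_vector by blast
  show "kdiff k S (nth_deriv (Suc 0) f)"
    using assms nth_deriv_1I by (intro kdiff_cong[OF assms(1) _ assms(3)]) auto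
qed

lemma kdiff_continuous_on:
  assumes "kdiff k S f" "j < k"
  shows "continuous_on S (nth_deriv j f)"
  using assms has_nth_deriv[OF assms]
  by (intro continuous_at_imp_continuous_on ballI)
     (blast intro: has_vector_derivative_continuous)

lemma kdiff_const: "open S \<Longrightarrow> kdiff k S (\<lambda>x. c)"
  and nth_deriv_const: "nth_deriv (Suc j) (\<lambda>x. c) x = 0"
proof -
  have F: "((if j = 0 then (\<lambda>x. c) else (\<lambda>x. 0)) has_vector_derivative
      (if Suc j = 0 then (\<lambda>x. c) else (\<lambda>x. 0)) x) (at x)" for j x
    by (cases j) auto
  show "open S \<Longrightarrow> kdiff k S (\<lambda>x. c)"
    by (rule nth_deriv_family[where F = "\<lambda>j. if j = 0 then (\<lambda>x. c) else (\<lambda>x. 0)"]) (use F in auto)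
  show "nth_deriv (Suc j) (\<lambda>x. c) x = 0"
    using nth_deriv_family(2)[where F = "\<lambda>j. if j = 0 then (\<lambda>x. c) else (\<lambda>x. 0)"
      and k = "Suc j" and S = UNIV and f = "\<lambda>x. c" and j = "Suc j" and x = x] F by auto
qed

section \<open>Linear images, sums, products and compositions\<close>

lemma kdiff_bounded_linear:
  assumes "bounded_linear L" "open S" "kdiff k S f"
  shows "kdiff k S (\<lambda>x. L (f x))"
    and "j \<le> k \<Longrightarrow> x \<in> S \<Longrightarrow> nth_deriv j (\<lambda>x. L (f x)) x = L (nth_deriv j f x)"
proof -
  have F: "((\<lambda>x. L (nth_deriv j f x)) has_vector_derivative L (nth_deriv (Suc j) f x)) (at x)"
    if "j < k" "x \<in> S" for j x
    by (rule bounded_linear.has_vector_derivative[OF assms(1) has_nth_deriv[OF assms(3)]])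
       (use that in auto)
  note fam = nth_deriv_family[where F = "\<lambda>j x. L (nth_deriv j f x)" and f = "\<lambda>x. L (f x)"
      and S = S and k = k, OF assms(2) _ F]
  show "kdiff k S (\<lambda>x. L (f x))" by (rule fam(1)) auto
  show "j \<le> k \<Longrightarrow> x \<in> S \<Longrightarrow> nth_deriv j (\<lambda>x. L (f x)) x = L (nth_deriv j f x)"
    by (rule fam(2)) auto
qed

lemma kdiff_add:
  assumes "open S" "kdiff k S f" "kdiff k S g"
  shows "kdiff k S (\<lambda>x. f x + g x)"
    and "j \<le> k \<Longrightarrow> x \<in> S \<Longrightarrow> nth_deriv j (\<lambda>x. f x + g x) x = nth_deriv j f x + nth_deriv j g x"
proof -
  have F: "((\<lambda>x. nth_deriv j f x + nth_deriv j g x) has_vector_derivative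
      nth_deriv (Suc j) f x + nth_deriv (Suc j) g x) (at x)"
    if "j < k" "x \<in> S" for j x
    using that assms by (intro has_vector_derivative_add has_nth_deriv) auto
  note fam = nth_deriv_family[where F = "\<lambda>j x. nth_deriv j f x + nth_deriv j g x"
      and f = "\<lambda>x. f x + g x" and S = S and k = k, OF assms(1) _ F]
  show "kdiff k S (\<lambda>x. f x + g x)" by (rule fam(1)) auto
  show "j \<le> k \<Longrightarrow> x \<in> S \<Longrightarrow> nth_deriv j (\<lambda>x. f x + g x) x = nth_deriv j f x + nth_deriv j g x"
    by (rule fam(2)) auto
qed

lemma kdiff_uminus:
  assumes "open S" "kdiff k S f"
  shows "kdiff k S (\<lambda>x. - f x)"
    and "j \<le> k \<Longrightarrow> x \<in> S \<Longrightarrow> nth_deriv j (\<lambda>x. - f x) x = - nth_deriv j f x"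
  using kdiff_bounded_linear[OF bounded_linear_minus[OF bounded_linear_ident] assms] by auto

lemma kdiff_diff:
  assumes "open S" "kdiff k S f" "kdiff k S g"
  shows "kdiff k S (\<lambda>x. f x - g x)"
    and "j \<le> k \<Longrightarrow> x \<in> S \<Longrightarrow> nth_deriv j (\<lambda>x. f x - g x) x = nth_deriv j f x - nth_deriv j g x"
  using kdiff_add[OF assms(1,2) kdiff_uminus(1)[OF assms(1,3)]]
    kdiff_uminus(2)[OF assms(1,3)] by auto

text \<open>Pascal's rule: differentiating the Leibniz sum of order \<open>k\<close> produces the
  one of order \<open>Suc k\<close>.\<close>

lemma leibniz_step:
  fixes p :: "nat \<Rightarrow> real" and q :: "nat \<Rightarrow> 'a::real_vector"
  shows "(\<Sum>i\<le>k. real (k choose i) *\<^sub>R (p (k - i) *\<^sub>R q (Suc i) + p (Suc (k - i)) *\<^sub>R q i)) =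
    (\<Sum>i\<le>Suc k. real (Suc k choose i) *\<^sub>R (p (Suc k - i) *\<^sub>R q i))"
proof -
  have A: "(\<Sum>i\<le>Suc k. real (Suc k choose i) *\<^sub>R (p (Suc k - i) *\<^sub>R q i)) =
      p (Suc k) *\<^sub>R q 0 + (\<Sum>i\<le>k. real (Suc k choose Suc i) *\<^sub>R (p (k - i) *\<^sub>R q (Suc i)))"
    by (subst sum.atMost_Suc_shift) simp
  have B: "(\<Sum>i\<le>k. real (k choose i) *\<^sub>R (p (Suc (k - i)) *\<^sub>R q i)) =
      (\<Sum>i\<le>Suc k. real (k choose i) *\<^sub>R (p (Suc k - i) *\<^sub>R q i))"
    by (auto intro!: sum.cong simp: Suc_diff_le)
  have C: "(\<Sum>i\<le>Suc k. real (k choose i) *\<^sub>R (p (Suc k - i) *\<^sub>R q i)) =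
      p (Suc k) *\<^sub>R q 0 + (\<Sum>i\<le>k. real (k choose Suc i) *\<^sub>R (p (k - i) *\<^sub>R q (Suc i)))"
    by (subst sum.atMost_Suc_shift) simp
  show ?thesis
    unfolding scaleR_add_right sum.distrib A B C
    by (simp add: sum.distrib scaleR_add_left algebra_simps)
qed

lemma kdiff_scaleR:
  fixes f :: "real \<Rightarrow> real" and g :: "real \<Rightarrow> 'a::real_normed_vector"
  assumes "open S" "kdiff k S f" "kdiff k S g"
  shows "kdiff k S (\<lambda>x. f x *\<^sub>R g x)"
    and "j \<le> k \<Longrightarrow> x \<in> S \<Longrightarrow> nth_deriv j (\<lambda>x. f x *\<^sub>R g x) x =
      (\<Sum>i\<le>j. real (j choose i) *\<^sub>R (nth_deriv (j - i) f x *\<^sub>R nth_deriv i g x))"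
proof -
  define F where "F = (\<lambda>j x. \<Sum>i\<le>j. real (j choose i) *\<^sub>R (nth_deriv (j - i) f x *\<^sub>R nth_deriv i g x))"
  have F: "(F j has_vector_derivative F (Suc j) x) (at x)" if "j < k" "x \<in> S" for j x
  proof -
    have "((\<lambda>x. \<Sum>i\<le>j. real (j choose i) *\<^sub>R (nth_deriv (j - i) f x *\<^sub>R nth_deriv i g x))
      has_vector_derivative (\<Sum>i\<le>j. real (j choose i) *\<^sub>R
        (nth_deriv (j - i) f x *\<^sub>R nth_deriv (Suc i) g x + nth_deriv (Suc (j - i)) f x *\<^sub>R nth_deriv i g x))) (at x)"
      by (intro has_vector_derivative_sum bounded_linear.has_vector_derivative[OF bounded_linear_scaleR_right]
          has_vector_derivative_scaleR has_nth_deriv[OF assms(3)])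
         (use that has_nth_deriv[OF assms(2)] in \<open>auto simp: has_real_derivative_iff_has_vector_derivative\<close>)
    then show ?thesis
      unfolding leibniz_step[of j "\<lambda>i. nth_deriv i f x" "\<lambda>i. nth_deriv i g x"]
      by (simp add: F_def)
  qed
  note fam = nth_deriv_family[where F = F and f = "\<lambda>x. f x *\<^sub>R g x" and S = S and k = k,
      OF assms(1) _ F]
  show "kdiff k S (\<lambda>x. f x *\<^sub>R g x)" by (rule fam(1)) (auto simp: F_def)
  show "j \<le> k \<Longrightarrow> x \<in> S \<Longrightarrow> nth_deriv j (\<lambda>x. f x *\<^sub>R g x) x =
      (\<Sum>i\<le>j. real (j choose i) *\<^sub>R (nth_deriv (j - i) f x *\<^sub>R nth_deriv i g x))"
    using fam(2)[of j x] by (simp add: F_def)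
qed

lemma chain_deriv:
  fixes g :: "real \<Rightarrow> real" and h :: "real \<Rightarrow> 'a::real_normed_vector"
  assumes "kdiff (Suc 0) S g" "kdiff (Suc 0) T h" "g ` S \<subseteq> T" "x \<in> S"
  shows "((\<lambda>x. h (g x)) has_vector_derivative nth_deriv (Suc 0) g x *\<^sub>R nth_deriv (Suc 0) h (g x)) (at x)"
  using vector_diff_chain_at[of g _ x h] has_nth_deriv[OF assms(1), of 0 x]
    has_nth_deriv[OF assms(2), of 0 "g x"] assms(3,4) by (auto simp: o_def)

lemma kdiff_compose:
  fixes g :: "real \<Rightarrow> real" and h :: "real \<Rightarrow> 'a::real_normed_vector"
  assumes "open S" "kdiff k S g" "kdiff k T h" "g ` S \<subseteq> T"
  shows "kdiff k S (\<lambda>x. h (g x))"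
  using assms(2,3)
proof (induction k arbitrary: h)
  case (Suc k)
  show ?case
  proof (rule kdiff_SucI[OF assms(1)])
    show "((\<lambda>x. h (g x)) has_vector_derivative
        nth_deriv (Suc 0) g x *\<^sub>R nth_deriv (Suc 0) h (g x)) (at x)" if "x \<in> S" for x
      by (rule chain_deriv[OF Suc.prems[THEN kdiff_Suc_0] assms(4) that])
    show "kdiff k S (\<lambda>x. nth_deriv (Suc 0) g x *\<^sub>R nth_deriv (Suc 0) h (g x))"
      by (rule kdiff_scaleR(1)[OF assms(1) kdiff_deriv[OF Suc.prems(1)]
            Suc.IH[OF kdiff_SucD[OF Suc.prems(1)] kdiff_deriv[OF Suc.prems(2)]]])
  qed
qed simp

text \<open>The Leibniz rule applied to the first derivative of the composition gives a recursion in
  the order, which replaces the explicit formula of Faa di Bruno.\<close>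

lemma nth_deriv_compose:
  fixes g :: "real \<Rightarrow> real" and h :: "real \<Rightarrow> 'a::real_normed_vector"
  assumes "open S" "kdiff (Suc k) S g" "kdiff (Suc k) T h" "g ` S \<subseteq> T" "x \<in> S"
  shows "nth_deriv (Suc k) (\<lambda>x. h (g x)) x =
    (\<Sum>i\<le>k. real (k choose i) *\<^sub>R (nth_deriv (Suc (k - i)) g x *\<^sub>R
       nth_deriv i (\<lambda>x. nth_deriv (Suc 0) h (g x)) x))"
proof -
  have "nth_deriv (Suc k) (\<lambda>x. h (g x)) x = nth_deriv k (nth_deriv (Suc 0) (\<lambda>x. h (g x))) x"
    by (metis nth_deriv_Suc_shift)
  also have "\<dots> = nth_deriv k (\<lambda>x. nth_deriv (Suc 0) g x *\<^sub>R nth_deriv (Suc 0) h (g x)) x"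
  proof (rule nth_deriv_cong[OF assms(1) _ assms(5)])
    fix y assume "y \<in> S"
    show "nth_deriv (Suc 0) (\<lambda>x. h (g x)) y = nth_deriv (Suc 0) g y *\<^sub>R nth_deriv (Suc 0) h (g y)"
      by (rule nth_deriv_1I, rule chain_deriv[OF assms(2,3)[THEN kdiff_Suc_0] assms(4) \<open>y \<in> S\<close>])
  qed
  also have "\<dots> = (\<Sum>i\<le>k. real (k choose i) *\<^sub>R (nth_deriv (k - i) (nth_deriv (Suc 0) g) x *\<^sub>R
       nth_deriv i (\<lambda>x. nth_deriv (Suc 0) h (g x)) x))"
    by (rule kdiff_scaleR(2)[OF assms(1) kdiff_deriv[OF assms(2)]
          kdiff_compose[OF assms(1) kdiff_SucD[OF assms(2)] kdiff_deriv[OF assms(3)] assms(4)]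
          order_refl assms(5)])
  finally show ?thesis by (simp add: nth_deriv_Suc_shift[symmetric])
qed

text \<open>The Bell numbers: they count set partitions, hence the products in the formula of Faa di
  Bruno.\<close>

fun bell :: "nat \<Rightarrow> nat" where
  "bell 0 = 1"
| "bell (Suc k) = (\<Sum>i\<le>k. (k choose i) * bell i)"

text \<open>The derivatives of \<open>g\<close> are bounded from order 1 on, as \<open>g x\<close>
  itself may be large. Since \<open>1 \<le> M\<close>, lower powers of \<open>M\<close> can be
  raised to a common exponent. The induction varies \<open>h\<close> because the recursion passes to
  \<open>h'\<close>.\<close>

lemma norm_nth_deriv_compose_le:
  fixes g :: "real \<Rightarrow> real" and h :: "real \<Rightarrow> 'a::real_normed_vector" and A M :: real
  assumes "open S" "kdiff k S g" "kdiff k T h" "g ` S \<subseteq> T" "x \<in> S" and M: "1 \<le> M"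
    and g: "\<And>j. 1 \<le> j \<Longrightarrow> j \<le> k \<Longrightarrow> \<bar>nth_deriv j g x\<bar> \<le> M"
    and h: "\<And>i. i \<le> k \<Longrightarrow> norm (nth_deriv i h (g x)) \<le> A"
  shows "norm (nth_deriv k (\<lambda>x. h (g x)) x) \<le> bell k * A * M ^ k"
  using assms(2,3) g h
proof (induction k arbitrary: h rule: less_induct)
  case (less k)
  have A: "0 \<le> A" using order_trans[OF norm_ge_zero less.prems(4)[of 0]] by simp
  show ?case
  proof (cases k)
    case 0 then show ?thesis using less.prems(4)[of 0] by simp
  next
    case (Suc m)
    have "norm (nth_deriv k (\<lambda>x. h (g x)) x) \<le>
      (\<Sum>i\<le>m. norm (real (m choose i) *\<^sub>R (nth_deriv (Suc (m - i)) g x *\<^sub>R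
       nth_deriv i (\<lambda>x. nth_deriv (Suc 0) h (g x)) x)))"
      unfolding Suc using less.prems assms(1,4,5)
      by (subst nth_deriv_compose[where S = S and T = T]) (auto simp: Suc simp del: norm_scaleR scaleR_scaleR intro!: norm_sum)
    also have "\<dots> \<le> (\<Sum>i\<le>m. real (m choose i) * (M * (bell i * A * M ^ m)))"
    proof (rule sum_mono)
      fix i assume i: "i \<in> {..m}"
      have "norm (nth_deriv i (\<lambda>x. nth_deriv (Suc 0) h (g x)) x) \<le> bell i * A * M ^ i"
      proof (rule less.IH)
        show "i < k" using i Suc by simp
        show "kdiff i S g" using i Suc kdiff_mono[OF less.prems(1), of i] by auto
        show "kdiff i T (nth_deriv (Suc 0) h)"
          using i Suc kdiff_mono[OF kdiff_deriv, of m _ _ i] less.prems(2) by auto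
        show "\<And>j. 1 \<le> j \<Longrightarrow> j \<le> i \<Longrightarrow> \<bar>nth_deriv j g x\<bar> \<le> M"
          using i Suc less.prems(3) by auto
        show "\<And>ia. ia \<le> i \<Longrightarrow> norm (nth_deriv ia (nth_deriv (Suc 0) h) (g x)) \<le> A"
          using i Suc less.prems(4) by (auto simp: nth_deriv_Suc_shift[symmetric])
      qed
      also have "\<dots> \<le> bell i * A * M ^ m"
        using i M A by (intro mult_left_mono power_increasing) auto
      finally have "\<bar>nth_deriv (Suc (m - i)) g x\<bar> * norm (nth_deriv i (\<lambda>x. nth_deriv (Suc 0) h (g x)) x)
          \<le> M * (bell i * A * M ^ m)"
        using i Suc less.prems(3)[of "Suc (m - i)"] M by (intro mult_mono) auto
      then show "norm (real (m choose i) *\<^sub>R (nth_deriv (Suc (m - i)) g x *\<^sub>R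
       nth_deriv i (\<lambda>x. nth_deriv (Suc 0) h (g x)) x)) \<le> real (m choose i) * (M * (bell i * A * M ^ m))"
        by (simp add: abs_mult mult.assoc mult_left_mono)
    qed
    also have "\<dots> = bell k * A * M ^ k"
      by (simp add: Suc sum_distrib_right sum_distrib_left mult_ac)
    finally show ?thesis .
  qed
qed

text \<open>The term with index 0 of the recursion is the only one that contains the derivative of
  \<open>g\<close> of order \<open>Suc k\<close>. Subtracting it leaves an estimate in terms of the
  derivatives of \<open>g\<close> up to order \<open>k\<close>; this is what permits induction on
  the order.\<close>

lemma norm_nth_deriv_compose_remainder:
  fixes g :: "real \<Rightarrow> real" and h :: "real \<Rightarrow> 'a::real_normed_vector" and A M :: real
  assumes "open S" "kdiff (Suc k) S g" "kdiff (Suc k) T h" "g ` S \<subseteq> T" "x \<in> S" and M: "1 \<le> M"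
    and g: "\<And>j. 1 \<le> j \<Longrightarrow> j \<le> k \<Longrightarrow> \<bar>nth_deriv j g x\<bar> \<le> M"
    and h: "\<And>i. i \<le> Suc k \<Longrightarrow> norm (nth_deriv i h (g x)) \<le> A"
  shows "norm (nth_deriv (Suc k) (\<lambda>x. h (g x)) x
      - nth_deriv (Suc k) g x *\<^sub>R nth_deriv (Suc 0) h (g x)) \<le> bell (Suc k) * A * M ^ Suc k"
proof -
  let ?t = "\<lambda>i. real (k choose i) *\<^sub>R (nth_deriv (Suc (k - i)) g x *\<^sub>R
       nth_deriv i (\<lambda>x. nth_deriv (Suc 0) h (g x)) x)"
  have A: "0 \<le> A" using order_trans[OF norm_ge_zero h[of 0]] by simp
  have "nth_deriv (Suc k) (\<lambda>x. h (g x)) x = (\<Sum>i\<le>k. ?t i)"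
    by (rule nth_deriv_compose[OF assms(1-5)])
  also have "\<dots> = ?t 0 + (\<Sum>i\<in>{1..k}. ?t i)"
    using sum.atLeast_Suc_atMost[of 0 k ?t] by (simp add: atMost_atLeast0)
  finally have "norm (nth_deriv (Suc k) (\<lambda>x. h (g x)) x
      - nth_deriv (Suc k) g x *\<^sub>R nth_deriv (Suc 0) h (g x)) = norm (\<Sum>i\<in>{1..k}. ?t i)"
    by simp
  also have "\<dots> \<le> (\<Sum>i\<in>{1..k}. norm (?t i))" by (rule norm_sum)
  also have "\<dots> \<le> (\<Sum>i\<in>{1..k}. real (k choose i) * (M * (bell i * A * M ^ k)))"
  proof (rule sum_mono)
    fix i assume i: "i \<in> {1..k}"
    have "norm (nth_deriv i (\<lambda>x. nth_deriv (Suc 0) h (g x)) x) \<le> bell i * A * M ^ i"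
    proof (rule norm_nth_deriv_compose_le[OF assms(1) _ _ assms(4,5) M])
      show "kdiff i S g" using i kdiff_mono[OF assms(2), of i] by auto
      show "kdiff i T (nth_deriv (Suc 0) h)"
        using i kdiff_mono[OF kdiff_deriv[OF assms(3)], of i] by auto
      show "\<And>j. 1 \<le> j \<Longrightarrow> j \<le> i \<Longrightarrow> \<bar>nth_deriv j g x\<bar> \<le> M"
        using i g by auto
      show "\<And>ia. ia \<le> i \<Longrightarrow> norm (nth_deriv ia (nth_deriv (Suc 0) h) (g x)) \<le> A"
        using i h by (auto simp: nth_deriv_Suc_shift[symmetric])
    qed
    also have "\<dots> \<le> bell i * A * M ^ k"
      using i M A by (intro mult_left_mono power_increasing) auto
    finally have "\<bar>nth_deriv (Suc (k - i)) g x\<bar> * norm (nth_deriv i (\<lambda>x. nth_deriv (Suc 0) h (g x)) x)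
        \<le> M * (bell i * A * M ^ k)"
      using i g[of "Suc (k - i)"] M by (intro mult_mono) auto
    then show "norm (?t i) \<le> real (k choose i) * (M * (bell i * A * M ^ k))"
      by (simp add: abs_mult mult.assoc mult_left_mono)
  qed
  also have "\<dots> \<le> (\<Sum>i\<le>k. real (k choose i) * (M * (bell i * A * M ^ k)))"
    using A M by (intro sum_mono2) auto
  also have "\<dots> = bell (Suc k) * A * M ^ Suc k"
    by (simp add: sum_distrib_right sum_distrib_left mult_ac)
  finally show ?thesis .
qed

section \<open>Reciprocals and inverse functions\<close>

lemma kdiff_inverse:
  fixes f :: "real \<Rightarrow> real"
  assumes "open S" "kdiff k S f" "\<And>x. x \<in> S \<Longrightarrow> f x \<noteq> 0"
  shows "kdiff k S (\<lambda>x. inverse (f x))"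
  using assms(2)
proof (induction k)
  case (Suc k)
  show ?case
  proof (rule kdiff_SucI[OF assms(1)])
    fix x assume x: "x \<in> S"
    have "(f has_real_derivative nth_deriv (Suc 0) f x) (at x)"
      using has_nth_deriv[OF Suc.prems, of 0 x] x
      by (simp add: has_real_derivative_iff_has_vector_derivative)
    from DERIV_inverse_fun[OF this] show "((\<lambda>x. inverse (f x)) has_vector_derivative
       (- nth_deriv (Suc 0) f x) *\<^sub>R (inverse (f x) *\<^sub>R inverse (f x))) (at x)"
      using assms(3)[OF x]
      by (simp add: has_real_derivative_iff_has_vector_derivative mult.assoc)
  next
    have "kdiff k S (\<lambda>x. inverse (f x))" by (rule Suc.IH[OF kdiff_SucD[OF Suc.prems]])
    then show "kdiff k S (\<lambda>x. (- nth_deriv (Suc 0) f x) *\<^sub>R (inverse (f x) *\<^sub>R inverse (f x)))"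
      by (intro kdiff_scaleR(1) kdiff_uminus(1) assms(1) kdiff_deriv[OF Suc.prems])
  qed
qed simp

lemma open_range_if_deriv_nonzero:
  fixes p :: "real \<Rightarrow> real"
  assumes "inj p" "continuous_on UNIV p"
  shows "open (range p)"
  using invariance_of_domain[of UNIV p] assms by auto

lemma inv_into_has_vector_derivative:
  fixes p :: "real \<Rightarrow> real"
  assumes p: "kdiff (Suc 0) UNIV p" and inj: "inj p" and nz: "\<And>x. nth_deriv (Suc 0) p x \<noteq> 0"
    and y: "y \<in> range p"
  shows "(inv_into UNIV p has_vector_derivative inverse (nth_deriv (Suc 0) p (inv_into UNIV p y))) (at y)"
proof -
  obtain x where x: "y = p x" using y by auto
  have c: "continuous_on UNIV p" using kdiff_continuous_on[OF p, of 0] by simp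
  have d: "(p has_derivative (\<lambda>h. nth_deriv (Suc 0) p x * h)) (at x)"
    using has_nth_deriv[OF p, of 0 x]
    by (simp add: has_vector_derivative_def mult.commute)
  have "(inv_into UNIV p has_derivative (\<lambda>h. h * inverse (nth_deriv (Suc 0) p x))) (at (p x))"
    by (rule has_derivative_inverse_strong[OF open_UNIV _ c _ d]) (use inj nz in \<open>auto simp: o_def\<close>)
  then show ?thesis using inj by (simp add: x has_vector_derivative_def)
qed

text \<open>Bootstrapping: the derivative of the inverse is \<open>1 / p'\<close> composed with the
  inverse itself, so \<open>k\<close> orders of differentiability yield one more.\<close>

lemma kdiff_inv_into:
  fixes p :: "real \<Rightarrow> real"
  assumes p: "\<And>k. kdiff k UNIV p" and inj: "inj p" and nz: "\<And>x. nth_deriv (Suc 0) p x \<noteq> 0"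
  shows "kdiff k (range p) (inv_into UNIV p)"
proof (induction k)
  case (Suc k)
  have "continuous_on UNIV p" using kdiff_continuous_on[OF p, of 0 1] by simp
  with inj have o: "open (range p)" by (rule open_range_if_deriv_nonzero)
  show ?case
  proof (rule kdiff_SucI[OF o])
    show "(inv_into UNIV p has_vector_derivative inverse (nth_deriv (Suc 0) p (inv_into UNIV p y))) (at y)"
      if "y \<in> range p" for y
      by (rule inv_into_has_vector_derivative[OF p inj nz that])
    show "kdiff k (range p) (\<lambda>y. inverse (nth_deriv (Suc 0) p (inv_into UNIV p y)))"
      by (rule kdiff_compose[OF o Suc.IH, where T = UNIV and h = "\<lambda>x. inverse (nth_deriv (Suc 0) p x)"])
         (use kdiff_inverse[OF open_UNIV kdiff_deriv[OF p] nz] in auto)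
  qed
qed simp


section \<open>Growth conditions and bump functions\<close>

definition smooth :: "(real \<Rightarrow> 'a::real_normed_vector) \<Rightarrow> bool" where
  "smooth f \<longleftrightarrow> (\<forall>k. kdiff k UNIV f)"

lemma smooth_kdiff: "smooth f \<Longrightarrow> kdiff k UNIV f"
  by (simp add: smooth_def)

lemma smooth_kdiff_on: "smooth f \<Longrightarrow> kdiff k S f"
  by (rule kdiff_subset[OF smooth_kdiff]) auto

lemma smooth_has_nth_deriv:
  "smooth f \<Longrightarrow> (nth_deriv j f has_vector_derivative nth_deriv (Suc j) f x) (at x)"
  using has_nth_deriv[OF smooth_kdiff, of f j "Suc j" x] by simp

lemma smooth_continuous_on: "smooth f \<Longrightarrow> continuous_on S (nth_deriv j f)"
  by (rule kdiff_continuous_on[OF smooth_kdiff_on lessI])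

lemma smooth_const: "smooth (\<lambda>x. c)"
  by (simp add: smooth_def kdiff_const)

lemma smooth_diff: "smooth f \<Longrightarrow> smooth g \<Longrightarrow> smooth (\<lambda>x. f x - g x)"
  by (simp add: smooth_def kdiff_diff)

lemma nth_deriv_diff:
  "smooth f \<Longrightarrow> smooth g \<Longrightarrow> nth_deriv j (\<lambda>x. f x - g x) x = nth_deriv j f x - nth_deriv j g x"
  using kdiff_diff(2)[OF open_UNIV smooth_kdiff smooth_kdiff, of f g j j x] by simp

lemma smooth_scaleR: "smooth f \<Longrightarrow> smooth g \<Longrightarrow> smooth (\<lambda>x. f x *\<^sub>R g x)"
  by (simp add: smooth_def kdiff_scaleR)

lemma smooth_compose: "smooth h \<Longrightarrow> smooth g \<Longrightarrow> smooth (\<lambda>x. h (g x))"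
  unfolding smooth_def by (metis kdiff_compose open_UNIV subset_UNIV)

lemma smooth_family:
  assumes "\<And>x. f x = F 0 x" "\<And>j x. (F j has_vector_derivative F (Suc j) x) (at x)"
  shows "smooth f" "nth_deriv j f x = F j x"
  using nth_deriv_family[of UNIV f F] assms unfolding smooth_def by auto

lemma
  fixes a b :: "'a::real_normed_vector"
  shows smooth_affine: "smooth (\<lambda>x. a + x *\<^sub>R b)"
    and nth_deriv_affine:
      "nth_deriv j (\<lambda>x. a + x *\<^sub>R b) x = (if j = 0 then a + x *\<^sub>R b else if j = 1 then b else 0)"
proof -
  define F where "F = (\<lambda>j x. if j = 0 then a + x *\<^sub>R b else if j = Suc 0 then b else 0)"
  have F: "(F j has_vector_derivative F (Suc j) x) (at x)" for j x
    by (auto simp: F_def intro!: derivative_eq_intros)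
  show "smooth (\<lambda>x. a + x *\<^sub>R b)"
    by (rule smooth_family(1)[of _ F]) (use F in \<open>auto simp: F_def\<close>)
  show "nth_deriv j (\<lambda>x. a + x *\<^sub>R b) x = (if j = 0 then a + x *\<^sub>R b else if j = 1 then b else 0)"
    using smooth_family(2)[of "\<lambda>x. a + x *\<^sub>R b" F j x] F by (auto simp: F_def)
qed

lemma smooth_funpow:
  fixes f :: "real \<Rightarrow> real"
  assumes "smooth f"
  shows "smooth (f ^^ n)"
proof (induction n)
  case 0
  then show ?case using smooth_affine[of 0 "1::real"] by (simp add: id_def)
next
  case (Suc n)
  then show ?case using smooth_compose[OF assms Suc] by (simp add: o_def)
qed

lemma smooth_iff_C_m: "smooth f \<longleftrightarrow> (\<forall>m\<ge>1. f \<in> C_m m)"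
proof
  assume "smooth f"
  then show "\<forall>m\<ge>1. f \<in> C_m m"
    using smooth_continuous_on smooth_has_nth_deriv differentiableI_vector
    unfolding C_m_def by blast
next
  assume *: "\<forall>m\<ge>1. f \<in> C_m m"
  show "smooth f" unfolding smooth_def kdiff_def
  proof (intro allI impI ballI)
    fix k j x assume "j < (k::nat)"
    then show "nth_deriv j f differentiable (at x)"
      using *[rule_format, of k] by (auto simp: C_m_def)
  qed
qed

text \<open>Constant and exponent may depend on the order: for the finitely many orders up to
  \<open>m\<close> they are summed, which is harmless because the weight is at least 1.\<close>

lemma O_M_iff: "f \<in> O_M \<longleftrightarrow>
   smooth f \<and> (\<forall>k. \<exists>C N. \<forall>x. norm (nth_deriv k f x) \<le> C * (1 + x\<^sup>2) ^ N)"
proof (intro iffI conjI allI)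
  assume f: "f \<in> O_M"
  then show "smooth f" unfolding smooth_iff_C_m by (fastforce simp: O_M_def O_mn_def)
  fix k
  \<comment> \<open>The order in \<open>O_M\<close> starts at 1; taking \<open>Suc k\<close> covers
    the case \<open>k = 0\<close> as well.\<close>
  from f obtain n where "f \<in> O_mn (Suc k) n" by (force simp: O_M_def)
  then have "bdd_above {norm (nth_deriv j f x) / (1 + \<bar>x\<bar>\<^sup>2) ^ n | x j. j \<le> Suc k}"
    by (simp add: O_mn_def)
  then obtain C where "\<And>y. y \<in> {norm (nth_deriv j f x) / (1 + \<bar>x\<bar>\<^sup>2) ^ n | x j. j \<le> Suc k} \<Longrightarrow> y \<le> C"
    by (auto simp: bdd_above_def)
  then have "norm (nth_deriv k f x) / (1 + x\<^sup>2) ^ n \<le> C" for x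
    by (metis (mono_tags, lifting) mem_Collect_eq power2_abs le_SucI order_refl)
  then have "norm (nth_deriv k f x) \<le> C * (1 + x\<^sup>2) ^ n" for x
    by (simp add: divide_le_eq add_pos_nonneg)
  then show "\<exists>C N. \<forall>x. norm (nth_deriv k f x) \<le> C * (1 + x\<^sup>2) ^ N" by blast
next
  assume *: "smooth f \<and> (\<forall>k. \<exists>C N. \<forall>x. norm (nth_deriv k f x) \<le> C * (1 + x\<^sup>2) ^ N)"
  then obtain C N where CN: "\<And>k x. norm (nth_deriv k f x) \<le> C k * (1 + x\<^sup>2) ^ N k" by metis
  show "f \<in> O_M" unfolding O_M_def
  proof (rule INT_I)
    fix m :: nat assume "m \<in> {1..}"
    \<comment> \<open>\<open>Suc\<close> keeps the exponent in the index set
      \<open>{1..}\<close>.\<close>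
    define n where "n = Suc (\<Sum>k\<le>m. N k)"
    define D where "D = (\<Sum>k\<le>m. \<bar>C k\<bar>)"
    have "norm (nth_deriv j f x) / (1 + x\<^sup>2) ^ n \<le> D" if "j \<le> m" for x j
    proof -
      have "N j \<le> (\<Sum>k\<le>m. N k)" "\<bar>C j\<bar> \<le> D"
        using that unfolding D_def by (auto intro!: member_le_sum)
      then have "\<bar>C j\<bar> * (1 + x\<^sup>2) ^ N j \<le> D * (1 + x\<^sup>2) ^ n"
        by (intro mult_mono power_increasing) (auto simp: n_def)
      moreover have "C j * (1 + x\<^sup>2) ^ N j \<le> \<bar>C j\<bar> * (1 + x\<^sup>2) ^ N j"
        by (intro mult_right_mono) auto
      ultimately have "norm (nth_deriv j f x) \<le> D * (1 + x\<^sup>2) ^ n"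
        using CN[of j x] by linarith
      then show ?thesis by (simp add: divide_le_eq add_pos_nonneg)
    qed
    then have "bdd_above {norm (nth_deriv j f x) / (1 + \<bar>x\<bar>\<^sup>2) ^ n | x j. j \<le> m}"
      unfolding bdd_above_def by auto
    then have "f \<in> O_mn m n"
      using * \<open>m \<in> {1..}\<close> by (auto simp: O_mn_def smooth_iff_C_m)
    then show "f \<in> (\<Union>n\<in>{1..}. O_mn m n)" by (auto simp: n_def)
  qed
qed

lemma weight_pow_le: "(1 + x\<^sup>2) ^ l \<le> 2 ^ l * (1 + \<bar>x\<bar> ^ (2 * l))" for x :: real
proof (cases "\<bar>x\<bar> \<le> 1")
  case True
  then have "x\<^sup>2 \<le> 1" by (simp add: abs_square_le_1)
  then have "(1 + x\<^sup>2) ^ l \<le> 2 ^ l" by (intro power_mono) auto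
  also have "\<dots> \<le> 2 ^ l * (1 + \<bar>x\<bar> ^ (2 * l))" by simp
  finally show ?thesis .
next
  case False
  then have "1 \<le> x\<^sup>2" using one_le_power[of "\<bar>x\<bar>" 2] by simp
  then have "(1 + x\<^sup>2) ^ l \<le> (2 * x\<^sup>2) ^ l" by (intro power_mono) auto
  also have "\<dots> = 2 ^ l * \<bar>x\<bar> ^ (2 * l)" by (simp add: power_mult_distrib power_mult)
  also have "\<dots> \<le> 2 ^ l * (1 + \<bar>x\<bar> ^ (2 * l))" by simp
  finally show ?thesis .
qed

lemma abs_le_weight: "\<bar>x\<bar> \<le> 1 + x\<^sup>2" for x :: real
  using sum_squares_bound[of 1 "\<bar>x\<bar>"] by simp

lemma weight_ge_1: "1 \<le> (1 + x\<^sup>2) ^ l" for x :: real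
  by simp

text \<open>Decay is expressed with the weight that measures growth in \<open>O_M\<close>, so that
  products are estimated by adding exponents.\<close>

lemma schwartz_iff: "v \<in> schwartz \<longleftrightarrow>
   smooth v \<and> (\<forall>k l. \<exists>C. \<forall>x. (1 + x\<^sup>2) ^ l * norm (nth_deriv k v x) \<le> C)"
proof (intro iffI conjI allI)
  assume v: "v \<in> schwartz"
  then show "smooth v" by (simp add: smooth_iff_C_m schwartz_def)
  fix k l
  have b: "\<exists>C. \<forall>x. \<bar>x\<bar> ^ l * norm (nth_deriv k v x) \<le> C" for l
    using v by (force simp: schwartz_def bdd_above_def)
  obtain C D where C: "\<And>x. \<bar>x\<bar> ^ 0 * norm (nth_deriv k v x) \<le> C"
    and D: "\<And>x. \<bar>x\<bar> ^ (2 * l) * norm (nth_deriv k v x) \<le> D"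
    using b by metis
  have "(1 + x\<^sup>2) ^ l * norm (nth_deriv k v x) \<le> 2 ^ l * (C + D)" for x
  proof -
    have "(1 + x\<^sup>2) ^ l * norm (nth_deriv k v x) \<le> 2 ^ l * (1 + \<bar>x\<bar> ^ (2 * l)) * norm (nth_deriv k v x)"
      by (intro mult_right_mono weight_pow_le) auto
    also have "\<dots> \<le> 2 ^ l * (C + D)"
      using add_mono[OF C[of x] D[of x]] by (simp add: mult.assoc distrib_right)
    finally show ?thesis .
  qed
  then show "\<exists>C. \<forall>x. (1 + x\<^sup>2) ^ l * norm (nth_deriv k v x) \<le> C" by blast
next
  assume *: "smooth v \<and> (\<forall>k l. \<exists>C. \<forall>x. (1 + x\<^sup>2) ^ l * norm (nth_deriv k v x) \<le> C)"
  have "v \<in> C_m m" for m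
    using * smooth_continuous_on smooth_has_nth_deriv differentiableI_vector
    unfolding C_m_def by blast
  moreover have "bdd_above (range (\<lambda>x. \<bar>x\<bar> ^ l * norm (nth_deriv k v x)))" for k l
  proof -
    obtain C where C: "\<And>x. (1 + x\<^sup>2) ^ l * norm (nth_deriv k v x) \<le> C" using * by metis
    have "\<bar>x\<bar> ^ l * norm (nth_deriv k v x) \<le> C" for x
    proof -
      have "\<bar>x\<bar> ^ l * norm (nth_deriv k v x) \<le> (1 + x\<^sup>2) ^ l * norm (nth_deriv k v x)"
        by (intro mult_right_mono power_mono abs_le_weight) auto
      then show ?thesis using C[of x] by linarith
    qed
    then show ?thesis by (auto simp: bdd_above_def)
  qed
  ultimately show "v \<in> schwartz" by (auto simp: schwartz_def)
qed

lemma schwartz_decay: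
  assumes "v \<in> schwartz"
  obtains C where "0 \<le> C" "\<And>x. (1 + x\<^sup>2) ^ l * norm (v x) \<le> C"
proof -
  obtain C where C: "\<And>x. (1 + x\<^sup>2) ^ l * norm (nth_deriv 0 v x) \<le> C"
    using assms by (metis schwartz_iff)
  moreover have "0 \<le> C" using order_trans[OF _ C[of 0]] by simp
  ultimately show ?thesis using that by simp
qed

text \<open>The number \<open>y\<close> is quantified after \<open>B\<close>, so one bound serves a
  whole family of functions. The power with exponent \<open>l\<close> is spare decay.\<close>

lemma schwartz_times_growth:
  assumes "v \<in> schwartz"
  obtains B where "0 \<le> B" "\<And>x y. \<bar>y\<bar> \<le> C * (1 + x\<^sup>2) ^ N \<Longrightarrow> (1 + x\<^sup>2) ^ l * norm (v x) * \<bar>y\<bar> \<le> B"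
proof -
  obtain D where D: "0 \<le> D" "\<And>x. (1 + x\<^sup>2) ^ (l + N) * norm (v x) \<le> D"
    using schwartz_decay[OF assms] by blast
  have "(1 + x\<^sup>2) ^ l * norm (v x) * \<bar>y\<bar> \<le> \<bar>C\<bar> * D" if "\<bar>y\<bar> \<le> C * (1 + x\<^sup>2) ^ N" for x y
  proof -
    have "\<bar>y\<bar> \<le> \<bar>C\<bar> * (1 + x\<^sup>2) ^ N"
      by (rule order_trans[OF that]) (intro mult_right_mono, auto)
    then have "(1 + x\<^sup>2) ^ l * norm (v x) * \<bar>y\<bar> \<le> (1 + x\<^sup>2) ^ l * norm (v x) * (\<bar>C\<bar> * (1 + x\<^sup>2) ^ N)"
      by (intro mult_left_mono) auto
    also have "\<dots> = \<bar>C\<bar> * ((1 + x\<^sup>2) ^ (l + N) * norm (v x))" by (simp add: power_add mult_ac)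
    also have "\<dots> \<le> \<bar>C\<bar> * D" by (intro mult_left_mono D) auto
    finally show ?thesis .
  qed
  with D(1) show ?thesis by (intro that[of "\<bar>C\<bar> * D"]) auto
qed

section \<open>Compactly supported functions and a bump\<close>

lemma compact_support_nth_deriv_0:
  assumes "\<And>x. L < \<bar>x\<bar> \<Longrightarrow> f x = 0" "L < \<bar>x\<bar>"
  shows "nth_deriv k f x = 0"
proof -
  have "open {x::real. L < \<bar>x\<bar>}" by (intro open_Collect_less continuous_intros)
  then have "nth_deriv k f x = nth_deriv k (\<lambda>x. 0) x"
    by (rule nth_deriv_cong) (use assms in auto)
  also have "\<dots> = 0" by (cases k) (auto simp: nth_deriv_const)
  finally show ?thesis .
qed

lemma compact_support_bounded:
  assumes "smooth f" "\<And>x. L < \<bar>x\<bar> \<Longrightarrow> f x = 0" "continuous_on UNIV (g :: real \<Rightarrow> real)"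
  shows "\<exists>B. \<forall>x. g x * norm (nth_deriv k f x) \<le> B"
proof -
  have "compact ((\<lambda>x. g x * norm (nth_deriv k f x)) ` {-L..L})"
    by (intro compact_continuous_image continuous_intros smooth_continuous_on assms(1)
        continuous_on_subset[OF assms(3)]) auto
  then have "bdd_above ((\<lambda>x. g x * norm (nth_deriv k f x)) ` {-L..L})"
    by (intro bounded_imp_bdd_above compact_imp_bounded)
  then obtain B where "\<forall>y\<in>(\<lambda>x. g x * norm (nth_deriv k f x)) ` {-L..L}. y \<le> B"
    unfolding bdd_above_def by blast
  then have B: "g x * norm (nth_deriv k f x) \<le> B" if "x \<in> {-L..L}" for x
    using that by blast
  have "g x * norm (nth_deriv k f x) \<le> max B 0" for x
  proof (cases "L < \<bar>x\<bar>")
    case True then show ?thesis using compact_support_nth_deriv_0[where k = k, OF assms(2) True] by simp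
  next
    case False
    then have "x \<in> {-L..L}" by auto
    from B[OF this] show ?thesis by (simp add: le_max_iff_disj)
  qed
  then show ?thesis by blast
qed

lemma compact_support_O_M:
  assumes "smooth f" "\<And>x. L < \<bar>x\<bar> \<Longrightarrow> f x = 0"
  shows "f \<in> O_M"
  unfolding O_M_iff
proof (intro conjI allI)
  fix k
  obtain B where "\<And>x. 1 * norm (nth_deriv k f x) \<le> B"
    using compact_support_bounded[OF assms continuous_on_const[of _ 1]] by blast
  then have "\<forall>x. norm (nth_deriv k f x) \<le> B * (1 + x\<^sup>2) ^ 0" by simp
  then show "\<exists>C N. \<forall>x. norm (nth_deriv k f x) \<le> C * (1 + x\<^sup>2) ^ N" by blast
qed (rule assms)

text \<open>The classical flat function for \<open>n = 0\<close>, together with the powers of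
  \<open>1 / x\<close> that differentiation produces: the linear span of the family is closed under
  derivatives.\<close>

definition flat_pow :: "nat \<Rightarrow> real \<Rightarrow> real" where
  "flat_pow n x = (if 0 < x then (1 / x) ^ n * exp (- (1 / x)) else 0)"

lemma flat_pow_tendsto_0: "(flat_pow n \<longlongrightarrow> 0) (at 0)"
proof (rule filterlim_split_at)
  have "eventually (\<lambda>x. flat_pow n x = 0) (at_left 0)"
    by (auto simp: flat_pow_def eventually_at_filter)
  then show "(flat_pow n \<longlongrightarrow> 0) (at_left 0)" by (rule tendsto_eventually)
  have "((\<lambda>x. inverse x ^ n / exp (inverse x)) \<longlongrightarrow> (0::real)) (at_right 0)"
    by (rule filterlim_compose[OF tendsto_power_div_exp_0 filterlim_inverse_at_top_right])
  moreover have "eventually (\<lambda>x. inverse x ^ n / exp (inverse x) = flat_pow n x) (at_right 0)"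
    by (auto simp: flat_pow_def eventually_at_filter exp_minus divide_inverse)
  ultimately show "(flat_pow n \<longlongrightarrow> 0) (at_right 0)" by (rule Lim_transform_eventually)
qed

lemma flat_pow_deriv:
  "(flat_pow n has_vector_derivative flat_pow (Suc (Suc n)) x - real n *\<^sub>R flat_pow (Suc n) x) (at x)"
proof -
  consider "x < 0" | "x = 0" | "0 < x" by linarith
  then have "(flat_pow n has_real_derivative flat_pow (Suc (Suc n)) x - real n * flat_pow (Suc n) x) (at x)"
  proof cases
    case 1
    have "((\<lambda>x. 0) has_real_derivative 0) (at x)" by simp
    then have "(flat_pow n has_real_derivative 0) (at x)"
      by (rule has_field_derivative_transform_within_open[of _ _ _ "{..<0}"])
         (use 1 in \<open>auto simp: flat_pow_def\<close>)
    then show ?thesis using 1 by (simp add: flat_pow_def)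
  next
    case 2
    \<comment> \<open>Division by \<open>h\<close> raises the index by one, so the difference
      quotient at 0 again belongs to the family and tends to 0.\<close>
    have "eventually (\<lambda>h. flat_pow (Suc n) h = (flat_pow n (0 + h) - flat_pow n 0) / h) (at 0)"
      by (auto simp: flat_pow_def eventually_at_filter)
    with flat_pow_tendsto_0 have "((\<lambda>h. (flat_pow n (0 + h) - flat_pow n 0) / h) \<longlongrightarrow> 0) (at 0)"
      by (rule Lim_transform_eventually)
    then show ?thesis by (simp add: DERIV_def 2 flat_pow_def)
  next
    case 3
    have "((\<lambda>x. inverse x ^ n * exp (- inverse x)) has_real_derivative
        real n * inverse x ^ (n - 1) * (- (inverse x * 1 * inverse x)) * exp (- inverse x)
        + exp (- inverse x) * (- (- (inverse x * 1 * inverse x))) * inverse x ^ n) (at x)"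
      using 3 by (auto intro!: derivative_eq_intros simp: algebra_simps)
    also have "real n * inverse x ^ (n - 1) * (- (inverse x * 1 * inverse x)) * exp (- inverse x)
        + exp (- inverse x) * (- (- (inverse x * 1 * inverse x))) * inverse x ^ n
      = flat_pow (Suc (Suc n)) x - real n * flat_pow (Suc n) x"
      using 3 by (cases n) (auto simp: flat_pow_def divide_inverse algebra_simps)
    finally have "((\<lambda>x. inverse x ^ n * exp (- inverse x)) has_real_derivative
        flat_pow (Suc (Suc n)) x - real n * flat_pow (Suc n) x) (at x)" .
    then show ?thesis
      by (rule has_field_derivative_transform_within_open[of _ _ _ "{0<..}"])
         (use 3 in \<open>auto simp: flat_pow_def divide_inverse\<close>)
  qed
  then show ?thesis by (simp add: has_real_derivative_iff_has_vector_derivative)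
qed

lemma smooth_flat_pow: "smooth (flat_pow n)"
proof -
  have "kdiff k UNIV (flat_pow n)" for k
  proof (induction k arbitrary: n)
    case (Suc k)
    show ?case
      by (rule kdiff_SucI[OF open_UNIV flat_pow_deriv])
         (intro kdiff_diff(1) kdiff_scaleR(1) kdiff_const open_UNIV Suc.IH)
  qed simp
  then show ?thesis by (simp add: smooth_def)
qed

lemma bump_exists:
  obtains \<phi> :: "real \<Rightarrow> real" and \<delta> :: real where "smooth \<phi>" "\<phi> 0 = 1" "\<And>x. 0 \<le> \<phi> x" "0 < \<delta>"
    "\<And>x. \<bar>x\<bar> \<le> 1 \<Longrightarrow> \<delta> \<le> \<phi> x" "\<And>x. 2 < \<bar>x\<bar> \<Longrightarrow> \<phi> x = 0"
proof
  \<comment> \<open>At 0 both factors are \<open>exp (- (1 / 2))\<close>, which \<open>exp 1\<close>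
    normalises to 1. For \<open>\<bar>x\<bar> \<le> 1\<close> both arguments are at least 1, so each
    factor is at least \<open>exp (-1)\<close>.\<close>
  define \<phi> where "\<phi> x = exp 1 *\<^sub>R (flat_pow 0 (2 + x *\<^sub>R 1) *\<^sub>R flat_pow 0 (2 + x *\<^sub>R (-1)))" for x :: real
  show "smooth \<phi>" unfolding \<phi>_def
    by (intro smooth_scaleR smooth_const smooth_compose[OF smooth_flat_pow] smooth_affine)
  show "\<phi> 0 = 1" by (simp add: \<phi>_def flat_pow_def exp_add[symmetric])
  show "\<And>x. 0 \<le> \<phi> x" by (simp add: \<phi>_def flat_pow_def)
  show "exp 1 * (exp (-1) * exp (-1)) > (0::real)" by simp
  show "exp 1 * (exp (-1) * exp (-1)) \<le> \<phi> x" if "\<bar>x\<bar> \<le> 1" for x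
    using that by (auto simp: \<phi>_def flat_pow_def intro!: mult_left_mono mult_mono)
  show "\<phi> x = 0" if "2 < \<bar>x\<bar>" for x using that by (auto simp: \<phi>_def flat_pow_def)
qed


section \<open>Domination by Schwartz functions\<close>

text \<open>Bumps centred at the \<open>t j\<close> are summed with heights that decay faster than
  every power of \<open>1 + (t j)\<^sup>2\<close>. All terms are nonnegative, so the sum dominates
  each of them.\<close>

lemma schwartz_series:
  fixes b t :: "nat \<Rightarrow> real" and \<phi> :: "real \<Rightarrow> real"
  assumes \<phi>: "smooth \<phi>" "\<And>x. 0 \<le> \<phi> x" "\<And>x. 2 < \<bar>x\<bar> \<Longrightarrow> \<phi> x = 0"
    and b: "\<And>j. 0 \<le> b j" "\<And>l. summable (\<lambda>j. b j * (1 + (t j)\<^sup>2) ^ l)"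
  shows "\<exists>W\<in>(schwartz :: (real \<Rightarrow> complex) set). \<forall>j x. b j * \<phi> (x - t j) \<le> cmod (W x)"
proof -
  have "\<exists>B. \<forall>x. \<bar>nth_deriv k \<phi> x\<bar> \<le> B" for k
    using compact_support_bounded[where k = k, OF \<phi>(1,3) continuous_on_const[of _ 1]] by simp
  then obtain B where B: "\<And>k x. \<bar>nth_deriv k \<phi> x\<bar> \<le> B k" by metis
  have B0: "0 \<le> B k" for k using B[of k 0] by linarith
  have b1: "summable b" using b(2)[of 0] by simp
  have le: "\<bar>b j * nth_deriv k \<phi> (x - t j)\<bar> \<le> B k * b j" for k j x
    using B[of k "x - t j"] b(1)[of j] by (simp add: abs_mult mult.commute[of "B k"] mult_left_mono)
  have sm: "summable (\<lambda>j. \<bar>b j * nth_deriv k \<phi> (x - t j)\<bar>)" for k x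
    by (rule summable_comparison_test[OF _ summable_mult[OF b1, of "B k"]]) (use le in auto)
  define F where "F k x = (\<Sum>j. b j * nth_deriv k \<phi> (x - t j))" for k x
  have F: "(F k has_vector_derivative F (Suc k) x) (at x)" for k x
  proof -
    have d: "((\<lambda>x. b j * nth_deriv k \<phi> (x - t j)) has_real_derivative
        b j * nth_deriv (Suc k) \<phi> (x - t j)) (at x within UNIV)" for j x
    proof -
      have "(nth_deriv k \<phi> has_real_derivative nth_deriv (Suc k) \<phi> (x - t j)) (at (x - t j))"
        using smooth_has_nth_deriv[OF \<phi>(1)] by (simp add: has_real_derivative_iff_has_vector_derivative)
      from DERIV_chain'[where f = "\<lambda>x. x - t j" and D = 1 and s = UNIV, OF _ this]
      have "((\<lambda>x. nth_deriv k \<phi> (x - t j)) has_real_derivative nth_deriv (Suc k) \<phi> (x - t j)) (at x)"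
        using DERIV_diff[OF DERIV_ident DERIV_const[of "t j"]] by auto
      then show ?thesis by (rule DERIV_cmult)
    qed
    have "uniformly_convergent_on UNIV (\<lambda>n x. \<Sum>i<n. b i * nth_deriv (Suc k) \<phi> (x - t i))"
      by (rule Weierstrass_m_test'[OF _ summable_mult[OF b1, of "B (Suc k)"]]) (use le in auto)
    from has_field_derivative_series'(2)[OF convex_UNIV d this UNIV_I _, of x x]
    show ?thesis
      using summable_rabs_cancel[OF sm[of k x]]
      unfolding F_def[abs_def] by (simp add: has_real_derivative_iff_has_vector_derivative)
  qed
  define W where "W x = complex_of_real (F 0 x)" for x
  have F0: "smooth (F 0)" "nth_deriv k (F 0) x = F k x" for k x
    using smooth_family[of "F 0" F] F by auto
  have W: "smooth W" "nth_deriv k W x = complex_of_real (F k x)" for k x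
    unfolding W_def
    using kdiff_bounded_linear(1)[OF bounded_linear_of_real open_UNIV smooth_kdiff[OF F0(1)]]
      kdiff_bounded_linear(2)[OF bounded_linear_of_real open_UNIV smooth_kdiff[OF F0(1)] order_refl UNIV_I, of k x]
      F0(2) by (auto simp: smooth_def)
  have "\<exists>C. \<forall>x. (1 + x\<^sup>2) ^ l * norm (nth_deriv k W x) \<le> C" for k l
  proof (intro exI allI)
    fix x
    have *: "(1 + x\<^sup>2) ^ l * \<bar>b j * nth_deriv k \<phi> (x - t j)\<bar> \<le> (9 ^ l * B k) * (b j * (1 + (t j)\<^sup>2) ^ l)" for j
    proof (cases "2 < \<bar>x - t j\<bar>")
      case True
      then show ?thesis using compact_support_nth_deriv_0[where k = k, OF \<phi>(3) True] B0 b(1) by simp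
    next
      case False
      \<comment> \<open>On the support of the bump, the weight at \<open>x\<close> is at most 9
        times the weight at \<open>t j\<close>.\<close>
      have "x\<^sup>2 \<le> (\<bar>t j\<bar> + 2)\<^sup>2" using False by (intro power2_le_iff_abs_le[THEN iffD2]) auto
      also have "\<dots> \<le> 8 + 9 * (t j)\<^sup>2"
        using sum_squares_bound[of "\<bar>t j\<bar>" 2]
            by (simp add: power2_sum) (smt (verit) zero_le_power2)
      finally have "1 + x\<^sup>2 \<le> 9 * (1 + (t j)\<^sup>2)" by simp
      then have "(1 + x\<^sup>2) ^ l \<le> (9 * (1 + (t j)\<^sup>2)) ^ l" by (intro power_mono) auto
      then have "(1 + x\<^sup>2) ^ l * \<bar>b j * nth_deriv k \<phi> (x - t j)\<bar> \<le> (9 * (1 + (t j)\<^sup>2)) ^ l * (B k * b j)"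
        using le by (intro mult_mono) auto
      then show ?thesis by (simp only: power_mult_distrib mult_ac)
    qed
    have "(1 + x\<^sup>2) ^ l * \<bar>F k x\<bar> \<le> (1 + x\<^sup>2) ^ l * (\<Sum>j. \<bar>b j * nth_deriv k \<phi> (x - t j)\<bar>)"
      unfolding F_def by (intro mult_left_mono summable_rabs sm) auto
    also have "\<dots> = (\<Sum>j. (1 + x\<^sup>2) ^ l * \<bar>b j * nth_deriv k \<phi> (x - t j)\<bar>)"
      by (rule suminf_mult[symmetric, OF sm])
    also have "\<dots> \<le> (\<Sum>j. (9 ^ l * B k) * (b j * (1 + (t j)\<^sup>2) ^ l))"
      by (rule suminf_le[OF * summable_mult[OF sm] summable_mult[OF b(2)]])
    finally show "(1 + x\<^sup>2) ^ l * norm (nth_deriv k W x) \<le> (\<Sum>j. (9 ^ l * B k) * (b j * (1 + (t j)\<^sup>2) ^ l))"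
      by (simp add: W)
  qed
  then have "W \<in> schwartz" using W(1) by (simp add: schwartz_iff)
  moreover have "b j * \<phi> (x - t j) \<le> cmod (W x)" for j x
  proof -
    have "(\<Sum>i\<in>{j}. b i * \<phi> (x - t i)) \<le> (\<Sum>i. b i * \<phi> (x - t i))"
      using summable_rabs_cancel[OF sm[of 0 x]] b(1) \<phi>(2) by (intro sum_le_suminf) auto
    then show ?thesis by (simp add: W_def F_def)
  qed
  ultimately show ?thesis by blast
qed

text \<open>Since the points \<open>y i\<close> may repeat or accumulate, they are grouped into
  cells of bounded size. The supremum over a cell becomes the height of a bump, and the sum of the
  bumps majorises all values.\<close>

lemma rapidly_decreasing_dominated_by_schwartz:
  fixes y r :: "'i \<Rightarrow> real"
  assumes "\<And>l. \<exists>C. \<forall>i\<in>I. (1 + (y i)\<^sup>2) ^ l * \<bar>r i\<bar> \<le> C"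
  shows "\<exists>w\<in>(schwartz :: (real \<Rightarrow> complex) set). \<forall>i\<in>I. \<bar>r i\<bar> \<le> cmod (w (y i))"
proof -
  obtain \<phi> :: "real \<Rightarrow> real" and \<delta> :: real where \<phi>: "smooth \<phi>" "\<phi> 0 = 1" "\<And>x. 0 \<le> \<phi> x" "0 < \<delta>"
    "\<And>x. \<bar>x\<bar> \<le> 1 \<Longrightarrow> \<delta> \<le> \<phi> x" "\<And>x. 2 < \<bar>x\<bar> \<Longrightarrow> \<phi> x = 0"
    using bump_exists by blast
  obtain C where C: "\<And>l i. i \<in> I \<Longrightarrow> (1 + (y i)\<^sup>2) ^ l * \<bar>r i\<bar> \<le> C l"
    using assms by metis
  \<comment> \<open>The centres are 0, -1/2, 1, -3/2, 2, ...: every point has distance at most 1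
    from one of them, and \<open>\<bar>t j\<bar>\<close> is \<open>j / 2\<close>, which later gives
    summability.\<close>
  define t where "t j = (-1) ^ j * (real j / 2)" for j
  have t2: "(t j)\<^sup>2 = (real j)\<^sup>2 / 4" for j
    by (simp add: t_def minus_one_power_iff power_divide)
  have cover: "\<exists>j. \<bar>z - t j\<bar> \<le> 1" for z
  proof (cases "0 \<le> z")
    case True
    have "real (nat \<lfloor>z\<rfloor>) = of_int \<lfloor>z\<rfloor>" using True by simp
    then have "\<bar>z - t (2 * nat \<lfloor>z\<rfloor>)\<bar> \<le> 1" by (simp add: t_def) linarith
    then show ?thesis by blast
  next
    case False
    have "real (nat \<lfloor>- z\<rfloor>) = of_int \<lfloor>- z\<rfloor>" using False by simp
    then have "\<bar>z - t (Suc (2 * nat \<lfloor>- z\<rfloor>))\<bar> \<le> 1" by (simp add: t_def field_simps) linarith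
    then show ?thesis by blast
  qed
  \<comment> \<open>Inserting 0 keeps the supremum over an empty cell meaningful and nonnegative;
    the division by \<open>\<delta>\<close> compensates for the height of the bump on its
    cell.\<close>
  define P where "P j = insert 0 {\<bar>r i\<bar> / \<delta> | i. i \<in> I \<and> \<bar>y i - t j\<bar> \<le> 1}" for j
  define b where "b j = Sup (P j)" for j
  have bdd: "bdd_above (P j)" for j
  proof -
    have "\<bar>r i\<bar> / \<delta> \<le> max 0 (C 0 / \<delta>)" if "i \<in> I" for i
      using C[OF that, of 0] \<phi>(4) by (auto simp: le_max_iff_disj divide_right_mono)
    then show ?thesis by (auto simp: P_def bdd_above_def intro!: exI[of _ "max 0 (C 0 / \<delta>)"])
  qed
  have b0: "0 \<le> b j" for j unfolding b_def by (rule cSup_upper[OF _ bdd]) (simp add: P_def)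
  have br: "\<bar>r i\<bar> / \<delta> \<le> b j" if "i \<in> I" "\<bar>y i - t j\<bar> \<le> 1" for i j
    unfolding b_def by (rule cSup_upper[OF _ bdd]) (use that in \<open>auto simp: P_def\<close>)
  have bl: "b j * (1 + (t j)\<^sup>2) ^ l \<le> 9 ^ l * \<bar>C l\<bar> / \<delta>" for j l
  proof -
    have "b j \<le> 9 ^ l * \<bar>C l\<bar> / \<delta> / (1 + (t j)\<^sup>2) ^ l"
      unfolding b_def
    proof (rule cSup_least)
      fix p assume "p \<in> P j"
      then consider "p = 0" | i where "p = \<bar>r i\<bar> / \<delta>" "i \<in> I" "\<bar>y i - t j\<bar> \<le> 1"
        by (auto simp: P_def)
      then show "p \<le> 9 ^ l * \<bar>C l\<bar> / \<delta> / (1 + (t j)\<^sup>2) ^ l"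
      proof cases
        case 1 then show ?thesis using \<phi>(4) by (simp add: add_nonneg_nonneg)
      next
        case 2
        have "(t j)\<^sup>2 \<le> (\<bar>y i\<bar> + 2)\<^sup>2" using 2 by (intro power2_le_iff_abs_le[THEN iffD2]) auto
        also have "\<dots> \<le> 8 + 9 * (y i)\<^sup>2"
          using sum_squares_bound[of "\<bar>y i\<bar>" 2]
            by (simp add: power2_sum) (smt (verit) zero_le_power2)
        finally have "1 + (t j)\<^sup>2 \<le> 9 * (1 + (y i)\<^sup>2)" by simp
        then have "(1 + (t j)\<^sup>2) ^ l \<le> (9 * (1 + (y i)\<^sup>2)) ^ l" by (intro power_mono) auto
        then have "\<bar>r i\<bar> * (1 + (t j)\<^sup>2) ^ l \<le> \<bar>r i\<bar> * (9 * (1 + (y i)\<^sup>2)) ^ l"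
          by (intro mult_left_mono) auto
        also have "\<dots> = 9 ^ l * ((1 + (y i)\<^sup>2) ^ l * \<bar>r i\<bar>)"
          by (simp only: power_mult_distrib mult_ac)
        also have "\<dots> \<le> 9 ^ l * \<bar>C l\<bar>" using C[OF 2(2), of l] by (intro mult_left_mono) auto
        finally have "\<bar>r i\<bar> \<le> 9 ^ l * \<bar>C l\<bar> / (1 + (t j)\<^sup>2) ^ l"
          by (simp add: pos_le_divide_eq add_pos_nonneg)
        from divide_right_mono[OF this, of \<delta>] show ?thesis
          using 2(1) \<phi>(4) by (simp add: mult.commute)
      qed
    qed (simp add: P_def)
    then show ?thesis by (subst (asm) pos_le_divide_eq) (auto simp: add_pos_nonneg)
  qed
  have "summable (\<lambda>j. b j * (1 + (t j)\<^sup>2) ^ l)" for l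
  proof (rule summable_comparison_test)
    \<comment> \<open>One more power of the weight is spent: \<open>1 + (t j)\<^sup>2\<close>
      exceeds \<open>(real j)\<^sup>2 / 4\<close>, which leaves a convergent majorant.\<close>
    define D where "D = 9 ^ Suc l * \<bar>C (Suc l)\<bar> / \<delta>"
    show "\<exists>N. \<forall>j\<ge>N. norm (b j * (1 + (t j)\<^sup>2) ^ l) \<le> (4 * D) * inverse (real j ^ 2)"
    proof (intro exI[of _ 1] allI impI)
      fix j :: nat assume j: "1 \<le> j"
      have nn: "0 \<le> b j * (1 + (t j)\<^sup>2) ^ l" using b0 by simp
      have "b j * (1 + (t j)\<^sup>2) ^ l * ((real j)\<^sup>2 / 4) \<le> b j * (1 + (t j)\<^sup>2) ^ l * (1 + (t j)\<^sup>2)"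
        using nn by (intro mult_left_mono) (auto simp: t2)
      also have "\<dots> \<le> D" using bl[of j "Suc l"] by (simp add: D_def mult_ac)
      finally show "norm (b j * (1 + (t j)\<^sup>2) ^ l) \<le> (4 * D) * inverse (real j ^ 2)"
        using nn j by (simp add: field_simps)
    qed
    show "summable (\<lambda>j. (4 * D) * inverse (real j ^ 2))"
      by (intro summable_mult inverse_power_summable) simp
  qed
  from schwartz_series[where b = b and t = t, OF \<phi>(1,3,6) b0 this] obtain W :: "real \<Rightarrow> complex"
    where W: "W \<in> schwartz" "\<And>j x. b j * \<phi> (x - t j) \<le> cmod (W x)" by blast
  have "\<bar>r i\<bar> \<le> cmod (W (y i))" if "i \<in> I" for i
  proof -
    obtain j where j: "\<bar>y i - t j\<bar> \<le> 1" using cover by blast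
    have "\<bar>r i\<bar> = \<bar>r i\<bar> / \<delta> * \<delta>" using \<phi>(4) by simp
    also have "\<dots> \<le> b j * \<phi> (y i - t j)"
      using br[OF that j] \<phi>(4,5) j b0 by (intro mult_mono) auto
    also have "\<dots> \<le> cmod (W (y i))" by (rule W)
    finally show ?thesis .
  qed
  with W(1) show ?thesis by blast
qed

text \<open>If every polynomial bound fails, there are points at which \<open>r\<close> beats the
  \<open>j\<close>-th power of the weight by a factor \<open>j\<close>. The reciprocals of these
  powers satisfy the decay condition of the domination principle even when the points stay bounded,
  and a Schwartz function above them makes the products exceed every \<open>j\<close>.\<close>

lemma polynomial_growth_if_schwartz_bounded:
  fixes y r :: "'i \<Rightarrow> real"
  assumes "\<And>v :: real \<Rightarrow> complex. v \<in> schwartz \<Longrightarrow> \<exists>B. \<forall>i\<in>I. cmod (v (y i)) * \<bar>r i\<bar> \<le> B"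
  shows "\<exists>C N. \<forall>i\<in>I. \<bar>r i\<bar> \<le> C * (1 + (y i)\<^sup>2) ^ N"
proof (rule ccontr)
  assume "\<not> ?thesis"
  then have "\<forall>j. \<exists>i\<in>I. real j * (1 + (y i)\<^sup>2) ^ j < \<bar>r i\<bar>"
    by (meson not_le)
  then obtain i where i: "\<And>j. i j \<in> I" "\<And>j. real j * (1 + (y (i j))\<^sup>2) ^ j < \<bar>r (i j)\<bar>" by metis
  define s where "s j = 1 / (1 + (y (i j))\<^sup>2) ^ j" for j
  have "\<exists>w\<in>(schwartz :: (real \<Rightarrow> complex) set). \<forall>j\<in>UNIV. \<bar>s j\<bar> \<le> cmod (w (y (i j)))"
  proof (rule rapidly_decreasing_dominated_by_schwartz)
    fix l
    \<comment> \<open>For fixed \<open>l\<close> the product is at most 1 once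
      \<open>j \<ge> l\<close>; the finite sum covers the remaining indices.\<close>
    have "(1 + (y (i j))\<^sup>2) ^ l * \<bar>s j\<bar> \<le> 1 + (\<Sum>k<l. (1 + (y (i k))\<^sup>2) ^ l * \<bar>s k\<bar>)" for j
    proof (cases "j < l")
      case True
      have "(1 + (y (i j))\<^sup>2) ^ l * \<bar>s j\<bar> \<le> (\<Sum>k<l. (1 + (y (i k))\<^sup>2) ^ l * \<bar>s k\<bar>)"
        using True by (intro member_le_sum) auto
      then show ?thesis by simp
    next
      case False
      have "(1 + (y (i j))\<^sup>2) ^ l \<le> (1 + (y (i j))\<^sup>2) ^ j" using False by (intro power_increasing) auto
      then have "(1 + (y (i j))\<^sup>2) ^ l * \<bar>s j\<bar> \<le> 1" by (simp add: s_def divide_le_eq add_pos_nonneg)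
      moreover have "0 \<le> (\<Sum>k<l. (1 + (y (i k))\<^sup>2) ^ l * \<bar>s k\<bar>)" by (intro sum_nonneg) auto
      ultimately show ?thesis by linarith
    qed
    then show "\<exists>C. \<forall>j\<in>UNIV. (1 + (y (i j))\<^sup>2) ^ l * \<bar>s j\<bar> \<le> C" by blast
  qed
  then obtain w :: "real \<Rightarrow> complex" where w: "w \<in> schwartz" "\<And>j. \<bar>s j\<bar> \<le> cmod (w (y (i j)))" by blast
  obtain B where B: "\<And>i. i \<in> I \<Longrightarrow> cmod (w (y i)) * \<bar>r i\<bar> \<le> B" using assms[OF w(1)] by blast
  have "real j \<le> B" for j
  proof -
    have "real j = \<bar>s j\<bar> * (real j * (1 + (y (i j))\<^sup>2) ^ j)"
      by (simp add: s_def add_nonneg_eq_0_iff)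
    also have "\<dots> \<le> cmod (w (y (i j))) * \<bar>r (i j)\<bar>"
      using w(2)[of j] i(2)[of j] by (intro mult_mono) auto
    also have "\<dots> \<le> B" by (rule B[OF i(1)])
    finally show ?thesis .
  qed
  then show False using reals_Archimedean2[of B] by (meson not_le)
qed


section \<open>The space of multipliers\<close>

lemma O_M_smooth: "f \<in> O_M \<Longrightarrow> smooth f"
  by (simp add: O_M_iff)

lemma weight_bound_mono:
  fixes x :: real
  assumes "y \<le> C * (1 + x\<^sup>2) ^ N" "\<bar>C\<bar> \<le> D" "N \<le> M"
  shows "y \<le> D * (1 + x\<^sup>2) ^ M"
proof -
  have "C * (1 + x\<^sup>2) ^ N \<le> D * (1 + x\<^sup>2) ^ M"
    by (rule mult_mono[OF _ power_increasing]) (use assms in auto)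
  with assms(1) show ?thesis by linarith
qed

text \<open>The constant is made at least 1 so that \<open>C * (1 + (y i)\<^sup>2) ^ N\<close> can
  play the role of \<open>M\<close> in the composition estimates.\<close>

lemma uniform_growth:
  fixes F :: "nat \<Rightarrow> 'i \<Rightarrow> real" and y :: "'i \<Rightarrow> real"
  assumes "\<And>j. j \<le> k \<Longrightarrow> \<exists>C N. \<forall>i\<in>I. F j i \<le> C * (1 + (y i)\<^sup>2) ^ N"
  obtains C N where "1 \<le> C" "\<And>j i. j \<le> k \<Longrightarrow> i \<in> I \<Longrightarrow> F j i \<le> C * (1 + (y i)\<^sup>2) ^ N"
proof -
  obtain C N where CN: "\<And>j i. j \<le> k \<Longrightarrow> i \<in> I \<Longrightarrow> F j i \<le> C j * (1 + (y i)\<^sup>2) ^ N j"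
    using assms by metis
  show ?thesis
  proof
    show "1 \<le> 1 + (\<Sum>j\<le>k. \<bar>C j\<bar>)" by (simp add: sum_nonneg)
    show "F j i \<le> (1 + (\<Sum>j\<le>k. \<bar>C j\<bar>)) * (1 + (y i)\<^sup>2) ^ (\<Sum>j\<le>k. N j)" if "j \<le> k" "i \<in> I" for j i
    proof (rule weight_bound_mono[OF CN[OF that]])
      have "\<bar>C j\<bar> \<le> (\<Sum>j\<le>k. \<bar>C j\<bar>)" using that by (intro member_le_sum) auto
      then show "\<bar>C j\<bar> \<le> 1 + (\<Sum>j\<le>k. \<bar>C j\<bar>)" by simp
      show "N j \<le> (\<Sum>j\<le>k. N j)" using that by (intro member_le_sum) auto
    qed
  qed
qed

lemma O_M_growth:
  assumes "f \<in> O_M"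
  obtains C N where "1 \<le> C" "\<And>j x. j \<le> k \<Longrightarrow> norm (nth_deriv j f x) \<le> C * (1 + x\<^sup>2) ^ N"
  using uniform_growth[of k UNIV "\<lambda>j x. norm (nth_deriv j f x)" "\<lambda>x. x"] assms
  unfolding O_M_iff by auto

lemma O_M_diff:
  assumes "f \<in> O_M" "g \<in> O_M"
  shows "(\<lambda>x. f x - g x) \<in> O_M"
  unfolding O_M_iff
proof (intro conjI allI)
  show "smooth (\<lambda>x. f x - g x)" using assms by (intro smooth_diff O_M_smooth)
  fix k
  obtain C N where f: "1 \<le> C" "\<And>j x. j \<le> k \<Longrightarrow> norm (nth_deriv j f x) \<le> C * (1 + x\<^sup>2) ^ N"
    using O_M_growth[OF assms(1)] by blast
  obtain D M where g: "1 \<le> D" "\<And>j x. j \<le> k \<Longrightarrow> norm (nth_deriv j g x) \<le> D * (1 + x\<^sup>2) ^ M"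
    using O_M_growth[OF assms(2)] by blast
  have "norm (nth_deriv k (\<lambda>x. f x - g x) x) \<le> (C + D) * (1 + x\<^sup>2) ^ (N + M)" for x
  proof -
    have "norm (nth_deriv k (\<lambda>x. f x - g x) x) \<le> norm (nth_deriv k f x) + norm (nth_deriv k g x)"
      using assms by (simp add: nth_deriv_diff O_M_smooth norm_triangle_ineq4)
    also have "\<dots> \<le> C * (1 + x\<^sup>2) ^ (N + M) + D * (1 + x\<^sup>2) ^ (N + M)"
      by (intro add_mono weight_bound_mono[OF f(2)[OF order_refl]] weight_bound_mono[OF g(2)[OF order_refl]])
         (use f(1) g(1) in auto)
    finally show ?thesis by (simp add: distrib_right)
  qed
  then show "\<exists>C N. \<forall>x. norm (nth_deriv k (\<lambda>x. f x - g x) x) \<le> C * (1 + x\<^sup>2) ^ N" by blast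
qed

lemma O_M_affine:
  fixes a b :: "'a::real_normed_vector"
  shows "(\<lambda>x. a + x *\<^sub>R b) \<in> O_M"
  unfolding O_M_iff
proof (intro conjI allI)
  fix k
  have "norm (nth_deriv k (\<lambda>x. a + x *\<^sub>R b) x) \<le> (norm a + norm b) * (1 + x\<^sup>2) ^ 1" for x
  proof -
    have "norm (a + x *\<^sub>R b) \<le> norm a + \<bar>x\<bar> * norm b" by (metis norm_scaleR norm_triangle_ineq)
    also have "\<dots> \<le> norm a * (1 + x\<^sup>2) + (1 + x\<^sup>2) * norm b"
      by (intro add_mono mult_right_mono abs_le_weight) (auto simp: mult_le_cancel_left1)
    also have "\<dots> = (norm a + norm b) * (1 + x\<^sup>2) ^ 1" by (simp add: algebra_simps)
    finally have 0: "norm (a + x *\<^sub>R b) \<le> (norm a + norm b) * (1 + x\<^sup>2) ^ 1" .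
    have "1 * norm b \<le> (1 + x\<^sup>2) * (norm a + norm b)" by (intro mult_mono) auto
    then have 1: "norm b \<le> (norm a + norm b) * (1 + x\<^sup>2) ^ 1" by (simp add: mult.commute)
    show ?thesis using 0 1 by (auto simp: nth_deriv_affine)
  qed
  then show "\<exists>C N. \<forall>x. norm (nth_deriv k (\<lambda>x. a + x *\<^sub>R b) x) \<le> C * (1 + x\<^sup>2) ^ N" by blast
qed (rule smooth_affine)

lemma weight_compose_le:
  fixes x y :: real
  assumes "\<bar>y\<bar> \<le> C * (1 + x\<^sup>2) ^ N"
  shows "1 + y\<^sup>2 \<le> (1 + C\<^sup>2) * (1 + x\<^sup>2) ^ (2 * N)"
proof -
  have "y\<^sup>2 \<le> (C * (1 + x\<^sup>2) ^ N)\<^sup>2" using power_mono[OF assms, of 2] by simp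
  also have "\<dots> = C\<^sup>2 * (1 + x\<^sup>2) ^ (2 * N)" by (simp add: power_mult_distrib power_mult mult.commute[of 2])
  finally show ?thesis using weight_ge_1[of x "2 * N"] by (simp add: distrib_right add_mono)
qed

lemma O_M_compose:
  fixes \<psi> :: "real \<Rightarrow> real" and f :: "real \<Rightarrow> 'a::real_normed_vector"
  assumes "\<psi> \<in> O_M" "f \<in> O_M"
  shows "(\<lambda>x. f (\<psi> x)) \<in> O_M"
  unfolding O_M_iff
proof (intro conjI allI)
  show "smooth (\<lambda>x. f (\<psi> x))" by (rule smooth_compose[OF O_M_smooth[OF assms(2)] O_M_smooth[OF assms(1)]])
  fix k
  obtain C N where p: "1 \<le> C" "\<And>j x. j \<le> k \<Longrightarrow> norm (nth_deriv j \<psi> x) \<le> C * (1 + x\<^sup>2) ^ N"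
    using O_M_growth[OF assms(1)] by blast
  obtain D M where f: "1 \<le> D" "\<And>j x. j \<le> k \<Longrightarrow> norm (nth_deriv j f x) \<le> D * (1 + x\<^sup>2) ^ M"
    using O_M_growth[OF assms(2)] by blast
  have "norm (nth_deriv k (\<lambda>x. f (\<psi> x)) x) \<le>
      (bell k * (D * (1 + C\<^sup>2) ^ M) * C ^ k) * (1 + x\<^sup>2) ^ (2 * N * M + N * k)" for x
  proof -
    have M1: "1 \<le> C * (1 + x\<^sup>2) ^ N" using mult_mono[OF p(1) weight_ge_1[of x N]] p(1) by simp
    have "1 + (\<psi> x)\<^sup>2 \<le> (1 + C\<^sup>2) * (1 + x\<^sup>2) ^ (2 * N)"
      using p(2)[of 0 x] by (intro weight_compose_le) auto
    then have le: "D * (1 + (\<psi> x)\<^sup>2) ^ M \<le> D * ((1 + C\<^sup>2) * (1 + x\<^sup>2) ^ (2 * N)) ^ M"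
      using f(1) by (intro mult_left_mono power_mono) auto
    have "norm (nth_deriv k (\<lambda>x. f (\<psi> x)) x) \<le> bell k * (D * ((1 + C\<^sup>2) * (1 + x\<^sup>2) ^ (2 * N)) ^ M) * (C * (1 + x\<^sup>2) ^ N) ^ k"
    proof (rule norm_nth_deriv_compose_le[where S = UNIV and T = UNIV])
      show "\<bar>nth_deriv j \<psi> x\<bar> \<le> C * (1 + x\<^sup>2) ^ N" if "j \<le> k" for j using p(2)[OF that] by simp
      show "norm (nth_deriv i f (\<psi> x)) \<le> D * ((1 + C\<^sup>2) * (1 + x\<^sup>2) ^ (2 * N)) ^ M" if "i \<le> k" for i
        using order_trans[OF f(2)[OF that] le] .
    qed (use assms M1 in \<open>auto intro: smooth_kdiff O_M_smooth\<close>)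
    then show ?thesis by (simp only: power_mult_distrib power_mult[symmetric] power_add mult_ac)
  qed
  then show "\<exists>C N. \<forall>x. norm (nth_deriv k (\<lambda>x. f (\<psi> x)) x) \<le> C * (1 + x\<^sup>2) ^ N" by blast
qed

section \<open>The seminorms\<close>

lemma seminorm_le:
  assumes "\<And>x j. j \<le> m \<Longrightarrow> cmod (v x) * cmod (nth_deriv j f x) \<le> B"
  shows "O_M_seminorm m v f \<le> B"
  unfolding O_M_seminorm_def
  by (rule cSUP_least) (use assms in \<open>auto simp: norm_mult\<close>)

text \<open>\<open>SUP\<close> is informative only over a bounded set; polynomial growth of the
  derivatives against the decay of \<open>v\<close> provides the bound.\<close>

lemma seminorm_ge:
  assumes "f \<in> O_M" "v \<in> schwartz" "j \<le> m"
  shows "cmod (v x) * cmod (nth_deriv j f x) \<le> O_M_seminorm m v f"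
proof -
  obtain C N where f: "1 \<le> C" "\<And>j x. j \<le> m \<Longrightarrow> norm (nth_deriv j f x) \<le> C * (1 + x\<^sup>2) ^ N"
    using O_M_growth[OF assms(1)] by blast
  obtain B where B: "\<And>x y. \<bar>y\<bar> \<le> C * (1 + x\<^sup>2) ^ N \<Longrightarrow> (1 + x\<^sup>2) ^ 0 * norm (v x) * \<bar>y\<bar> \<le> B"
    using schwartz_times_growth[OF assms(2)] by blast
  let ?M = "\<lambda>x. Max ((\<lambda>j. cmod (v x * nth_deriv j f x)) ` {..m})"
  have "?M x \<le> B" for x
    using B[of "norm (nth_deriv _ f x)" x] f(2) by (auto simp: norm_mult)
  then have bdd: "bdd_above (range ?M)" by (auto simp: bdd_above_def)
  have "cmod (v x) * cmod (nth_deriv j f x) \<le> ?M x"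
    using assms(3) by (intro Max_ge) (auto simp: norm_mult[symmetric])
  also have "\<dots> \<le> O_M_seminorm m v f"
    unfolding O_M_seminorm_def by (rule cSUP_upper[OF _ bdd]) simp
  finally show ?thesis .
qed

lemma seminorm_triangle:
  assumes "f \<in> O_M" "g \<in> O_M" "h \<in> O_M" "v \<in> schwartz"
  shows "O_M_seminorm m v (\<lambda>x. f x - h x) \<le> O_M_seminorm m v (\<lambda>x. f x - g x) + O_M_seminorm m v (\<lambda>x. g x - h x)"
proof (rule seminorm_le)
  fix x j assume j: "j \<le> m"
  have "nth_deriv j (\<lambda>x. f x - h x) x = nth_deriv j (\<lambda>x. f x - g x) x + nth_deriv j (\<lambda>x. g x - h x) x"
    using assms by (simp add: nth_deriv_diff O_M_smooth)
  then have "cmod (nth_deriv j (\<lambda>x. f x - h x) x) \<le>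
      cmod (nth_deriv j (\<lambda>x. f x - g x) x) + cmod (nth_deriv j (\<lambda>x. g x - h x) x)"
    by (metis norm_triangle_ineq)
  then have "cmod (v x) * cmod (nth_deriv j (\<lambda>x. f x - h x) x) \<le>
      cmod (v x) * (cmod (nth_deriv j (\<lambda>x. f x - g x) x) + cmod (nth_deriv j (\<lambda>x. g x - h x) x))"
    by (intro mult_left_mono) auto
  also have "\<dots> \<le> O_M_seminorm m v (\<lambda>x. f x - g x) + O_M_seminorm m v (\<lambda>x. g x - h x)"
    unfolding distrib_left using assms j by (intro add_mono seminorm_ge O_M_diff)
  finally show "cmod (v x) * cmod (nth_deriv j (\<lambda>x. f x - h x) x) \<le>
     O_M_seminorm m v (\<lambda>x. f x - g x) + O_M_seminorm m v (\<lambda>x. g x - h x)" .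
qed

lemma seminorm_mono:
  assumes "f \<in> O_M" "w \<in> schwartz" "m \<le> m'" "\<And>x. cmod (v x) \<le> cmod (w x)"
  shows "O_M_seminorm m v f \<le> O_M_seminorm m' w f"
proof (rule seminorm_le)
  fix x j assume "j \<le> m"
  have "cmod (v x) * cmod (nth_deriv j f x) \<le> cmod (w x) * cmod (nth_deriv j f x)"
    by (intro mult_right_mono assms) auto
  also have "\<dots> \<le> O_M_seminorm m' w f"
    using \<open>j \<le> m\<close> assms by (intro seminorm_ge) auto
  finally show "cmod (v x) * cmod (nth_deriv j f x) \<le> O_M_seminorm m' w f" .
qed

lemma seminorm_zero: "O_M_seminorm m v (\<lambda>x. f x - f x) \<le> 0"
proof (rule seminorm_le)
  fix x j show "cmod (v x) * cmod (nth_deriv j (\<lambda>x. f x - f x) x) \<le> 0"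
    by (cases j) (auto simp: nth_deriv_const)
qed

text \<open>A pointwise maximum need not be smooth, so the domination principle supplies the common
  weight; this makes the seminorms a directed family.\<close>

lemma schwartz_dominating:
  fixes v1 v2 :: "real \<Rightarrow> complex"
  assumes "v1 \<in> schwartz" "v2 \<in> schwartz"
  obtains w :: "real \<Rightarrow> complex" where "w \<in> schwartz" "\<And>x. cmod (v1 x) \<le> cmod (w x)" "\<And>x. cmod (v2 x) \<le> cmod (w x)"
proof -
  have "\<exists>w\<in>(schwartz :: (real \<Rightarrow> complex) set). \<forall>x\<in>UNIV. \<bar>max (cmod (v1 x)) (cmod (v2 x))\<bar> \<le> cmod (w x)"
  proof (rule rapidly_decreasing_dominated_by_schwartz)
    fix l
    obtain C D where C: "\<And>x. (1 + x\<^sup>2) ^ l * norm (v1 x) \<le> C" and D: "\<And>x. (1 + x\<^sup>2) ^ l * norm (v2 x) \<le> D"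
      using schwartz_decay[OF assms(1), of l] schwartz_decay[OF assms(2), of l] by metis
    have "(1 + x\<^sup>2) ^ l * \<bar>max (cmod (v1 x)) (cmod (v2 x))\<bar> \<le> max C D" for x
      using C[of x] D[of x] by (auto simp: max_def)
    then show "\<exists>C. \<forall>x\<in>UNIV. (1 + x\<^sup>2) ^ l * \<bar>max (cmod (v1 x)) (cmod (v2 x))\<bar> \<le> C" by blast
  qed
  then obtain w :: "real \<Rightarrow> complex" where w: "w \<in> schwartz"
    "\<And>x. \<bar>max (cmod (v1 x)) (cmod (v2 x))\<bar> \<le> cmod (w x)" by blast
  show ?thesis
  proof (rule that[OF w(1)])
    show "cmod (v1 x) \<le> cmod (w x)" "cmod (v2 x) \<le> cmod (w x)" for x
      using w(2)[of x] by linarith+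
  qed
qed

lemma schwartz_ge_1_on_interval:
  obtains w :: "real \<Rightarrow> complex" where "w \<in> schwartz" "\<And>x. \<bar>x\<bar> \<le> L \<Longrightarrow> 1 \<le> cmod (w x)"
proof -
  have "\<exists>w\<in>(schwartz :: (real \<Rightarrow> complex) set). \<forall>x\<in>{x. \<bar>x\<bar> \<le> L}. \<bar>1\<bar> \<le> cmod (w x)"
  proof (rule rapidly_decreasing_dominated_by_schwartz)
    fix l
    have "(1 + x\<^sup>2) ^ l * \<bar>1\<bar> \<le> (1 + L\<^sup>2) ^ l" if "\<bar>x\<bar> \<le> L" for x
      using that abs_le_square_iff[of x L] by (auto intro!: power_mono)
    then show "\<exists>C. \<forall>x\<in>{x. \<bar>x\<bar> \<le> L}. (1 + x\<^sup>2) ^ l * \<bar>1\<bar> \<le> C" by blast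
  qed
  then show ?thesis using that by auto
qed

section \<open>The topology generated by the seminorms\<close>

lemma openin_seminorm_ball:
  assumes "v \<in> schwartz" "f \<in> O_M" "0 < \<epsilon>"
  shows "openin O_M_topology {g \<in> O_M. O_M_seminorm m v (\<lambda>x. g x - f x) < \<epsilon>}"
  unfolding O_M_topology_def
  by (rule topology_generated_by_Basis) (use assms in blast)

text \<open>The generating balls have arbitrary centres and enter as a subbasis. The triangle
  inequality recentres a ball at \<open>f\<close>, and directedness merges two balls into
  one.\<close>

lemma openin_O_M_imp_ball:
  assumes "openin O_M_topology U" "f \<in> U"
  shows "f \<in> O_M \<and> (\<exists>m v \<epsilon>. v \<in> schwartz \<and> 0 < \<epsilon> \<and>
    (\<forall>g\<in>O_M. O_M_seminorm m v (\<lambda>x. g x - f x) < \<epsilon> \<longrightarrow> g \<in> U))"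
  using assms unfolding O_M_topology_def openin_topology_generated_by_iff
proof (induction arbitrary: f rule: generate_topology_on.induct)
  case (Int a b)
  obtain m v \<epsilon> where 1: "v \<in> schwartz" "0 < \<epsilon>" "\<And>g. g \<in> O_M \<Longrightarrow> O_M_seminorm m v (\<lambda>x. g x - f x) < \<epsilon> \<Longrightarrow> g \<in> a"
    using Int.IH(1)[of f] Int.prems by blast
  obtain m' v' \<epsilon>' where 2: "v' \<in> schwartz" "0 < \<epsilon>'" "\<And>g. g \<in> O_M \<Longrightarrow> O_M_seminorm m' v' (\<lambda>x. g x - f x) < \<epsilon>' \<Longrightarrow> g \<in> b"
    using Int.IH(2)[of f] Int.prems by blast
  have f: "f \<in> O_M" using Int.IH(1)[of f] Int.prems by blast
  obtain w :: "real \<Rightarrow> complex" where w: "w \<in> schwartz" "\<And>x. cmod (v x) \<le> cmod (w x)" "\<And>x. cmod (v' x) \<le> cmod (w x)"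
    using schwartz_dominating[OF 1(1) 2(1)] by blast
  have "g \<in> a \<inter> b" if g: "g \<in> O_M" "O_M_seminorm (max m m') w (\<lambda>x. g x - f x) < min \<epsilon> \<epsilon>'" for g
  proof -
    have "O_M_seminorm m v (\<lambda>x. g x - f x) \<le> O_M_seminorm (max m m') w (\<lambda>x. g x - f x)"
      "O_M_seminorm m' v' (\<lambda>x. g x - f x) \<le> O_M_seminorm (max m m') w (\<lambda>x. g x - f x)"
      using w g f by (auto intro!: seminorm_mono O_M_diff)
    then show ?thesis using 1(3)[OF g(1)] 2(3)[OF g(1)] g(2) by auto
  qed
  moreover have "0 < min \<epsilon> \<epsilon>'" using 1(2) 2(2) by simp
  ultimately show ?case using f w(1) by blast
next
  case (UN K)
  then obtain k where k: "k \<in> K" "f \<in> k" by blast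
  then show ?case using UN.IH[OF k] by blast
next
  case (Basis s)
  then obtain m v f0 \<epsilon> where s: "s = {g \<in> O_M. O_M_seminorm m v (\<lambda>x. g x - f0 x) < \<epsilon>}"
    "v \<in> schwartz" "f0 \<in> O_M" "0 < \<epsilon>" by blast
  have f: "f \<in> O_M" "O_M_seminorm m v (\<lambda>x. f x - f0 x) < \<epsilon>" using Basis s by auto
  have "g \<in> s" if "g \<in> O_M" "O_M_seminorm m v (\<lambda>x. g x - f x) < \<epsilon> - O_M_seminorm m v (\<lambda>x. f x - f0 x)" for g
    using seminorm_triangle[OF that(1) f(1) s(3,2), of m] that s(1) by auto
  moreover have "0 < \<epsilon> - O_M_seminorm m v (\<lambda>x. f x - f0 x)" using f(2) by simp
  ultimately show ?case using f(1) s(2) by blast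
qed auto

lemma topspace_O_M: "topspace O_M_topology = O_M"
proof
  show "topspace O_M_topology \<subseteq> O_M"
    using openin_O_M_imp_ball[OF openin_topspace] by blast
  show "O_M \<subseteq> topspace O_M_topology"
  proof
    fix f :: "real \<Rightarrow> complex" assume f: "f \<in> O_M"
    obtain w :: "real \<Rightarrow> complex" where w: "w \<in> schwartz"
      using schwartz_ge_1_on_interval[of 0] by blast
    have "f \<in> {g \<in> O_M. O_M_seminorm 0 w (\<lambda>x. g x - f x) < 1}"
      using f seminorm_zero[of 0 w f] by auto
    then show "f \<in> topspace O_M_topology"
      using openin_subset[OF openin_seminorm_ball[OF w f zero_less_one]] by blast
  qed
qed

text \<open>The topology controls derivatives uniformly on bounded sets; this is the form in which
  closeness to a test function is exploited.\<close>

lemma C_k_neighbourhood: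
  assumes "h \<in> O_M" "0 < \<epsilon>"
  obtains V where "openin O_M_topology V" "h \<in> V"
    "\<And>g x j. g \<in> V \<Longrightarrow> \<bar>x\<bar> \<le> L \<Longrightarrow> j \<le> m \<Longrightarrow> cmod (nth_deriv j g x - nth_deriv j h x) < \<epsilon>"
proof -
  obtain w :: "real \<Rightarrow> complex" where w: "w \<in> schwartz" "\<And>x. \<bar>x\<bar> \<le> L \<Longrightarrow> 1 \<le> cmod (w x)"
    using schwartz_ge_1_on_interval[of L] by blast
  let ?V = "{g \<in> O_M. O_M_seminorm m w (\<lambda>x. g x - h x) < \<epsilon>}"
  show ?thesis
  proof (rule that)
    show "openin O_M_topology ?V" by (rule openin_seminorm_ball[OF w(1) assms])
    show "h \<in> ?V" using seminorm_zero[of m w h] assms by auto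
    fix g x j assume *: "g \<in> ?V" "\<bar>x\<bar> \<le> L" "j \<le> m"
    have "1 * cmod (nth_deriv j (\<lambda>x. g x - h x) x) \<le> cmod (w x) * cmod (nth_deriv j (\<lambda>x. g x - h x) x)"
      using w(2)[OF *(2)] by (intro mult_right_mono) auto
    also have "\<dots> \<le> O_M_seminorm m w (\<lambda>x. g x - h x)"
      using * assms w by (intro seminorm_ge O_M_diff) auto
    finally show "cmod (nth_deriv j g x - nth_deriv j h x) < \<epsilon>"
      using * assms by (auto simp: nth_deriv_diff O_M_smooth)
  qed
qed

text \<open>The weight \<open>w\<close> must be large at the points \<open>\<psi> x\<close>, which
  may coincide for different \<open>x\<close>; so the domination principle is applied to a family
  indexed by \<open>x\<close>. Its hypothesis holds since \<open>1 + (\<psi> x)\<^sup>2\<close> is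
  bounded by a constant times a power of \<open>1 + x\<^sup>2\<close>, while \<open>v\<close> decays
  in \<open>x\<close>.\<close>

lemma seminorm_compose_le:
  fixes \<psi> :: "real \<Rightarrow> real" and v :: "real \<Rightarrow> complex"
  assumes "\<psi> \<in> O_M" "v \<in> schwartz"
  obtains w :: "real \<Rightarrow> complex" where "w \<in> schwartz"
    "\<And>f. f \<in> O_M \<Longrightarrow> O_M_seminorm m v (\<lambda>x. f (\<psi> x)) \<le> O_M_seminorm m w f"
proof -
  obtain C N where p: "1 \<le> C" "\<And>j x. j \<le> m \<Longrightarrow> norm (nth_deriv j \<psi> x) \<le> C * (1 + x\<^sup>2) ^ N"
    using O_M_growth[OF assms(1)] by blast
  define c where "c = (\<Sum>j\<le>m. real (bell j))"
  define M where "M x = C * (1 + x\<^sup>2) ^ N" for x :: real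
  define r where "r x = cmod (v x) * (c * M x ^ m)" for x
  have M1: "1 \<le> M x" for x using mult_mono[OF p(1) weight_ge_1[of x N]] p(1) by (simp add: M_def)
  have c0: "0 \<le> c" by (simp add: c_def sum_nonneg)
  have "\<exists>w\<in>(schwartz :: (real \<Rightarrow> complex) set). \<forall>x\<in>UNIV. \<bar>r x\<bar> \<le> cmod (w (\<psi> x))"
  proof (rule rapidly_decreasing_dominated_by_schwartz)
    fix l
    define D where "D = (1 + C\<^sup>2) ^ l * (c * C ^ m)"
    obtain B where B: "\<And>x y. \<bar>y\<bar> \<le> D * (1 + x\<^sup>2) ^ (2 * N * l + N * m) \<Longrightarrow> (1 + x\<^sup>2) ^ 0 * norm (v x) * \<bar>y\<bar> \<le> B"
      using schwartz_times_growth[OF assms(2)] by blast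
    have "(1 + (\<psi> x)\<^sup>2) ^ l * \<bar>r x\<bar> \<le> B" for x
    proof -
      have "1 + (\<psi> x)\<^sup>2 \<le> (1 + C\<^sup>2) * (1 + x\<^sup>2) ^ (2 * N)"
        using p(2)[of 0 x] by (intro weight_compose_le) auto
      then have "(1 + (\<psi> x)\<^sup>2) ^ l \<le> ((1 + C\<^sup>2) * (1 + x\<^sup>2) ^ (2 * N)) ^ l" by (intro power_mono) auto
      then have "(1 + (\<psi> x)\<^sup>2) ^ l * (c * M x ^ m) \<le> ((1 + C\<^sup>2) * (1 + x\<^sup>2) ^ (2 * N)) ^ l * (c * M x ^ m)"
        using c0 M1[of x] by (intro mult_right_mono) auto
      also have "\<dots> = D * (1 + x\<^sup>2) ^ (2 * N * l + N * m)"
        by (simp only: D_def M_def power_mult_distrib power_mult[symmetric] power_add mult_ac)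
      finally have "\<bar>(1 + (\<psi> x)\<^sup>2) ^ l * (c * M x ^ m)\<bar> \<le> D * (1 + x\<^sup>2) ^ (2 * N * l + N * m)"
        using c0 M1[of x] by (simp add: abs_mult)
      from B[OF this] show ?thesis using c0 M1[of x] by (simp add: r_def abs_mult mult_ac)
    qed
    then show "\<exists>C. \<forall>x\<in>UNIV. (1 + (\<psi> x)\<^sup>2) ^ l * \<bar>r x\<bar> \<le> C" by blast
  qed
  then obtain w :: "real \<Rightarrow> complex" where w: "w \<in> schwartz" "\<And>x. \<bar>r x\<bar> \<le> cmod (w (\<psi> x))" by blast
  have "O_M_seminorm m v (\<lambda>x. f (\<psi> x)) \<le> O_M_seminorm m w f" if f: "f \<in> O_M" for f
  proof (rule seminorm_le)
    fix x j assume j: "j \<le> m"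
    \<comment> \<open>The maximum over the orders at the single point \<open>\<psi> x\<close> is
      attained by one order, so the final bound is one weighted derivative, which the seminorm
      controls.\<close>
    define A where "A = Max ((\<lambda>i. cmod (nth_deriv i f (\<psi> x))) ` {..m})"
    have "A \<in> (\<lambda>i. cmod (nth_deriv i f (\<psi> x))) ` {..m}" unfolding A_def by (intro Max_in) auto
    then obtain i where i: "i \<le> m" "A = cmod (nth_deriv i f (\<psi> x))" by auto
    have "cmod (nth_deriv j (\<lambda>x. f (\<psi> x)) x) \<le> bell j * A * M x ^ j"
    proof (rule norm_nth_deriv_compose_le[where S = UNIV and T = UNIV])
      show "\<bar>nth_deriv i \<psi> x\<bar> \<le> M x" if "i \<le> j" for i using p(2)[of i x] that j by (simp add: M_def)
      show "cmod (nth_deriv i f (\<psi> x)) \<le> A" if "i \<le> j" for i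
        using that j unfolding A_def by (intro Max_ge) auto
    qed (use assms f M1 in \<open>auto intro: smooth_kdiff O_M_smooth\<close>)
    also have "\<dots> \<le> c * A * M x ^ m"
    proof (rule mult_mono)
      have "real (bell j) \<le> (\<Sum>j\<le>m. real (bell j))" using j by (intro member_le_sum) auto
      then show "real (bell j) * A \<le> c * A" unfolding c_def i(2)
        by (intro mult_right_mono) auto
      show "M x ^ j \<le> M x ^ m" using M1 j by (intro power_increasing) auto
    qed (use c0 M1[of x] i in auto)
    finally have "cmod (v x) * cmod (nth_deriv j (\<lambda>x. f (\<psi> x)) x) \<le> cmod (v x) * (c * A * M x ^ m)"
      by (intro mult_left_mono) auto
    also have "\<dots> = r x * A" by (simp add: r_def mult_ac)
    also have "\<dots> \<le> cmod (w (\<psi> x)) * A" using w(2)[of x] i by (intro mult_right_mono) auto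
    also have "\<dots> \<le> O_M_seminorm m w f" unfolding i(2) by (rule seminorm_ge[OF f w(1) i(1)])
    finally show "cmod (v x) * cmod (nth_deriv j (\<lambda>x. f (\<psi> x)) x) \<le> O_M_seminorm m w f" .
  qed
  with w(1) show ?thesis by (rule that)
qed

lemma continuous_map_comp_op:
  fixes \<psi> :: "real \<Rightarrow> real"
  assumes "\<psi> \<in> O_M"
  shows "continuous_map O_M_topology O_M_topology (comp_op \<psi>)"
  unfolding continuous_map_def topspace_O_M
proof (intro conjI allI impI)
  have O: "comp_op \<psi> f \<in> O_M" if "f \<in> O_M" for f
    using O_M_compose[OF assms that] by (simp add: comp_op_def o_def)
  then show "comp_op \<psi> \<in> O_M \<rightarrow> O_M" by auto
  fix U assume U: "openin O_M_topology U"
  show "openin O_M_topology {f \<in> O_M. comp_op \<psi> f \<in> U}"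
  proof (subst openin_subopen, intro ballI)
    fix f assume "f \<in> {f \<in> O_M. comp_op \<psi> f \<in> U}"
    then have f: "f \<in> O_M" "comp_op \<psi> f \<in> U" by auto
    obtain m v \<epsilon> where b: "v \<in> schwartz" "0 < \<epsilon>"
      "\<And>g. g \<in> O_M \<Longrightarrow> O_M_seminorm m v (\<lambda>x. g x - comp_op \<psi> f x) < \<epsilon> \<Longrightarrow> g \<in> U"
      using openin_O_M_imp_ball[OF U f(2)] by blast
    obtain w :: "real \<Rightarrow> complex" where w: "w \<in> schwartz"
      "\<And>f. f \<in> O_M \<Longrightarrow> O_M_seminorm m v (\<lambda>x. f (\<psi> x)) \<le> O_M_seminorm m w f"
      using seminorm_compose_le[OF assms b(1)] by blast
    let ?T = "{g \<in> O_M. O_M_seminorm m w (\<lambda>x. g x - f x) < \<epsilon>}"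
    have "openin O_M_topology ?T" by (rule openin_seminorm_ball[OF w(1) f(1) b(2)])
    moreover have "f \<in> ?T" using seminorm_zero[of m w f] f b by auto
    moreover have "comp_op \<psi> g \<in> U" if "g \<in> ?T" for g
      using that w(2)[OF O_M_diff[of g f]] f b(3)[of "comp_op \<psi> g"] O[of g]
      by (auto simp: comp_op_def)
    ultimately show "\<exists>T. openin O_M_topology T \<and> f \<in> T \<and> T \<subseteq> {f \<in> O_M. comp_op \<psi> f \<in> U}"
      by (intro exI[of _ ?T]) auto
  qed
qed


text \<open>Cutting off with a dilated bump: the derivatives of \<open>\<phi> (x / R) - 1\<close> up
  to order \<open>m\<close> are at most \<open>B / R\<close> times \<open>1 + x\<^sup>2\<close>, and
  this one power of the weight is absorbed by \<open>v\<close>. Order 0 uses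
  \<open>\<phi> 0 = 1\<close> and a Lipschitz bound, higher orders use the factors
  \<open>1 / R\<close> from the chain rule.\<close>

lemma compactly_supported_dense:
  fixes f v :: "real \<Rightarrow> complex"
  assumes f: "f \<in> O_M" and v: "v \<in> schwartz" and "0 < \<epsilon>"
  obtains f0 L where "smooth f0" "\<And>x. L < \<bar>x\<bar> \<Longrightarrow> f0 x = 0" "O_M_seminorm m v (\<lambda>x. f0 x - f x) < \<epsilon>"
proof -
  obtain \<phi> :: "real \<Rightarrow> real" and \<delta> :: real where \<phi>: "smooth \<phi>" "\<phi> 0 = 1" "\<And>x. 0 \<le> \<phi> x" "0 < \<delta>"
    "\<And>x. \<bar>x\<bar> \<le> 1 \<Longrightarrow> \<delta> \<le> \<phi> x" "\<And>x. 2 < \<bar>x\<bar> \<Longrightarrow> \<phi> x = 0"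
    using bump_exists by blast
  have "\<exists>B. \<forall>x. \<bar>nth_deriv k \<phi> x\<bar> \<le> B" for k
    using compact_support_bounded[where k = k, OF \<phi>(1,6) continuous_on_const[of _ 1]] by simp
  then obtain b where b: "\<And>k x. \<bar>nth_deriv k \<phi> x\<bar> \<le> b k" by metis
  define B where "B = (\<Sum>k\<le>Suc m. b k)"
  have b0: "0 \<le> b k" for k using b[of k 0] by linarith
  have B: "\<bar>nth_deriv k \<phi> x\<bar> \<le> B" if "k \<le> Suc m" for k x
  proof -
    have "b k \<le> B" unfolding B_def using that b0 by (intro member_le_sum) auto
    then show ?thesis using b[of k x] by linarith
  qed
  have B0: "0 \<le> B" unfolding B_def by (intro sum_nonneg b0)
  have lip: "\<bar>\<phi> x - 1\<bar> \<le> B * \<bar>x\<bar>" for x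
  proof -
    have "norm (\<phi> x - \<phi> 0) \<le> B * norm (x - 0)"
    proof (rule field_differentiable_bound[of UNIV \<phi> "nth_deriv (Suc 0) \<phi>"])
      show "(\<phi> has_real_derivative nth_deriv (Suc 0) \<phi> z) (at z within UNIV)" for z
        using smooth_has_nth_deriv[OF \<phi>(1), of 0 z] by (simp add: has_real_derivative_iff_has_vector_derivative)
    qed (use B[of "Suc 0"] in auto)
    then show ?thesis using \<phi>(2) by simp
  qed
  obtain C N where fg: "1 \<le> C" "\<And>j x. j \<le> m \<Longrightarrow> norm (nth_deriv j f x) \<le> C * (1 + x\<^sup>2) ^ N"
    using O_M_growth[OF f] by blast
  obtain K where K: "0 \<le> K" "\<And>x y. \<bar>y\<bar> \<le> C * (1 + x\<^sup>2) ^ N \<Longrightarrow> (1 + x\<^sup>2) ^ 1 * norm (v x) * \<bar>y\<bar> \<le> K"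
    using schwartz_times_growth[OF v] by blast
  \<comment> \<open>\<open>2 ^ m\<close> bounds the sum of the binomial coefficients in the Leibniz
    rule; the summand 1 ensures \<open>1 \<le> R\<close> and the strict inequality.\<close>
  define R where "R = 1 + B * K * 2 ^ m / \<epsilon>"
  have R: "1 \<le> R" "B * K * 2 ^ m / R < \<epsilon>"
  proof -
    have "0 \<le> B * K * 2 ^ m" using B0 K(1) by simp
    then show "1 \<le> R" using \<open>0 < \<epsilon>\<close> by (simp add: R_def)
    then show "B * K * 2 ^ m / R < \<epsilon>"
      using \<open>0 < \<epsilon>\<close> by (simp add: divide_less_eq) (simp add: R_def distrib_left)
  qed
  define q where "q x = \<phi> (x / R) - 1" for x
  define F where "F k x = (1 / R) ^ k * nth_deriv k \<phi> (x / R) - (if k = 0 then 1 else 0)" for k x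
  have F: "(F k has_vector_derivative F (Suc k) x) (at x)" for k x
  proof -
    have "(nth_deriv k \<phi> has_real_derivative nth_deriv (Suc k) \<phi> (x / R)) (at (x / R))"
      using smooth_has_nth_deriv[OF \<phi>(1)] by (simp add: has_real_derivative_iff_has_vector_derivative)
    from DERIV_chain'[where f = "\<lambda>x. x / R" and D = "1 / R" and s = UNIV, OF _ this]
    have "((\<lambda>x. nth_deriv k \<phi> (x / R)) has_real_derivative nth_deriv (Suc k) \<phi> (x / R) * (1 / R)) (at x)"
      using DERIV_cdivide[OF DERIV_ident] by auto
    from DERIV_diff[OF DERIV_cmult[OF this, of "(1 / R) ^ k"] DERIV_const[of "if k = 0 then 1 else 0"]]
    show ?thesis unfolding F_def[abs_def] has_real_derivative_iff_has_vector_derivative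
      by (simp add: mult_ac)
  qed
  have q: "smooth q" "nth_deriv k q x = F k x" for k x
    using smooth_family[of q F] F by (auto simp: q_def F_def)
  have qb: "\<bar>nth_deriv k q x\<bar> \<le> B / R * (1 + x\<^sup>2)" if "k \<le> m" for k x
  proof (cases k)
    case 0
    have "\<bar>nth_deriv k q x\<bar> \<le> B / R * \<bar>x\<bar>"
      using lip[of "x / R"] R(1) by (simp add: 0 q_def abs_divide)
    also have "\<dots> \<le> B / R * (1 + x\<^sup>2)" using B0 R(1) by (intro mult_left_mono abs_le_weight) auto
    finally show ?thesis .
  next
    case (Suc l)
    have "(1 / R) ^ k \<le> (1 / R) ^ 1"
      unfolding Suc by (intro power_decreasing) (use R(1) in auto)
    then have "(1 / R) ^ k * \<bar>nth_deriv k \<phi> (x / R)\<bar> \<le> (1 / R) ^ 1 * B"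
      using B[of k "x / R"] R(1) that by (intro mult_mono) auto
    then have "\<bar>nth_deriv k q x\<bar> \<le> 1 / R * B"
      using R(1) by (simp add: q F_def Suc abs_mult)
    also have "\<dots> \<le> B / R * (1 + x\<^sup>2)" using B0 R(1) by (simp add: mult_left_mono divide_right_mono mult_le_cancel_left1)
    finally show ?thesis .
  qed
  define f0 where "f0 x = \<phi> (x / R) *\<^sub>R f x" for x
  have f0q: "f0 x - f x = q x *\<^sub>R f x" for x by (simp add: f0_def q_def scaleR_left_diff_distrib)
  have sq: "smooth (\<lambda>x. \<phi> (x / R))"
    using smooth_compose[OF \<phi>(1) smooth_affine[of 0 "1 / R"]] by simp
  show ?thesis
  proof (rule that)
    show "smooth f0" unfolding f0_def by (rule smooth_scaleR[OF sq O_M_smooth[OF f]])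
    show "f0 x = 0" if "2 * R < \<bar>x\<bar>" for x
      using \<phi>(6)[of "x / R"] that R(1) by (simp add: f0_def abs_divide less_divide_eq)
    have "O_M_seminorm m v (\<lambda>x. f0 x - f x) \<le> B * K * 2 ^ m / R"
      unfolding f0q
    proof (rule seminorm_le)
      fix x j assume j: "j \<le> m"
      have "cmod (nth_deriv j (\<lambda>x. q x *\<^sub>R f x) x) \<le>
        (\<Sum>i\<le>j. cmod (real (j choose i) *\<^sub>R (nth_deriv (j - i) q x *\<^sub>R nth_deriv i f x)))"
        unfolding kdiff_scaleR(2)[OF open_UNIV smooth_kdiff[OF q(1)] smooth_kdiff[OF O_M_smooth[OF f]] order_refl UNIV_I]
        by (rule norm_sum)
      then have "cmod (v x) * cmod (nth_deriv j (\<lambda>x. q x *\<^sub>R f x) x) \<le>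
        (\<Sum>i\<le>j. cmod (v x) * cmod (real (j choose i) *\<^sub>R (nth_deriv (j - i) q x *\<^sub>R nth_deriv i f x)))"
        by (simp only: sum_distrib_left[symmetric]) (rule mult_left_mono, auto)
      also have "\<dots> \<le> (\<Sum>i\<le>j. real (j choose i) * (B / R * K))"
      proof (rule sum_mono)
        fix i assume i: "i \<in> {..j}"
        have "\<bar>nth_deriv (j - i) q x\<bar> * (cmod (v x) * cmod (nth_deriv i f x)) \<le>
            B / R * (1 + x\<^sup>2) * (cmod (v x) * cmod (nth_deriv i f x))"
          using j by (intro mult_right_mono qb) auto
        also have "\<dots> = B / R * ((1 + x\<^sup>2) ^ 1 * cmod (v x) * \<bar>cmod (nth_deriv i f x)\<bar>)" by (simp add: mult_ac)
        also have "\<dots> \<le> B / R * K"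
          using B0 R(1) i j fg(2)[of i x] by (intro mult_left_mono K(2)) auto
        finally have "real (j choose i) * (\<bar>nth_deriv (j - i) q x\<bar> * (cmod (v x) * cmod (nth_deriv i f x)))
            \<le> real (j choose i) * (B / R * K)" by (intro mult_left_mono) auto
        then show "cmod (v x) * cmod (real (j choose i) *\<^sub>R (nth_deriv (j - i) q x *\<^sub>R nth_deriv i f x)) \<le>
            real (j choose i) * (B / R * K)"
          by (simp add: abs_mult mult_ac)
      qed
      also have "\<dots> = real (\<Sum>i\<le>j. j choose i) * (B / R * K)" by (simp only: sum_distrib_right of_nat_sum)
      also have "\<dots> = 2 ^ j * (B / R * K)" by (simp add: choose_row_sum)
      also have "\<dots> \<le> 2 ^ m * (B / R * K)"
        using j B0 R(1) K(1) by (intro mult_right_mono power_increasing) auto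
      finally show "cmod (v x) * cmod (nth_deriv j (\<lambda>x. q x *\<^sub>R f x) x) \<le> B * K * 2 ^ m / R"
        by (simp add: mult_ac)
    qed
    with R(2) show "O_M_seminorm m v (\<lambda>x. f0 x - f x) < \<epsilon>" by linarith
  qed
qed

section \<open>Orbits\<close>

text \<open>A bounded increasing orbit would converge to a fixed point.\<close>

lemma iterates_unbounded:
  fixes \<psi> :: "real \<Rightarrow> real"
  assumes "continuous_on UNIV \<psi>" "\<And>x. x < \<psi> x"
  shows "\<exists>N. \<forall>n\<ge>N. L < (\<psi> ^^ n) x"
proof (rule ccontr)
  assume *: "\<not> ?thesis"
  have inc: "incseq (\<lambda>n. (\<psi> ^^ n) x)" by (rule incseq_SucI) (simp add: assms(2) less_imp_le)
  have "(\<psi> ^^ n) x \<le> L" for n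
  proof (rule ccontr)
    assume "\<not> (\<psi> ^^ n) x \<le> L"
    then have "L < (\<psi> ^^ m) x" if "m \<ge> n" for m using incseqD[OF inc that] by linarith
    with * show False by blast
  qed
  then obtain l where l: "(\<lambda>n. (\<psi> ^^ n) x) \<longlonglongrightarrow> l" using incseq_convergent[OF inc] by blast
  have "isCont \<psi> l" using assms(1) by (simp add: continuous_on_eq_continuous_at)
  then have "(\<lambda>n. \<psi> ((\<psi> ^^ n) x)) \<longlonglongrightarrow> \<psi> l" by (rule isCont_tendsto_compose[OF _ l])
  moreover have "(\<lambda>n. \<psi> ((\<psi> ^^ n) x)) \<longlonglongrightarrow> l" using LIMSEQ_Suc[OF l] by simp
  ultimately have "\<psi> l = l" by (rule LIMSEQ_unique)
  then show False using assms(2)[of l] by simp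
qed

text \<open>Here \<open>\<psi>\<close> is increasing. An omitted value \<open>c\<close> lies below
  the whole range by the intermediate value theorem, so monotonicity compares every orbit with that
  of the single point \<open>c\<close>: the escape is uniform in \<open>t\<close>. For the second
  part, the successive images of \<open>{a..\<psi> a}\<close> are adjacent and fill the half-line
  above \<open>a\<close>.\<close>

lemma iterates_escape_up:
  fixes \<psi> :: "real \<Rightarrow> real"
  assumes cont: "continuous_on UNIV \<psi>" and inj: "inj \<psi>" and up: "\<And>x. x < \<psi> x" and "\<not> surj \<psi>"
  shows "\<exists>N. \<forall>n\<ge>N. \<forall>t. L < \<bar>(\<psi> ^^ n) t\<bar>"
    and "\<exists>N M. \<forall>t. \<bar>t\<bar> \<le> R \<longrightarrow> (\<exists>i<M. (\<psi> ^^ N) t \<in> (\<psi> ^^ i) ` {a..\<psi> a})"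
proof -
  have "strict_mono_on UNIV \<psi> \<or> strict_antimono_on UNIV \<psi>"
    using injective_eq_monotone_map[OF is_interval_univ cont] inj by simp
  moreover have "\<not> strict_antimono_on UNIV \<psi>"
    using up by (metis UNIV_I monotone_onD order_less_asym)
  ultimately have mono: "strict_mono \<psi>" by simp
  then have monon: "strict_mono (\<psi> ^^ n)" for n
    by (induction n) (auto simp: strict_mono_def)
  have contn: "continuous_on S (\<psi> ^^ n)" for n S
  proof (induction n)
    case (Suc n)
    show ?case using continuous_on_compose[OF Suc continuous_on_subset[OF cont]] by (simp add: o_def)
  qed (simp add: id_def)
  obtain c where c: "c \<notin> range \<psi>" using assms(4) by auto
  have lower: "c < \<psi> x" for x
  proof (rule ccontr)
    assume "\<not> c < \<psi> x"
    moreover have "c < \<psi> (max c x)" using up[of "max c x"] by linarith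
    ultimately obtain z where "\<psi> z = c"
      using IVT'[of \<psi> x c "max c x"] cont continuous_on_subset by fastforce
    then show False using c by auto
  qed
  have shift: "(\<psi> ^^ (m + n)) t = (\<psi> ^^ m) ((\<psi> ^^ n) t)" for m n t by (simp add: funpow_add)
  show "\<exists>N. \<forall>n\<ge>N. \<forall>t. L < \<bar>(\<psi> ^^ n) t\<bar>"
  proof -
    obtain N where N: "\<And>n. n \<ge> N \<Longrightarrow> L < (\<psi> ^^ n) c" using iterates_unbounded[OF cont up] by blast
    have "L < \<bar>(\<psi> ^^ n) t\<bar>" if "n \<ge> Suc N" for n t
    proof -
      \<comment> \<open>One step is spent on entering the range, which lies above
        \<open>c\<close>.\<close>
      define m where "m = n - 1"
      have m: "n = m + 1" "m \<ge> N" using that by (auto simp: m_def)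
      have "(\<psi> ^^ m) c < (\<psi> ^^ m) (\<psi> t)" using monon lower by (simp add: strict_mono_less)
      also have "\<dots> = (\<psi> ^^ n) t" using shift[of m 1 t] by (simp add: m)
      finally show ?thesis using N[OF m(2)] by linarith
    qed
    then show ?thesis by blast
  qed
  obtain N where N: "a < (\<psi> ^^ N) (- R)" using iterates_unbounded[OF cont up] by blast
  obtain M where M: "(\<psi> ^^ N) R < (\<psi> ^^ M) a" using iterates_unbounded[OF cont up] by blast
  have "\<exists>i<M. (\<psi> ^^ N) t \<in> (\<psi> ^^ i) ` {a..\<psi> a}" if t: "\<bar>t\<bar> \<le> R" for t
  proof -
    let ?s = "(\<psi> ^^ N) t"
    have "(\<psi> ^^ N) (- R) \<le> ?s" "?s \<le> (\<psi> ^^ N) R"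
      using monon t by (auto simp: strict_mono_less_eq)
    then have s: "a < ?s" "?s < (\<psi> ^^ M) a" using N M by linarith+
    \<comment> \<open>The first iterate of \<open>a\<close> beyond the point is the right end of the
      tile containing it; that tile has the preceding exponent.\<close>
    define i where "i = (LEAST i. ?s < (\<psi> ^^ i) a)"
    have i: "?s < (\<psi> ^^ i) a" "i \<le> M" unfolding i_def
      using s(2) by (auto intro: LeastI Least_le)
    from i(1) s(1) have "i \<noteq> 0" by (intro notI) simp
    then obtain j where j: "i = Suc j" using not0_implies_Suc by blast
    have "(\<psi> ^^ j) a \<le> ?s"
      using not_less_Least[of j "\<lambda>i. ?s < (\<psi> ^^ i) a"] j unfolding i_def by simp
    moreover have "?s \<le> (\<psi> ^^ j) (\<psi> a)" using i(1) shift[of j 1 a] by (simp add: j)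
    ultimately obtain z where "a \<le> z" "z \<le> \<psi> a" "(\<psi> ^^ j) z = ?s"
      using IVT'[of "\<psi> ^^ j" a ?s "\<psi> a"] up[of a] contn by auto
    then have "?s \<in> (\<psi> ^^ j) ` {a..\<psi> a}" by (metis atLeastAtMost_iff imageI)
    moreover have "j < M" using i(2) j by simp
    ultimately show ?thesis by blast
  qed
  then show "\<exists>N M. \<forall>t. \<bar>t\<bar> \<le> R \<longrightarrow> (\<exists>i<M. (\<psi> ^^ N) t \<in> (\<psi> ^^ i) ` {a..\<psi> a})" by blast
qed

text \<open>Without fixed points the sign of \<open>\<psi> x - x\<close> is constant; the downward
  case is conjugate to the upward one by reflection at 0.\<close>

lemma iterates_escape:
  fixes \<psi> :: "real \<Rightarrow> real"
  assumes cont: "continuous_on UNIV \<psi>" and inj: "inj \<psi>" and fp: "\<And>x. \<psi> x \<noteq> x" and ns: "\<not> surj \<psi>"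
  shows "\<exists>N. \<forall>n\<ge>N. \<forall>t. L < \<bar>(\<psi> ^^ n) t\<bar>"
    and "\<exists>N M. \<forall>t. \<bar>t\<bar> \<le> R \<longrightarrow> (\<exists>i<M. (\<psi> ^^ N) t \<in> (\<psi> ^^ i) ` {min a (\<psi> a)..max a (\<psi> a)})"
proof -
  have c: "continuous_on {u..v} (\<lambda>x. \<psi> x - x)" for u v
    by (intro continuous_intros continuous_on_subset[OF cont]) auto
  have sgn: "(0 < \<psi> u - u) = (0 < \<psi> v - v)" if "u \<le> v" for u v
  proof (rule ccontr)
    assume "(0 < \<psi> u - u) \<noteq> (0 < \<psi> v - v)"
    then have "(\<psi> u - u \<le> 0 \<and> 0 \<le> \<psi> v - v) \<or> (\<psi> v - v \<le> 0 \<and> 0 \<le> \<psi> u - u)" by linarith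
    then have "\<exists>x. \<psi> x - x = 0"
      using IVT'[of "\<lambda>x. \<psi> x - x" u 0 v] IVT2'[of "\<lambda>x. \<psi> x - x" v 0 u] c that by blast
    then show False using fp by auto
  qed
  have "(0 < \<psi> u - u) = (0 < \<psi> v - v)" for u v
    using sgn[of u v] sgn[of v u, symmetric] linear[of u v] by blast
  then consider "\<And>x. x < \<psi> x" | "\<And>x. \<psi> x < x"
    using fp by (metis diff_gt_0_iff_gt linorder_neqE_linordered_idom)
  then have "(\<exists>N. \<forall>n\<ge>N. \<forall>t. L < \<bar>(\<psi> ^^ n) t\<bar>) \<and>
    (\<exists>N M. \<forall>t. \<bar>t\<bar> \<le> R \<longrightarrow> (\<exists>i<M. (\<psi> ^^ N) t \<in> (\<psi> ^^ i) ` {min a (\<psi> a)..max a (\<psi> a)}))"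
  proof cases
    case 1
    have J: "{min a (\<psi> a)..max a (\<psi> a)} = {a..\<psi> a}" using 1[of a] by auto
    show ?thesis unfolding J using iterates_escape_up[OF cont inj 1 ns] by blast
  next
    case 2
    define \<theta> where "\<theta> x = - \<psi> (- x)" for x
    have it: "(\<theta> ^^ n) x = - (\<psi> ^^ n) (- x)" for n x by (induction n) (auto simp: \<theta>_def)
    have c\<theta>: "continuous_on UNIV \<theta>" unfolding \<theta>_def
      by (intro continuous_intros continuous_on_compose2[OF cont]) auto
    have inj\<theta>: "inj \<theta>" by (rule injI) (auto simp: \<theta>_def dest: injD[OF inj])
    have up\<theta>: "x < \<theta> x" for x using 2[of "- x"] by (simp add: \<theta>_def)
    have ns\<theta>: "\<not> surj \<theta>"
    proof
      assume s: "surj \<theta>"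
      have "y \<in> range \<psi>" for y
      proof -
        obtain x where "- y = \<theta> x" using surjD[OF s] by blast
        then have "y = \<psi> (- x)" by (simp add: \<theta>_def)
        then show ?thesis by blast
      qed
      then show False using ns by auto
    qed
    have *: "\<exists>N. \<forall>n\<ge>N. \<forall>t. L < \<bar>(\<theta> ^^ n) t\<bar>"
      "\<exists>N M. \<forall>t. \<bar>t\<bar> \<le> R \<longrightarrow> (\<exists>i<M. (\<theta> ^^ N) t \<in> (\<theta> ^^ i) ` {- a..\<theta> (- a)})"
      by (fact iterates_escape_up[OF c\<theta> inj\<theta> up\<theta> ns\<theta>])+
    have J: "{min a (\<psi> a)..max a (\<psi> a)} = {\<psi> a..a}" using 2[of a] by auto
    obtain N where N: "\<And>n t. n \<ge> N \<Longrightarrow> L < \<bar>(\<theta> ^^ n) t\<bar>" using *(1) by blast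
    have "L < \<bar>(\<psi> ^^ n) t\<bar>" if "n \<ge> N" for n t using N[OF that, of "- t"] by (simp add: it)
    moreover obtain N' M where NM: "\<And>t. \<bar>t\<bar> \<le> R \<Longrightarrow> (\<exists>i<M. (\<theta> ^^ N') t \<in> (\<theta> ^^ i) ` {- a..\<theta> (- a)})"
      using *(2) by blast
    have "\<exists>i<M. (\<psi> ^^ N') t \<in> (\<psi> ^^ i) ` {\<psi> a..a}" if t: "\<bar>t\<bar> \<le> R" for t
    proof -
      obtain i z where iz: "i < M" "(\<theta> ^^ N') (- t) = (\<theta> ^^ i) z" "z \<in> {- a..\<theta> (- a)}"
        using NM[of "- t"] t by auto
      then have "(\<psi> ^^ N') t = (\<psi> ^^ i) (- z)" "- z \<in> {\<psi> a..a}" by (auto simp: it \<theta>_def)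
      with iz(1) show ?thesis by blast
    qed
    ultimately show ?thesis unfolding J by blast
  qed
  then show "\<exists>N. \<forall>n\<ge>N. \<forall>t. L < \<bar>(\<psi> ^^ n) t\<bar>"
    "\<exists>N M. \<forall>t. \<bar>t\<bar> \<le> R \<longrightarrow> (\<exists>i<M. (\<psi> ^^ N) t \<in> (\<psi> ^^ i) ` {min a (\<psi> a)..max a (\<psi> a)})" by blast+
qed


section \<open>Uniform growth along families\<close>

lemma schwartz_times_growth_small:
  assumes "v \<in> schwartz" "0 < \<epsilon>"
  obtains R where "\<And>x y. R < \<bar>x\<bar> \<Longrightarrow> \<bar>y\<bar> \<le> C * (1 + x\<^sup>2) ^ N \<Longrightarrow> norm (v x) * \<bar>y\<bar> < \<epsilon>"
proof -
  obtain B where B: "0 \<le> B" "\<And>x y. \<bar>y\<bar> \<le> C * (1 + x\<^sup>2) ^ N \<Longrightarrow> (1 + x\<^sup>2) ^ 1 * norm (v x) * \<bar>y\<bar> \<le> B"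
    using schwartz_times_growth[OF assms(1)] by blast
  show ?thesis
  proof (rule that[of "B / \<epsilon>"])
    fix x y assume x: "B / \<epsilon> < \<bar>x\<bar>" and y: "\<bar>y\<bar> \<le> C * (1 + x\<^sup>2) ^ N"
    have "B < \<epsilon> * (1 + x\<^sup>2)"
      using x abs_le_weight[of x] \<open>0 < \<epsilon>\<close> by (simp add: divide_less_eq) (smt (verit) mult.commute mult_le_cancel_left_pos)
    with B(2)[OF y] have "(1 + x\<^sup>2) * (norm (v x) * \<bar>y\<bar>) < (1 + x\<^sup>2) * \<epsilon>" by (simp add: mult_ac)
    then show "norm (v x) * \<bar>y\<bar> < \<epsilon>" by (subst (asm) mult_less_cancel_left_pos) (auto simp: add_pos_nonneg)
  qed
qed

lemma compact_nth_deriv_bounded: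
  assumes "\<And>k. kdiff k S f" "compact K" "K \<subseteq> S"
  obtains A where "\<And>i x. i \<le> k \<Longrightarrow> x \<in> K \<Longrightarrow> norm (nth_deriv i f x) \<le> A"
proof -
  have "\<exists>A. \<forall>x\<in>K. norm (nth_deriv i f x) \<le> A" for i
  proof -
    have "compact (nth_deriv i f ` K)"
      using kdiff_continuous_on[OF assms(1) lessI, of i] assms(2,3)
      by (intro compact_continuous_image) (auto intro: continuous_on_subset)
    then have "bounded (nth_deriv i f ` K)" by (rule compact_imp_bounded)
    then show ?thesis unfolding bounded_iff by blast
  qed
  then obtain A where A: "\<And>i x. x \<in> K \<Longrightarrow> norm (nth_deriv i f x) \<le> A i" by metis
  have "norm (nth_deriv i f x) \<le> (\<Sum>i\<le>k. \<bar>A i\<bar>)" if "i \<le> k" "x \<in> K" for i x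
  proof -
    have "\<bar>A i\<bar> \<le> (\<Sum>i\<le>k. \<bar>A i\<bar>)" using that by (intro member_le_sum) auto
    with A[OF that(2), of i] show ?thesis by linarith
  qed
  then show ?thesis by (rule that)
qed

text \<open>Each \<open>g i\<close> has its own domain, because the ranges of the iterates shrink.
  The derivatives of the outer function are bounded by a constant, which compactness supplies in the
  applications; only those of \<open>g i\<close> grow.\<close>

lemma compose_growth:
  fixes g :: "'i \<Rightarrow> real \<Rightarrow> real" and x :: "'i \<Rightarrow> real" and h :: "real \<Rightarrow> 'a::real_normed_vector"
  assumes S: "\<And>i. i \<in> I \<Longrightarrow> open (S i) \<and> x i \<in> S i \<and> kdiff k (S i) (g i) \<and> g i ` S i \<subseteq> T"
    and h: "kdiff k T h" "\<And>i l. i \<in> I \<Longrightarrow> l \<le> k \<Longrightarrow> norm (nth_deriv l h (g i (x i))) \<le> A"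
    and g: "\<And>j. 1 \<le> j \<Longrightarrow> \<exists>C N. \<forall>i\<in>I. \<bar>nth_deriv j (g i) (x i)\<bar> \<le> C * (1 + (x i)\<^sup>2) ^ N"
  shows "\<exists>C N. \<forall>i\<in>I. norm (nth_deriv k (\<lambda>y. h (g i y)) (x i)) \<le> C * (1 + (x i)\<^sup>2) ^ N"
proof -
  \<comment> \<open>Order 0 is replaced by 0, since growth is assumed from order 1 on.\<close>
  have "\<exists>C N. \<forall>i\<in>I. (if j = 0 then 0 else \<bar>nth_deriv j (g i) (x i)\<bar>) \<le> C * (1 + (x i)\<^sup>2) ^ N" for j
    using g[of j] by (cases j) (auto intro!: exI[of _ 0])
  then obtain C N where C: "1 \<le> C" "\<And>j i. j \<le> k \<Longrightarrow> i \<in> I \<Longrightarrow>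
      (if j = 0 then 0 else \<bar>nth_deriv j (g i) (x i)\<bar>) \<le> C * (1 + (x i)\<^sup>2) ^ N"
    using uniform_growth[of k I "\<lambda>j i. if j = 0 then 0 else \<bar>nth_deriv j (g i) (x i)\<bar>" x] by blast
  have "norm (nth_deriv k (\<lambda>y. h (g i y)) (x i)) \<le> bell k * A * C ^ k * (1 + (x i)\<^sup>2) ^ (N * k)"
    if i: "i \<in> I" for i
  proof -
    have "1 \<le> C * (1 + (x i)\<^sup>2) ^ N" using mult_mono[OF C(1) weight_ge_1[of "x i" N]] C(1) by simp
    then have "norm (nth_deriv k (\<lambda>y. h (g i y)) (x i)) \<le> bell k * A * (C * (1 + (x i)\<^sup>2) ^ N) ^ k"
    proof (rule norm_nth_deriv_compose_le[rotated 5])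
      show "\<bar>nth_deriv j (g i) (x i)\<bar> \<le> C * (1 + (x i)\<^sup>2) ^ N" if "1 \<le> j" "j \<le> k" for j
        using C(2)[OF that(2) i] that(1) by simp
      show "norm (nth_deriv l h (g i (x i))) \<le> A" if "l \<le> k" for l by (rule h(2)[OF i that])
      show "open (S i)" "kdiff k (S i) (g i)" "kdiff k T h" "g i ` S i \<subseteq> T" "x i \<in> S i"
        using S[OF i] h(1) by auto
    qed
    then show ?thesis by (simp add: power_mult_distrib power_mult mult.assoc)
  qed
  then show ?thesis by blast
qed

section \<open>Derivatives of the inverse iterates\<close>

locale smooth_embedding =
  fixes \<psi> :: "real \<Rightarrow> real"
  assumes smooth: "smooth \<psi>" and inj: "inj \<psi>" and deriv_nonzero: "nth_deriv (Suc 0) \<psi> x \<noteq> 0"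
begin

lemma smooth_iterate: "smooth (\<psi> ^^ n)"
  by (rule smooth_funpow[OF smooth])

lemma inj_iterate: "inj (\<psi> ^^ n)"
  using inj by (rule inj_fn)

lemma deriv_iterate_nonzero: "nth_deriv (Suc 0) (\<psi> ^^ n) x \<noteq> 0"
proof (induction n)
  case 0
  then show ?case using nth_deriv_affine[of 1 0 "1::real" x] by (simp add: id_def)
next
  case (Suc n)
  have "nth_deriv (Suc 0) (\<psi> ^^ Suc n) x =
      nth_deriv (Suc 0) (\<psi> ^^ n) x *\<^sub>R nth_deriv (Suc 0) \<psi> ((\<psi> ^^ n) x)"
    using nth_deriv_1I[OF chain_deriv[of UNIV "\<psi> ^^ n" UNIV \<psi> x]] smooth_kdiff[OF smooth_iterate[of n]]
      smooth_kdiff[OF smooth] by (simp add: o_def)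
  then show ?case using Suc deriv_nonzero by (simp del: funpow.simps)
qed

lemma open_range_iterate: "open (range (\<psi> ^^ n))"
  using open_range_if_deriv_nonzero[OF inj_iterate] smooth_continuous_on[OF smooth_iterate, of UNIV 0] by simp

lemma kdiff_inv_iter: "kdiff k (range (\<psi> ^^ n)) (inv_iter \<psi> n)"
  unfolding inv_iter_def
  by (rule kdiff_inv_into[OF smooth_kdiff[OF smooth_iterate] inj_iterate deriv_iterate_nonzero])

lemma inv_iter_iterate [simp]: "inv_iter \<psi> n ((\<psi> ^^ n) t) = t"
  unfolding inv_iter_def by (rule inv_f_f[OF inj_iterate])

lemma iterate_Suc: "(\<psi> ^^ Suc n) t = (\<psi> ^^ n) (\<psi> t)"
  by (simp add: funpow_swap1)

text \<open>Two factorisations through neighbouring iterates: the first moves growth bounds from a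
  set to its image under \<open>\<psi>\<close>, the second moves them back.\<close>

lemma inv_iter_eq_Suc:
  assumes "x \<in> range (\<psi> ^^ Suc n)"
  shows "inv_iter \<psi> n x = \<psi> (inv_iter \<psi> (Suc n) x)"
    and "inv_iter \<psi> (Suc n) x = inv_iter \<psi> 1 (inv_iter \<psi> n x)"
    and "inv_iter \<psi> n x \<in> range (\<psi> ^^ 1)"
proof -
  obtain t where t: "x = (\<psi> ^^ Suc n) t" using assms by blast
  then have t': "x = (\<psi> ^^ n) (\<psi> t)" by (simp only: iterate_Suc)
  have i: "inv_iter \<psi> n x = \<psi> t" unfolding t' by simp
  have iS: "inv_iter \<psi> (Suc n) x = t" unfolding t by (rule inv_iter_iterate)
  show "inv_iter \<psi> n x = \<psi> (inv_iter \<psi> (Suc n) x)" by (simp add: i iS)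
  show "inv_iter \<psi> (Suc n) x = inv_iter \<psi> 1 (inv_iter \<psi> n x)"
    using inv_iter_iterate[of 1 t] by (simp add: i iS)
  show "inv_iter \<psi> n x \<in> range (\<psi> ^^ 1)" by (simp add: i)
qed

lemma range_iterate_Suc_subset: "range (\<psi> ^^ Suc n) \<subseteq> range (\<psi> ^^ n)"
  using iterate_Suc by (metis image_subsetI rangeI)

text \<open>If \<open>(\<psi> ^^ n) ` K\<close> leaves every bounded set, this is the limit condition of the theorem for
  \<open>K\<close>, freed of the Schwartz functions.\<close>

definition inverse_growth :: "nat \<Rightarrow> real set \<Rightarrow> bool" where
  "inverse_growth k K \<longleftrightarrow> (\<exists>C N. \<forall>n. \<forall>x\<in>(\<psi> ^^ n) ` K. \<bar>nth_deriv k (inv_iter \<psi> n) x\<bar> \<le> C * (1 + x\<^sup>2) ^ N)"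

definition tame :: "real set \<Rightarrow> bool" where
  "tame K \<longleftrightarrow> (\<forall>k\<ge>1. inverse_growth k K)"

text \<open>Indexing by pairs of an exponent and a point of \<open>K\<close> puts all
  \<open>n\<close> into one family, as the growth lemmas require.\<close>

lemma inverse_growth_iff:
  "inverse_growth k K \<longleftrightarrow>
    (\<exists>C N. \<forall>i\<in>UNIV \<times> K. \<bar>nth_deriv k (inv_iter \<psi> (fst i)) ((\<psi> ^^ fst i) (snd i))\<bar>
      \<le> C * (1 + ((\<psi> ^^ fst i) (snd i))\<^sup>2) ^ N)"
  by (simp add: inverse_growth_def)

lemma tame_subset: "tame K \<Longrightarrow> K' \<subseteq> K \<Longrightarrow> tame K'"
  unfolding tame_def inverse_growth_def by (meson image_mono subsetD)

lemma tame_Un: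
  assumes "tame K" "tame K'"
  shows "tame (K \<union> K')"
  unfolding tame_def
proof (intro allI impI)
  fix k :: nat assume "1 \<le> k"
  then obtain C N C' N' where
    1: "\<And>n x. x \<in> (\<psi> ^^ n) ` K \<Longrightarrow> \<bar>nth_deriv k (inv_iter \<psi> n) x\<bar> \<le> C * (1 + x\<^sup>2) ^ N" and
    2: "\<And>n x. x \<in> (\<psi> ^^ n) ` K' \<Longrightarrow> \<bar>nth_deriv k (inv_iter \<psi> n) x\<bar> \<le> C' * (1 + x\<^sup>2) ^ N'"
    using assms unfolding tame_def inverse_growth_def by metis
  have "\<bar>nth_deriv k (inv_iter \<psi> n) x\<bar> \<le> max \<bar>C\<bar> \<bar>C'\<bar> * (1 + x\<^sup>2) ^ max N N'"
    if "x \<in> (\<psi> ^^ n) ` (K \<union> K')" for n x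
  proof (cases "x \<in> (\<psi> ^^ n) ` K")
    case True then show ?thesis by (intro weight_bound_mono[OF 1]) auto
  next
    case False
    then have "x \<in> (\<psi> ^^ n) ` K'" using that by auto
    then show ?thesis by (intro weight_bound_mono[OF 2]) auto
  qed
  then show "inverse_growth k (K \<union> K')" unfolding inverse_growth_def by blast
qed

lemma tame_UN: "(\<And>i. i < M \<Longrightarrow> tame (F i)) \<Longrightarrow> tame (\<Union>i<M. F i)" for M :: nat
proof (induction M)
  case 0 then show ?case by (simp add: tame_def inverse_growth_def)
next
  case (Suc M)
  then show ?case using tame_Un[of "F M" "\<Union>i<M. F i"] by (simp add: lessThan_Suc)
qed

text \<open>The point \<open>(\<psi> ^^ n) (\<psi> t)\<close> is also
  \<open>(\<psi> ^^ Suc n) t\<close>, and near it \<open>inv_iter \<psi> n\<close> is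
  \<open>\<psi>\<close> after \<open>inv_iter \<psi> (Suc n)\<close>; the derivatives of
  \<open>\<psi>\<close> are bounded on the compact set \<open>K\<close>.\<close>

lemma tame_image:
  assumes "compact K" "tame K"
  shows "tame (\<psi> ` K)"
  unfolding tame_def inverse_growth_iff
proof (intro allI impI)
  fix k :: nat assume "1 \<le> k"
  obtain A where A: "\<And>i x. i \<le> k \<Longrightarrow> x \<in> K \<Longrightarrow> norm (nth_deriv i \<psi> x) \<le> A"
    using compact_nth_deriv_bounded[OF smooth_kdiff[OF smooth] assms(1) subset_UNIV] by blast
  have "\<exists>C N. \<forall>i\<in>UNIV \<times> K. norm (nth_deriv k (\<lambda>y. \<psi> (inv_iter \<psi> (Suc (fst i)) y)) ((\<psi> ^^ Suc (fst i)) (snd i)))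
      \<le> C * (1 + ((\<psi> ^^ Suc (fst i)) (snd i))\<^sup>2) ^ N"
  proof (rule compose_growth[where S = "\<lambda>i. range (\<psi> ^^ Suc (fst i))" and T = UNIV and A = A
        and h = \<psi> and g = "\<lambda>i. inv_iter \<psi> (Suc (fst i))" and x = "\<lambda>i. (\<psi> ^^ Suc (fst i)) (snd i)"])
    fix i :: "nat \<times> real" assume "i \<in> UNIV \<times> K"
    show "open (range (\<psi> ^^ Suc (fst i))) \<and> (\<psi> ^^ Suc (fst i)) (snd i) \<in> range (\<psi> ^^ Suc (fst i)) \<and>
        kdiff k (range (\<psi> ^^ Suc (fst i))) (inv_iter \<psi> (Suc (fst i))) \<and>
        inv_iter \<psi> (Suc (fst i)) ` range (\<psi> ^^ Suc (fst i)) \<subseteq> UNIV"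
      using open_range_iterate kdiff_inv_iter by blast
    show "norm (nth_deriv l \<psi> (inv_iter \<psi> (Suc (fst i)) ((\<psi> ^^ Suc (fst i)) (snd i)))) \<le> A" if "l \<le> k" for l
      unfolding inv_iter_iterate using A[OF that] \<open>i \<in> UNIV \<times> K\<close> by auto
  next
    fix j :: nat assume "1 \<le> j"
    then obtain C N where "\<And>n x. x \<in> (\<psi> ^^ n) ` K \<Longrightarrow> \<bar>nth_deriv j (inv_iter \<psi> n) x\<bar> \<le> C * (1 + x\<^sup>2) ^ N"
      using assms(2) unfolding tame_def inverse_growth_def by metis
    then have "\<forall>i\<in>UNIV \<times> K. \<bar>nth_deriv j (inv_iter \<psi> (Suc (fst i))) ((\<psi> ^^ Suc (fst i)) (snd i))\<bar>
      \<le> C * (1 + ((\<psi> ^^ Suc (fst i)) (snd i))\<^sup>2) ^ N" by (metis imageI mem_Times_iff)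
    then show "\<exists>C N. \<forall>i\<in>UNIV \<times> K. \<bar>nth_deriv j (inv_iter \<psi> (Suc (fst i))) ((\<psi> ^^ Suc (fst i)) (snd i))\<bar>
      \<le> C * (1 + ((\<psi> ^^ Suc (fst i)) (snd i))\<^sup>2) ^ N" by blast
  qed (rule smooth_kdiff[OF smooth])
  then obtain C N where CN: "\<And>n t. t \<in> K \<Longrightarrow>
      norm (nth_deriv k (\<lambda>y. \<psi> (inv_iter \<psi> (Suc n) y)) ((\<psi> ^^ Suc n) t)) \<le> C * (1 + ((\<psi> ^^ Suc n) t)\<^sup>2) ^ N"
    by (metis SigmaI UNIV_I fst_conv snd_conv)
  have "\<bar>nth_deriv k (inv_iter \<psi> n) ((\<psi> ^^ n) s)\<bar> \<le> C * (1 + ((\<psi> ^^ n) s)\<^sup>2) ^ N" if s: "s \<in> \<psi> ` K" for n s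
  proof -
    obtain t where t: "t \<in> K" "s = \<psi> t" using s by blast
    have "nth_deriv k (inv_iter \<psi> n) ((\<psi> ^^ Suc n) t) =
        nth_deriv k (\<lambda>y. \<psi> (inv_iter \<psi> (Suc n) y)) ((\<psi> ^^ Suc n) t)"
      by (rule nth_deriv_cong[OF open_range_iterate[of "Suc n"] inv_iter_eq_Suc(1) rangeI])
    then show ?thesis using CN[OF t(1), of n] unfolding t(2) iterate_Suc[symmetric] by simp
  qed
  then show "\<exists>C N. \<forall>i\<in>UNIV \<times> \<psi> ` K. \<bar>nth_deriv k (inv_iter \<psi> (fst i)) ((\<psi> ^^ fst i) (snd i))\<bar>
      \<le> C * (1 + ((\<psi> ^^ fst i) (snd i))\<^sup>2) ^ N" by (metis mem_Times_iff)
qed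

text \<open>Now the outer function is \<open>inv_iter \<psi> 1\<close>, whose derivatives are
  bounded on the compact image of \<open>K\<close>. This factorisation reaches positive exponents
  only.\<close>

lemma tame_preimage:
  assumes "compact K" "tame (\<psi> ` K)"
  shows "tame K"
  unfolding tame_def inverse_growth_iff
proof (intro allI impI)
  fix k :: nat assume k: "1 \<le> k"
  have "continuous_on K \<psi>" using smooth_continuous_on[OF smooth, of K 0] by simp
  then have "compact (\<psi> ` K)" using assms(1) by (rule compact_continuous_image)
  moreover have "\<psi> ` K \<subseteq> range (\<psi> ^^ 1)" by auto
  ultimately obtain A where A: "\<And>i x. i \<le> k \<Longrightarrow> x \<in> \<psi> ` K \<Longrightarrow> norm (nth_deriv i (inv_iter \<psi> 1) x) \<le> A"
    using compact_nth_deriv_bounded[OF kdiff_inv_iter[of _ 1]] by blast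
  have "\<exists>C N. \<forall>i\<in>UNIV \<times> K. norm (nth_deriv k (\<lambda>y. inv_iter \<psi> 1 (inv_iter \<psi> (fst i) y)) ((\<psi> ^^ Suc (fst i)) (snd i)))
      \<le> C * (1 + ((\<psi> ^^ Suc (fst i)) (snd i))\<^sup>2) ^ N"
  proof (rule compose_growth[where S = "\<lambda>i. range (\<psi> ^^ Suc (fst i))" and T = "range (\<psi> ^^ 1)" and A = A
        and h = "inv_iter \<psi> 1" and g = "\<lambda>i. inv_iter \<psi> (fst i)" and x = "\<lambda>i. (\<psi> ^^ Suc (fst i)) (snd i)"])
    fix i :: "nat \<times> real" assume i: "i \<in> UNIV \<times> K"
    show "open (range (\<psi> ^^ Suc (fst i))) \<and> (\<psi> ^^ Suc (fst i)) (snd i) \<in> range (\<psi> ^^ Suc (fst i)) \<and>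
        kdiff k (range (\<psi> ^^ Suc (fst i))) (inv_iter \<psi> (fst i)) \<and>
        inv_iter \<psi> (fst i) ` range (\<psi> ^^ Suc (fst i)) \<subseteq> range (\<psi> ^^ 1)"
      using open_range_iterate kdiff_subset[OF kdiff_inv_iter range_iterate_Suc_subset] inv_iter_eq_Suc(3) by blast
    show "norm (nth_deriv l (inv_iter \<psi> 1) (inv_iter \<psi> (fst i) ((\<psi> ^^ Suc (fst i)) (snd i)))) \<le> A" if "l \<le> k" for l
      unfolding iterate_Suc inv_iter_iterate using A[OF that] i by auto
  next
    fix j :: nat assume "1 \<le> j"
    then obtain C N where "\<And>n x. x \<in> (\<psi> ^^ n) ` \<psi> ` K \<Longrightarrow> \<bar>nth_deriv j (inv_iter \<psi> n) x\<bar> \<le> C * (1 + x\<^sup>2) ^ N"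
      using assms(2) unfolding tame_def inverse_growth_def by metis
    then have "\<forall>i\<in>UNIV \<times> K. \<bar>nth_deriv j (inv_iter \<psi> (fst i)) ((\<psi> ^^ Suc (fst i)) (snd i))\<bar>
      \<le> C * (1 + ((\<psi> ^^ Suc (fst i)) (snd i))\<^sup>2) ^ N" unfolding iterate_Suc by (metis imageI mem_Times_iff)
    then show "\<exists>C N. \<forall>i\<in>UNIV \<times> K. \<bar>nth_deriv j (inv_iter \<psi> (fst i)) ((\<psi> ^^ Suc (fst i)) (snd i))\<bar>
      \<le> C * (1 + ((\<psi> ^^ Suc (fst i)) (snd i))\<^sup>2) ^ N" by blast
  qed (rule kdiff_inv_iter)
  then obtain C N where CN: "\<And>n t. t \<in> K \<Longrightarrow>
      norm (nth_deriv k (\<lambda>y. inv_iter \<psi> 1 (inv_iter \<psi> n y)) ((\<psi> ^^ Suc n) t)) \<le> C * (1 + ((\<psi> ^^ Suc n) t)\<^sup>2) ^ N"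
    by (metis SigmaI UNIV_I fst_conv snd_conv)
  have "\<bar>nth_deriv k (inv_iter \<psi> n) ((\<psi> ^^ n) t)\<bar> \<le> max 1 \<bar>C\<bar> * (1 + ((\<psi> ^^ n) t)\<^sup>2) ^ N" if t: "t \<in> K" for n t
  proof (cases n)
    case 0
    \<comment> \<open>For exponent 0 the inverse is the identity, whose derivatives of positive
      order are at most 1.\<close>
    have "inv_iter \<psi> 0 = (\<lambda>x. 0 + x *\<^sub>R 1)" by (auto simp: inv_iter_def inv_id[unfolded id_def] id_def)
    then have "\<bar>nth_deriv k (inv_iter \<psi> n) ((\<psi> ^^ n) t)\<bar> \<le> 1 * (1 + ((\<psi> ^^ n) t)\<^sup>2) ^ 0"
      using k by (simp only: 0 nth_deriv_affine) auto
    then show ?thesis by (rule weight_bound_mono) auto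
  next
    case (Suc m)
    have "nth_deriv k (inv_iter \<psi> (Suc m)) ((\<psi> ^^ Suc m) t) =
        nth_deriv k (\<lambda>y. inv_iter \<psi> 1 (inv_iter \<psi> m y)) ((\<psi> ^^ Suc m) t)"
      by (rule nth_deriv_cong[OF open_range_iterate[of "Suc m"] inv_iter_eq_Suc(2) rangeI])
    then have "\<bar>nth_deriv k (inv_iter \<psi> (Suc m)) ((\<psi> ^^ Suc m) t)\<bar> \<le> C * (1 + ((\<psi> ^^ Suc m) t)\<^sup>2) ^ N"
      using CN[OF t, of m] by (simp only: real_norm_def)
    then show ?thesis unfolding Suc by (rule weight_bound_mono) auto
  qed
  then show "\<exists>C N. \<forall>i\<in>UNIV \<times> K. \<bar>nth_deriv k (inv_iter \<psi> (fst i)) ((\<psi> ^^ fst i) (snd i))\<bar>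
      \<le> C * (1 + ((\<psi> ^^ fst i) (snd i))\<^sup>2) ^ N" by (metis mem_Times_iff)
qed

lemma compact_iterate_image: "compact K \<Longrightarrow> compact ((\<psi> ^^ n) ` K)"
  using smooth_continuous_on[OF smooth_iterate, of K 0] by (simp add: compact_continuous_image)

lemma tame_iterate_image: "compact K \<Longrightarrow> tame K \<Longrightarrow> tame ((\<psi> ^^ n) ` K)"
proof (induction n)
  case (Suc n)
  then show ?case using tame_image[OF compact_iterate_image[of K n]] by (simp add: image_comp)
qed simp

lemma tame_iterate_preimage: "compact K \<Longrightarrow> tame ((\<psi> ^^ n) ` K) \<Longrightarrow> tame K"
proof (induction n)
  case (Suc n)
  then show ?case using tame_preimage[OF compact_iterate_image[of K n]] by (simp add: image_comp)
qed simp

text \<open>For a single \<open>n\<close> compactness suffices; this makes the suprema meaningful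
  and takes care of finitely many small exponents.\<close>

lemma weighted_inverse_bounded:
  fixes v :: "real \<Rightarrow> complex"
  assumes "v \<in> schwartz" "compact K"
  obtains B where "\<And>x. x \<in> (\<psi> ^^ n) ` K \<Longrightarrow> cmod (v x * complex_of_real (nth_deriv k (inv_iter \<psi> n) x)) \<le> B"
proof -
  have "continuous_on ((\<psi> ^^ n) ` K) v"
    using assms(1) smooth_continuous_on[of v _ 0] by (simp add: schwartz_iff)
  moreover have "continuous_on ((\<psi> ^^ n) ` K) (nth_deriv k (inv_iter \<psi> n))"
    by (rule continuous_on_subset[OF kdiff_continuous_on[OF kdiff_inv_iter lessI]]) auto
  ultimately have "compact ((\<lambda>x. v x * complex_of_real (nth_deriv k (inv_iter \<psi> n) x)) ` (\<psi> ^^ n) ` K)"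
    by (intro compact_continuous_image compact_iterate_image assms continuous_intros)
  then have "bounded ((\<lambda>x. v x * complex_of_real (nth_deriv k (inv_iter \<psi> n) x)) ` (\<psi> ^^ n) ` K)"
    by (rule compact_imp_bounded)
  then obtain B where "\<forall>y\<in>(\<lambda>x. v x * complex_of_real (nth_deriv k (inv_iter \<psi> n) x)) ` (\<psi> ^^ n) ` K. norm y \<le> B"
    unfolding bounded_iff by blast
  then show ?thesis using that by blast
qed

text \<open>Convergent suprema are bounded, so the family is bounded against every weight and grows
  polynomially. Conversely, polynomial growth leaves a spare power of decay, which the escape of the
  images turns into convergence to 0.\<close>

lemma sup_tendsto_0_iff_inverse_growth:
  assumes K: "compact K" "K \<noteq> {}" and esc: "\<And>L. \<exists>N. \<forall>n\<ge>N. \<forall>t. L < \<bar>(\<psi> ^^ n) t\<bar>"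
  shows "(\<forall>v\<in>(schwartz :: (real \<Rightarrow> complex) set).
     (\<lambda>n. SUP x\<in>(\<psi> ^^ n) ` K. cmod (v x * complex_of_real (nth_deriv k (inv_iter \<psi> n) x))) \<longlonglongrightarrow> 0)
     \<longleftrightarrow> inverse_growth k K"
proof
  assume *: "\<forall>v\<in>(schwartz :: (real \<Rightarrow> complex) set).
     (\<lambda>n. SUP x\<in>(\<psi> ^^ n) ` K. cmod (v x * complex_of_real (nth_deriv k (inv_iter \<psi> n) x))) \<longlonglongrightarrow> 0"
  show "inverse_growth k K"
    unfolding inverse_growth_iff
  proof (rule polynomial_growth_if_schwartz_bounded)
    fix v :: "real \<Rightarrow> complex" assume v: "v \<in> schwartz"
    let ?s = "\<lambda>n. SUP x\<in>(\<psi> ^^ n) ` K. cmod (v x * complex_of_real (nth_deriv k (inv_iter \<psi> n) x))"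
    have "Bseq ?s" using * v convergentI by (intro convergent_imp_Bseq) blast
    then obtain B where B: "\<And>n. norm (?s n) \<le> B" by (auto simp: Bseq_def)
    have "cmod (v x) * \<bar>nth_deriv k (inv_iter \<psi> n) x\<bar> \<le> B" if "x \<in> (\<psi> ^^ n) ` K" for n x
    proof -
      have "bdd_above ((\<lambda>x. cmod (v x * complex_of_real (nth_deriv k (inv_iter \<psi> n) x))) ` (\<psi> ^^ n) ` K)"
        by (rule weighted_inverse_bounded[OF v K(1), of n k], rule bdd_aboveI2)
      then have "cmod (v x * complex_of_real (nth_deriv k (inv_iter \<psi> n) x)) \<le> ?s n"
        by (rule cSUP_upper[OF that])
      then show ?thesis using B[of n] by (simp add: norm_mult)
    qed
    then show "\<exists>B. \<forall>i\<in>UNIV \<times> K. cmod (v ((\<psi> ^^ fst i) (snd i))) *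
        \<bar>nth_deriv k (inv_iter \<psi> (fst i)) ((\<psi> ^^ fst i) (snd i))\<bar> \<le> B"
      by (metis imageI mem_Times_iff)
  qed
next
  assume "inverse_growth k K"
  then obtain C N where CN: "\<And>n x. x \<in> (\<psi> ^^ n) ` K \<Longrightarrow> \<bar>nth_deriv k (inv_iter \<psi> n) x\<bar> \<le> C * (1 + x\<^sup>2) ^ N"
    unfolding inverse_growth_def by metis
  show "\<forall>v\<in>(schwartz :: (real \<Rightarrow> complex) set).
     (\<lambda>n. SUP x\<in>(\<psi> ^^ n) ` K. cmod (v x * complex_of_real (nth_deriv k (inv_iter \<psi> n) x))) \<longlonglongrightarrow> 0"
  proof
    fix v :: "real \<Rightarrow> complex" assume v: "v \<in> schwartz"
    let ?s = "\<lambda>n. SUP x\<in>(\<psi> ^^ n) ` K. cmod (v x * complex_of_real (nth_deriv k (inv_iter \<psi> n) x))"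
    show "?s \<longlonglongrightarrow> 0"
    proof (rule LIMSEQ_I)
      fix \<epsilon> :: real assume "0 < \<epsilon>"
      then obtain R where R: "\<And>x y. R < \<bar>x\<bar> \<Longrightarrow> \<bar>y\<bar> \<le> C * (1 + x\<^sup>2) ^ N \<Longrightarrow> norm (v x) * \<bar>y\<bar> < \<epsilon> / 2"
        using schwartz_times_growth_small[OF v, of "\<epsilon> / 2" C N] by auto
      obtain n0 where n0: "\<And>n t. n \<ge> n0 \<Longrightarrow> R < \<bar>(\<psi> ^^ n) t\<bar>" using esc by blast
      have "norm (?s n - 0) < \<epsilon>" if "n \<ge> n0" for n
      proof -
        have le: "cmod (v x * complex_of_real (nth_deriv k (inv_iter \<psi> n) x)) \<le> \<epsilon> / 2" if "x \<in> (\<psi> ^^ n) ` K" for x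
          using R[OF _ CN[OF that]] n0[OF \<open>n \<ge> n0\<close>] that by (force simp: norm_mult)
        then have "?s n \<le> \<epsilon> / 2" using K(2) by (intro cSUP_least) auto
        moreover have "0 \<le> ?s n"
        proof -
          obtain x where x: "x \<in> (\<psi> ^^ n) ` K" using K(2) by blast
          have "bdd_above ((\<lambda>x. cmod (v x * complex_of_real (nth_deriv k (inv_iter \<psi> n) x))) ` (\<psi> ^^ n) ` K)"
            using le by (intro bdd_aboveI2)
          then have "cmod (v x * complex_of_real (nth_deriv k (inv_iter \<psi> n) x)) \<le> ?s n"
            by (rule cSUP_upper[OF x])
          then show ?thesis by (rule order_trans[OF norm_ge_zero])
        qed
        ultimately show ?thesis using \<open>0 < \<epsilon>\<close> by simp
      qed
      then show "\<exists>n0. \<forall>n\<ge>n0. norm (?s n - 0) < \<epsilon>" by blast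
    qed
  qed
qed

end


section \<open>Mixing\<close>

lemma comp_op_funpow: "(comp_op \<psi> ^^ n) f = (\<lambda>x. f ((\<psi> ^^ n) x))"
  by (induction n) (auto simp: comp_op_def o_def funpow_swap1)

lemma mixingD:
  assumes "mixing O_M_topology (comp_op \<psi>)" "openin O_M_topology U" "f \<in> U" "openin O_M_topology V" "g \<in> V"
  obtains n0 where "\<And>n. n \<ge> n0 \<Longrightarrow> \<exists>f\<in>U. (\<lambda>x. f ((\<psi> ^^ n) x)) \<in> V"
proof -
  have "\<forall>\<^sub>F n in sequentially. (comp_op \<psi> ^^ n) ` U \<inter> V \<noteq> {}"
    using assms unfolding mixing_def by blast
  then obtain n0 where n0: "\<And>n. n \<ge> n0 \<Longrightarrow> (comp_op \<psi> ^^ n) ` U \<inter> V \<noteq> {}"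
    unfolding eventually_sequentially by blast
  have "\<exists>f\<in>U. (\<lambda>x. f ((\<psi> ^^ n) x)) \<in> V" if "n \<ge> n0" for n
    using n0[OF that] comp_op_funpow[of n \<psi>] by fastforce
  then show ?thesis by (rule that)
qed

section \<open>Necessary conditions for mixing\<close>

lemma of_real_eq_affine: "complex_of_real = (\<lambda>x. 0 + x *\<^sub>R 1)"
  by (auto simp: of_real_def)

lemma of_real_O_M: "complex_of_real \<in> O_M"
  unfolding of_real_eq_affine by (rule O_M_affine)

lemma nth_deriv_of_real:
  "nth_deriv j complex_of_real x = (if j = 0 then of_real x else if j = 1 then 1 else 0)"
  unfolding of_real_eq_affine nth_deriv_affine by simp

text \<open>If \<open>\<psi> x = \<psi> y\<close>, a composition with a positive iterate takes one
  value at both points, and no number is closer than half their distance to both.\<close>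

lemma mixing_imp_inj:
  assumes "mixing O_M_topology (comp_op \<psi>)"
  shows "inj \<psi>"
proof (rule injI, rule ccontr)
  fix x y assume xy: "\<psi> x = \<psi> y" "x \<noteq> y"
  let ?L = "max \<bar>x\<bar> \<bar>y\<bar>"
  obtain V where V: "openin O_M_topology V" "complex_of_real \<in> V"
    "\<And>g z j. g \<in> V \<Longrightarrow> \<bar>z\<bar> \<le> ?L \<Longrightarrow> j \<le> 0 \<Longrightarrow> cmod (nth_deriv j g z - nth_deriv j complex_of_real z) < \<bar>x - y\<bar> / 2"
    using C_k_neighbourhood[OF of_real_O_M, of "\<bar>x - y\<bar> / 2" ?L 0] xy by auto
  obtain n0 where "\<And>n. n \<ge> n0 \<Longrightarrow> \<exists>f\<in>V. (\<lambda>x. f ((\<psi> ^^ n) x)) \<in> V"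
    using mixingD[OF assms V(1,2) V(1,2)] by blast
  then obtain f where f: "(\<lambda>x. f ((\<psi> ^^ Suc n0) x)) \<in> V" by (meson le_SucI order_refl)
  have e: "(\<psi> ^^ Suc n0) x = (\<psi> ^^ Suc n0) y" using xy(1) by (simp only: funpow_Suc_right o_def)
  let ?c = "f ((\<psi> ^^ Suc n0) x)"
  have "cmod (?c - of_real x) < \<bar>x - y\<bar> / 2" "cmod (?c - of_real y) < \<bar>x - y\<bar> / 2"
    using V(3)[OF f, of x 0] V(3)[OF f, of y 0] e by (auto simp: nth_deriv_of_real)
  then have "cmod (?c - of_real x) + cmod (?c - of_real y) < \<bar>x - y\<bar> / 2 + \<bar>x - y\<bar> / 2"
    by (rule add_strict_mono)
  moreover have "\<bar>x - y\<bar> \<le> cmod (?c - of_real x) + cmod (?c - of_real y)"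
    using norm_triangle_ineq4[of "?c - of_real y" "?c - of_real x"]
    by (simp add: of_real_diff[symmetric] del: of_real_diff)
  ultimately show False unfolding field_sum_of_halves by (rule leD[THEN notE, rotated])
qed

text \<open>With \<open>\<psi>\<close> as innermost factor, the chain rule makes the derivative of
  the composition vanish at \<open>x\<close>, whereas a function close to the identity has
  derivative close to 1 there.\<close>

lemma mixing_imp_deriv_nonzero:
  assumes "mixing O_M_topology (comp_op \<psi>)" and \<psi>: "\<psi> \<in> O_M"
  shows "nth_deriv (Suc 0) \<psi> x \<noteq> 0"
proof
  assume z: "nth_deriv (Suc 0) \<psi> x = 0"
  obtain V where V: "openin O_M_topology V" "complex_of_real \<in> V"
    "\<And>g z j. g \<in> V \<Longrightarrow> \<bar>z\<bar> \<le> \<bar>x\<bar> \<Longrightarrow> j \<le> 1 \<Longrightarrow> cmod (nth_deriv j g z - nth_deriv j complex_of_real z) < 1 / 2"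
    using C_k_neighbourhood[OF of_real_O_M, of "1 / 2" "\<bar>x\<bar>" 1] by auto
  obtain n0 where "\<And>n. n \<ge> n0 \<Longrightarrow> \<exists>f\<in>V. (\<lambda>x. f ((\<psi> ^^ n) x)) \<in> V"
    using mixingD[OF assms(1) V(1,2) V(1,2)] by blast
  then obtain f where f: "f \<in> V" "(\<lambda>x. f ((\<psi> ^^ Suc n0) x)) \<in> V" by (meson le_SucI order_refl)
  define p where "p = (\<lambda>y. f ((\<psi> ^^ n0) y))"
  have fO: "smooth f" using f(1) openin_subset[OF V(1)] by (auto simp: topspace_O_M O_M_smooth)
  have "smooth (\<psi> ^^ n0)" by (rule smooth_funpow[OF O_M_smooth[OF \<psi>]])
  then have "smooth p" unfolding p_def by (rule smooth_compose[OF fO])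
  then have "((\<lambda>y. p (\<psi> y)) has_vector_derivative nth_deriv (Suc 0) \<psi> x *\<^sub>R nth_deriv (Suc 0) p (\<psi> x)) (at x)"
    by (intro chain_deriv[of UNIV \<psi> UNIV p] smooth_kdiff[OF \<open>smooth p\<close>] smooth_kdiff[OF O_M_smooth[OF \<psi>]]) auto
  then have "nth_deriv (Suc 0) (\<lambda>y. p (\<psi> y)) x = 0" using z nth_deriv_1I by fastforce
  moreover have "(\<lambda>y. p (\<psi> y)) = (\<lambda>x. f ((\<psi> ^^ Suc n0) x))"
    by (simp only: p_def funpow_Suc_right o_def)
  ultimately show False using V(3)[OF f(2), of x 1] by (simp add: nth_deriv_of_real)
qed

text \<open>Composition with iterates preserves the value at a fixed point, so a function near 0
  there is never sent near 1.\<close>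

lemma mixing_imp_no_fixed_point:
  assumes "mixing O_M_topology (comp_op \<psi>)"
  shows "\<psi> x \<noteq> x"
proof
  assume fp: "\<psi> x = x"
  then have it: "(\<psi> ^^ n) x = x" for n by (induction n) auto
  \<comment> \<open>Constants are written as affine functions of slope 0, which are known to lie in
    \<open>O_M\<close>.\<close>
  have O: "(\<lambda>y. c + y *\<^sub>R 0) \<in> O_M" for c :: complex by (rule O_M_affine)
  obtain U where U: "openin O_M_topology U" "(\<lambda>y. 0 + y *\<^sub>R 0) \<in> U"
    "\<And>g z j. g \<in> U \<Longrightarrow> \<bar>z\<bar> \<le> \<bar>x\<bar> \<Longrightarrow> j \<le> 0 \<Longrightarrow> cmod (nth_deriv j g z - nth_deriv j (\<lambda>y. 0 + y *\<^sub>R 0) z) < 1 / 2"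
    using C_k_neighbourhood[OF O[of 0], of "1 / 2" "\<bar>x\<bar>" 0] by auto
  obtain V where V: "openin O_M_topology V" "(\<lambda>y. 1 + y *\<^sub>R 0) \<in> V"
    "\<And>g z j. g \<in> V \<Longrightarrow> \<bar>z\<bar> \<le> \<bar>x\<bar> \<Longrightarrow> j \<le> 0 \<Longrightarrow> cmod (nth_deriv j g z - nth_deriv j (\<lambda>y. 1 + y *\<^sub>R 0) z) < 1 / 2"
    using C_k_neighbourhood[OF O[of 1], of "1 / 2" "\<bar>x\<bar>" 0] by auto
  obtain n0 where "\<And>n. n \<ge> n0 \<Longrightarrow> \<exists>f\<in>U. (\<lambda>x. f ((\<psi> ^^ n) x)) \<in> V"
    using mixingD[OF assms U(1,2) V(1,2)] by blast
  then obtain f where f: "f \<in> U" "(\<lambda>x. f ((\<psi> ^^ n0) x)) \<in> V" by blast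
  have "cmod (f x) < 1 / 2" using U(3)[OF f(1), of x 0] by simp
  moreover have "cmod (f x - 1) < 1 / 2" using V(3)[OF f(2), of x 0] by (simp add: it)
  moreover have "1 \<le> cmod (f x) + cmod (f x - 1)"
    using norm_triangle_ineq4[of "f x" "f x - 1"] by simp
  ultimately show False by linarith
qed

context smooth_embedding
begin

text \<open>If \<open>h = f \<circ> (\<psi> ^^ n)\<close> is close to the identity, then \<open>f = h \<circ> inv_iter \<psi> n\<close> on the range, and up to
  terms in lower derivatives of \<open>inv_iter \<psi> n\<close> the \<open>k\<close>-th derivative of \<open>f\<close> is \<open>h'\<close>, which is
  bounded below, times that of \<open>inv_iter \<psi> n\<close>. A small \<open>f\<close> thus forces a small inverse.\<close>

lemma mixing_imp_inverse_growth:
  assumes mix: "mixing O_M_topology (comp_op \<psi>)" and K: "compact K" and "1 \<le> k"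
  shows "inverse_growth k K"
  using \<open>1 \<le> k\<close>
proof (induction k rule: less_induct)
  case (less k)
  then obtain k' where k: "k = Suc k'" by (cases k) auto
  have "\<exists>C N. \<forall>i\<in>UNIV \<times> K. (if j = 0 then 0 else \<bar>nth_deriv j (inv_iter \<psi> (fst i)) ((\<psi> ^^ fst i) (snd i))\<bar>)
      \<le> C * (1 + ((\<psi> ^^ fst i) (snd i))\<^sup>2) ^ N" if "j \<le> k'" for j
    using less.IH[of j, unfolded inverse_growth_iff] that k by (cases j) (auto intro!: exI[of _ 0])
  then obtain C N where C: "1 \<le> C" and "\<And>j i. j \<le> k' \<Longrightarrow> i \<in> UNIV \<times> K \<Longrightarrow>
      (if j = 0 then 0 else \<bar>nth_deriv j (inv_iter \<psi> (fst i)) ((\<psi> ^^ fst i) (snd i))\<bar>) \<le> C * (1 + ((\<psi> ^^ fst i) (snd i))\<^sup>2) ^ N"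
    using uniform_growth[of k' "UNIV \<times> K" "\<lambda>j i. if j = 0 then 0 else \<bar>nth_deriv j (inv_iter \<psi> (fst i)) ((\<psi> ^^ fst i) (snd i))\<bar>"
      "\<lambda>i. (\<psi> ^^ fst i) (snd i)"] by blast
  note CN0 = this(2)
  have CN: "\<bar>nth_deriv j (inv_iter \<psi> n) ((\<psi> ^^ n) t)\<bar> \<le> C * (1 + ((\<psi> ^^ n) t)\<^sup>2) ^ N"
    if "1 \<le> j" "j \<le> k'" "t \<in> K" for j n t
    using CN0[OF that(2), of "(n, t)"] that by simp
  obtain L where L: "\<And>t. t \<in> K \<Longrightarrow> \<bar>t\<bar> \<le> L"
    using compact_imp_bounded[OF K] by (auto simp: bounded_iff)
  \<comment> \<open>On \<open>K\<close> all derivatives of the identity are at most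
    \<open>\<bar>L\<bar> + 1\<close>, and closeness costs another 1/2.\<close>
  define A where "A = \<bar>L\<bar> + 2"
  obtain V where V: "openin O_M_topology V" "complex_of_real \<in> V"
    "\<And>g z j. g \<in> V \<Longrightarrow> \<bar>z\<bar> \<le> L \<Longrightarrow> j \<le> k \<Longrightarrow> cmod (nth_deriv j g z - nth_deriv j complex_of_real z) < 1 / 2"
    using C_k_neighbourhood[OF of_real_O_M, of "1 / 2" L k] by auto
  show ?case
    unfolding inverse_growth_iff
  proof (rule polynomial_growth_if_schwartz_bounded)
    fix v :: "real \<Rightarrow> complex" assume v: "v \<in> schwartz"
    \<comment> \<open>The ball depends on \<open>v\<close>, hence so does \<open>n0\<close>; the
      finitely many smaller exponents are treated by compactness below.\<close>
    let ?U = "{g \<in> O_M. O_M_seminorm k v (\<lambda>x. g x - (\<lambda>x. 0) x) < 1}"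
    have Z: "(\<lambda>x. 0) \<in> (O_M :: (real \<Rightarrow> complex) set)" using O_M_affine[of "0::complex" 0] by simp
    have U: "openin O_M_topology ?U" "(\<lambda>x. 0) \<in> ?U"
      using openin_seminorm_ball[OF v Z zero_less_one] seminorm_zero[of k v "\<lambda>x. 0"] Z by auto
    obtain n0 where n0: "\<And>n. n \<ge> n0 \<Longrightarrow> \<exists>f\<in>?U. (\<lambda>x. f ((\<psi> ^^ n) x)) \<in> V"
      using mixingD[OF mix U V(1,2)] by blast
    \<comment> \<open>\<open>B\<close> absorbs the remainder of the chain rule, whose growth is a
      power of the growth known for the lower orders.\<close>
    obtain B where B: "0 \<le> B" "\<And>x y. \<bar>y\<bar> \<le> (bell k * A * C ^ k) * (1 + x\<^sup>2) ^ (N * k) \<Longrightarrow>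
        (1 + x\<^sup>2) ^ 0 * norm (v x) * \<bar>y\<bar> \<le> B"
      using schwartz_times_growth[OF v] by blast
    \<comment> \<open>The factor 2 is the reciprocal of the lower bound for the first derivative of
      \<open>h\<close>; the summand 1 is the radius of the ball.\<close>
    have large: "cmod (v ((\<psi> ^^ n) t)) * \<bar>nth_deriv k (inv_iter \<psi> n) ((\<psi> ^^ n) t)\<bar> \<le> 2 * (1 + B)"
      if n: "n \<ge> n0" and t: "t \<in> K" for n t
    proof -
      obtain f where f: "f \<in> ?U" "(\<lambda>x. f ((\<psi> ^^ n) x)) \<in> V" using n0[OF n] by blast
      define h where "h = (\<lambda>x. f ((\<psi> ^^ n) x))"
      define x where "x = (\<psi> ^^ n) t"
      define M where "M = C * (1 + x\<^sup>2) ^ N"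
      have M1: "1 \<le> M" unfolding M_def using mult_mono[OF C weight_ge_1[of x N]] C by simp
      have "h \<in> O_M" using f(2) openin_subset[OF V(1)] by (auto simp: h_def topspace_O_M)
      then have h: "smooth h" by (rule O_M_smooth)
      have close: "cmod (nth_deriv j h t - nth_deriv j complex_of_real t) < 1 / 2" if "j \<le> k" for j
        using V(3)[OF f(2) L[OF t] that] by (simp add: h_def)
      have hb: "cmod (nth_deriv j h t) \<le> A" if "j \<le> k" for j
      proof -
        have "cmod (nth_deriv j h t) \<le> cmod (nth_deriv j complex_of_real t) + cmod (nth_deriv j h t - nth_deriv j complex_of_real t)"
          using norm_triangle_sub .
        moreover have "cmod (nth_deriv j complex_of_real t) \<le> \<bar>L\<bar> + 1"
          using L[OF t] by (auto simp: nth_deriv_of_real)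
        ultimately show ?thesis using close[OF that] by (simp add: A_def)
      qed
      have "1 - cmod (nth_deriv (Suc 0) h t) \<le> cmod (1 - nth_deriv (Suc 0) h t)"
        using norm_triangle_ineq2[of 1 "nth_deriv (Suc 0) h t"] by simp
      then have h1: "1 / 2 \<le> cmod (nth_deriv (Suc 0) h t)"
        using close[of "Suc 0"] k by (simp add: nth_deriv_of_real norm_minus_commute)
      have xr: "x \<in> range (\<psi> ^^ n)" by (simp add: x_def)
      have "nth_deriv k f x = nth_deriv k (\<lambda>y. h (inv_iter \<psi> n y)) x"
        by (rule nth_deriv_cong[OF open_range_iterate[of n] _ xr]) (auto simp: h_def)
      moreover have "norm (nth_deriv (Suc k') (\<lambda>y. h (inv_iter \<psi> n y)) x
          - nth_deriv (Suc k') (inv_iter \<psi> n) x *\<^sub>R nth_deriv (Suc 0) h (inv_iter \<psi> n x)) \<le> bell (Suc k') * A * M ^ Suc k'"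
      proof (rule norm_nth_deriv_compose_remainder[OF open_range_iterate kdiff_inv_iter smooth_kdiff[OF h] subset_UNIV xr M1])
        show "\<bar>nth_deriv j (inv_iter \<psi> n) x\<bar> \<le> M" if "1 \<le> j" "j \<le> k'" for j
          using CN[OF that t, of n] by (simp add: x_def M_def)
        show "cmod (nth_deriv i h (inv_iter \<psi> n x)) \<le> A" if "i \<le> Suc k'" for i
          using hb[of i] that k by (simp add: x_def)
      qed
      ultimately have rem: "cmod (nth_deriv k f x - nth_deriv k (inv_iter \<psi> n) x *\<^sub>R nth_deriv (Suc 0) h t) \<le> bell k * A * M ^ k"
        unfolding k by (simp add: x_def)
      let ?d = "\<bar>nth_deriv k (inv_iter \<psi> n) x\<bar>"
      have "?d * (1 / 2) \<le> ?d * cmod (nth_deriv (Suc 0) h t)" using h1 by (intro mult_left_mono) auto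
      also have "\<dots> = cmod (nth_deriv k (inv_iter \<psi> n) x *\<^sub>R nth_deriv (Suc 0) h t)" by simp
      also have "\<dots> \<le> cmod (nth_deriv k f x) + bell k * A * M ^ k"
        using norm_triangle_sub[of "nth_deriv k (inv_iter \<psi> n) x *\<^sub>R nth_deriv (Suc 0) h t" "nth_deriv k f x"] rem
        by (simp add: norm_minus_commute)
      finally have "cmod (v x) * (?d * (1 / 2)) \<le> cmod (v x) * (cmod (nth_deriv k f x) + bell k * A * M ^ k)"
        by (intro mult_left_mono) auto
      moreover have "cmod (v x) * cmod (nth_deriv k f x) \<le> 1"
        using seminorm_ge[of f v k k x] f(1) v by auto
      moreover have "cmod (v x) * (bell k * A * M ^ k) \<le> B"
      proof -
        define X where "X = bell k * A * M ^ k"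
        have "0 \<le> X" using M1 by (simp add: A_def X_def)
        moreover have "X = (bell k * A * C ^ k) * (1 + x\<^sup>2) ^ (N * k)"
          by (simp add: X_def M_def power_mult_distrib power_mult mult.assoc)
        ultimately have "\<bar>X\<bar> \<le> (bell k * A * C ^ k) * (1 + x\<^sup>2) ^ (N * k)" by linarith
        from B(2)[OF this] show ?thesis using \<open>0 \<le> X\<close> by (simp add: X_def)
      qed
      ultimately show ?thesis by (simp add: x_def distrib_left)
    qed
    have "\<exists>b. \<forall>t\<in>K. cmod (v ((\<psi> ^^ n) t)) * \<bar>nth_deriv k (inv_iter \<psi> n) ((\<psi> ^^ n) t)\<bar> \<le> b" for n
    proof -
      obtain b where "\<And>x. x \<in> (\<psi> ^^ n) ` K \<Longrightarrow> cmod (v x * complex_of_real (nth_deriv k (inv_iter \<psi> n) x)) \<le> b"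
        using weighted_inverse_bounded[OF v K] by blast
      then show ?thesis by (auto simp: norm_mult)
    qed
    then obtain b where b: "\<And>n t. t \<in> K \<Longrightarrow> cmod (v ((\<psi> ^^ n) t)) * \<bar>nth_deriv k (inv_iter \<psi> n) ((\<psi> ^^ n) t)\<bar> \<le> b n"
      by metis
    have "cmod (v ((\<psi> ^^ n) t)) * \<bar>nth_deriv k (inv_iter \<psi> n) ((\<psi> ^^ n) t)\<bar> \<le> 2 * (1 + B) + (\<Sum>n<n0. \<bar>b n\<bar>)"
      if t: "t \<in> K" for n t
    proof (cases "n < n0")
      case True
      then have "\<bar>b n\<bar> \<le> (\<Sum>n<n0. \<bar>b n\<bar>)" by (intro member_le_sum) auto
      also have "\<dots> \<le> 2 * (1 + B) + (\<Sum>n<n0. \<bar>b n\<bar>)" using B(1) by simp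
      finally have "\<bar>b n\<bar> \<le> 2 * (1 + B) + (\<Sum>n<n0. \<bar>b n\<bar>)" .
      with order_trans[OF b[OF t, of n] abs_ge_self] show ?thesis by (rule order_trans)
    next
      case False
      then have "cmod (v ((\<psi> ^^ n) t)) * \<bar>nth_deriv k (inv_iter \<psi> n) ((\<psi> ^^ n) t)\<bar> \<le> 2 * (1 + B)"
        by (intro large t) simp
      then show ?thesis by (rule add_increasing2[rotated]) (simp add: sum_nonneg)
    qed
    then show "\<exists>B. \<forall>i\<in>UNIV \<times> K. cmod (v ((\<psi> ^^ fst i) (snd i))) *
        \<bar>nth_deriv k (inv_iter \<psi> (fst i)) ((\<psi> ^^ fst i) (snd i))\<bar> \<le> B" by auto
  qed
qed

text \<open>Some iterate carries \<open>K\<close> into finitely many images of the fundamental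
  interval. Tameness goes forward from the interval to these images, passes to the subset, and
  returns along the iterate to \<open>K\<close>.\<close>

lemma tame_transport:
  assumes "tame {min a (\<psi> a)..max a (\<psi> a)}" and fp: "\<And>x. \<psi> x \<noteq> x" and ns: "\<not> surj \<psi>"
    and K: "compact K"
  shows "tame K"
proof -
  let ?J = "{min a (\<psi> a)..max a (\<psi> a)}"
  have cont: "continuous_on UNIV \<psi>" using smooth_continuous_on[OF smooth, of UNIV 0] by simp
  obtain R where R: "\<And>t. t \<in> K \<Longrightarrow> \<bar>t\<bar> \<le> R"
    using compact_imp_bounded[OF K] by (auto simp: bounded_iff)
  obtain N M where NM: "\<And>t. \<bar>t\<bar> \<le> R \<Longrightarrow> (\<exists>i<M. (\<psi> ^^ N) t \<in> (\<psi> ^^ i) ` ?J)"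
    using iterates_escape(2)[OF cont inj fp ns] by blast
  have "tame (\<Union>i<M. (\<psi> ^^ i) ` ?J)"
    by (intro tame_UN tame_iterate_image assms(1) compact_Icc)
  moreover have "(\<psi> ^^ N) ` K \<subseteq> (\<Union>i<M. (\<psi> ^^ i) ` ?J)" using NM R by fast
  ultimately show ?thesis using tame_subset tame_iterate_preimage[OF K] by blast
qed

text \<open>A compactly supported \<open>g\<close> is pulled back along \<open>\<psi> ^^ n\<close> exactly, by extending
  \<open>g \<circ> inv_iter \<psi> n\<close> by zero.\<close>

lemma tame_imp_pullback_small:
  fixes g v :: "real \<Rightarrow> complex"
  assumes tame: "tame {-L..L}" and esc: "\<And>R. \<exists>N. \<forall>n\<ge>N. \<forall>t. R < \<bar>(\<psi> ^^ n) t\<bar>"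
    and g: "smooth g" "\<And>x. L < \<bar>x\<bar> \<Longrightarrow> g x = 0" and v: "v \<in> schwartz" and "0 < \<epsilon>"
  obtains n0 where "\<And>n. n \<ge> n0 \<Longrightarrow> \<exists>G\<in>O_M. O_M_seminorm m v G < \<epsilon> \<and> (\<forall>t. G ((\<psi> ^^ n) t) = g t)"
proof -
  let ?J = "{-L..L}"
  have gr: "\<exists>C N. \<forall>i\<in>UNIV \<times> ?J. norm (nth_deriv j (\<lambda>y. g (inv_iter \<psi> (fst i) y)) ((\<psi> ^^ fst i) (snd i)))
      \<le> C * (1 + ((\<psi> ^^ fst i) (snd i))\<^sup>2) ^ N" if "j \<le> m" for j
  proof -
    obtain A where A: "\<And>i x. i \<le> j \<Longrightarrow> x \<in> ?J \<Longrightarrow> norm (nth_deriv i g x) \<le> A"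
      using compact_nth_deriv_bounded[OF smooth_kdiff[OF g(1)] compact_Icc subset_UNIV] by blast
    show ?thesis
    proof (rule compose_growth[where S = "\<lambda>i. range (\<psi> ^^ fst i)" and T = UNIV and A = A
        and h = g and g = "\<lambda>i. inv_iter \<psi> (fst i)" and x = "\<lambda>i. (\<psi> ^^ fst i) (snd i)"])
      fix i :: "nat \<times> real" assume i: "i \<in> UNIV \<times> ?J"
      show "open (range (\<psi> ^^ fst i)) \<and> (\<psi> ^^ fst i) (snd i) \<in> range (\<psi> ^^ fst i) \<and>
          kdiff j (range (\<psi> ^^ fst i)) (inv_iter \<psi> (fst i)) \<and> inv_iter \<psi> (fst i) ` range (\<psi> ^^ fst i) \<subseteq> UNIV"
        using open_range_iterate kdiff_inv_iter by blast
      show "cmod (nth_deriv l g (inv_iter \<psi> (fst i) ((\<psi> ^^ fst i) (snd i)))) \<le> A" if "l \<le> j" for l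
        unfolding inv_iter_iterate using A[OF that] i by auto
    next
      show "\<exists>C N. \<forall>i\<in>UNIV \<times> ?J. \<bar>nth_deriv l (inv_iter \<psi> (fst i)) ((\<psi> ^^ fst i) (snd i))\<bar>
          \<le> C * (1 + ((\<psi> ^^ fst i) (snd i))\<^sup>2) ^ N" if "1 \<le> l" for l
        using tame that unfolding tame_def inverse_growth_iff by blast
    qed (rule smooth_kdiff[OF g(1)])
  qed
  define D where "D j i = cmod (nth_deriv j (\<lambda>y. g (inv_iter \<psi> (fst i) y)) ((\<psi> ^^ fst i) (snd i)))"
    for j and i :: "nat \<times> real"
  from uniform_growth[of m "UNIV \<times> ?J" D "\<lambda>i. (\<psi> ^^ fst i) (snd i)"] gr
  obtain C N where CN0: "\<And>j i. j \<le> m \<Longrightarrow> i \<in> UNIV \<times> ?J \<Longrightarrow> D j i \<le> C * (1 + ((\<psi> ^^ fst i) (snd i))\<^sup>2) ^ N"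
    unfolding D_def[symmetric] by metis
  \<comment> \<open>Half of \<open>\<epsilon>\<close>, because passing to the supremum preserves
    only the weak inequality.\<close>
  obtain R where R: "\<And>x y. R < \<bar>x\<bar> \<Longrightarrow> \<bar>y\<bar> \<le> C * (1 + x\<^sup>2) ^ N \<Longrightarrow> norm (v x) * \<bar>y\<bar> < \<epsilon> / 2"
    using schwartz_times_growth_small[OF v, of "\<epsilon> / 2"] \<open>0 < \<epsilon>\<close> by auto
  obtain n0 where n0: "\<And>n t. n \<ge> n0 \<Longrightarrow> R < \<bar>(\<psi> ^^ n) t\<bar>" using esc by blast
  show ?thesis
  proof (rule that)
    fix n assume n: "n \<ge> n0"
    define G where "G x = (if x \<in> range (\<psi> ^^ n) then g (inv_iter \<psi> n x) else 0)" for x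
    \<comment> \<open>The range and the complement of the compact image are open and cover the line.
      On the former \<open>G\<close> is a composition of smooth functions, on the latter it
      vanishes, so boundary points of the range cause no trouble.\<close>
    have cJ: "compact ((\<psi> ^^ n) ` ?J)" by (rule compact_iterate_image) auto
    then have oZ: "open (- (\<psi> ^^ n) ` ?J)" by (simp add: compact_imp_closed open_Compl)
    have GZ: "G x = 0" if "x \<in> - (\<psi> ^^ n) ` ?J" for x
    proof (cases "x \<in> range (\<psi> ^^ n)")
      case True
      then obtain t where t: "x = (\<psi> ^^ n) t" by blast
      then have "t \<notin> ?J" using that by blast
      then have "L < \<bar>t\<bar>" by auto
      then show ?thesis by (simp add: G_def t g(2))
    qed (simp add: G_def)
    have "kdiff k (range (\<psi> ^^ n)) G" for k
      by (rule kdiff_cong[OF open_range_iterate _ kdiff_compose[OF open_range_iterate kdiff_inv_iter smooth_kdiff[OF g(1)] subset_UNIV]])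
         (auto simp: G_def)
    moreover have "kdiff k (- (\<psi> ^^ n) ` ?J) G" for k
      by (rule kdiff_cong[OF oZ GZ kdiff_const[OF oZ]])
    moreover have "x \<in> range (\<psi> ^^ n) \<or> x \<in> - (\<psi> ^^ n) ` ?J" for x by blast
    ultimately have G: "smooth G" unfolding smooth_def kdiff_def by (metis UNIV_I)
    obtain L' where L': "\<And>x. x \<in> (\<psi> ^^ n) ` ?J \<Longrightarrow> \<bar>x\<bar> \<le> L'"
      using compact_imp_bounded[OF cJ] unfolding bounded_iff real_norm_def by blast
    have "G \<in> O_M"
    proof (rule compact_support_O_M[OF G])
      fix x assume "L' < \<bar>x\<bar>"
      then show "G x = 0" using L' by (intro GZ) force
    qed
    moreover have "O_M_seminorm m v G \<le> \<epsilon> / 2"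
    proof (rule seminorm_le)
      fix x j assume j: "j \<le> m"
      show "cmod (v x) * cmod (nth_deriv j G x) \<le> \<epsilon> / 2"
      proof (cases "x \<in> (\<psi> ^^ n) ` ?J")
        case True
        then obtain t where t: "t \<in> ?J" "x = (\<psi> ^^ n) t" by blast
        have "nth_deriv j G x = nth_deriv j (\<lambda>y. g (inv_iter \<psi> n y)) x"
          by (rule nth_deriv_cong[OF open_range_iterate[of n]]) (auto simp: G_def t)
        then have "\<bar>cmod (nth_deriv j G x)\<bar> \<le> C * (1 + x\<^sup>2) ^ N"
          using CN0[OF j, of "(n, t)"] t by (simp add: D_def)
        then show ?thesis using R[of x "cmod (nth_deriv j G x)"] n0[OF n, of t] t by simp
      next
        case False
        have "nth_deriv j G x = nth_deriv j (\<lambda>y. 0) x"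
          by (rule nth_deriv_cong[OF oZ GZ]) (use False in auto)
        also have "\<dots> = 0" by (cases j) (auto simp: nth_deriv_const)
        finally show ?thesis using \<open>0 < \<epsilon>\<close> by simp
      qed
    qed
    moreover have "G ((\<psi> ^^ n) t) = g t" for t by (simp add: G_def)
    ultimately show "\<exists>G\<in>O_M. O_M_seminorm m v G < \<epsilon> \<and> (\<forall>t. G ((\<psi> ^^ n) t) = g t)"
      using \<open>0 < \<epsilon>\<close> by (intro bexI[of _ G]) auto
  qed
qed

lemma tame_imp_mixing:
  assumes \<psi>: "\<psi> \<in> O_M" and tame: "\<And>K. compact K \<Longrightarrow> tame K"
    and esc: "\<And>R. \<exists>N. \<forall>n\<ge>N. \<forall>t. R < \<bar>(\<psi> ^^ n) t\<bar>"
  shows "mixing O_M_topology (comp_op \<psi>)"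
  unfolding mixing_def
proof (intro conjI allI impI)
  show "continuous_map O_M_topology O_M_topology (comp_op \<psi>)" by (rule continuous_map_comp_op[OF \<psi>])
  fix U V assume UV: "openin O_M_topology U \<and> U \<noteq> {} \<and> openin O_M_topology V \<and> V \<noteq> {}"
  then obtain f g where fg: "f \<in> U" "g \<in> V" by blast
  obtain m v \<epsilon> where f: "f \<in> O_M" "v \<in> schwartz" "0 < \<epsilon>"
    "\<And>h. h \<in> O_M \<Longrightarrow> O_M_seminorm m v (\<lambda>x. h x - f x) < \<epsilon> \<Longrightarrow> h \<in> U"
    using openin_O_M_imp_ball[of U f] UV fg by blast
  obtain m' v' \<epsilon>' where g: "g \<in> O_M" "v' \<in> schwartz" "0 < \<epsilon>'"
    "\<And>h. h \<in> O_M \<Longrightarrow> O_M_seminorm m' v' (\<lambda>x. h x - g x) < \<epsilon>' \<Longrightarrow> h \<in> V"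
    using openin_O_M_imp_ball[of V g] UV fg by blast
  \<comment> \<open>Half of \<open>\<epsilon>\<close> is left for the pulled-back function;
    \<open>g0\<close> below gets its whole tolerance, since it is hit exactly.\<close>
  obtain f0 L where f0: "smooth f0" "\<And>x. L < \<bar>x\<bar> \<Longrightarrow> f0 x = 0" "O_M_seminorm m v (\<lambda>x. f0 x - f x) < \<epsilon> / 2"
    using compactly_supported_dense[OF f(1,2), of "\<epsilon> / 2" m] f(3) by auto
  obtain g0 L' where g0: "smooth g0" "\<And>x. L' < \<bar>x\<bar> \<Longrightarrow> g0 x = 0" "O_M_seminorm m' v' (\<lambda>x. g0 x - g x) < \<epsilon>'"
    using compactly_supported_dense[OF g(1-3), of m'] by auto
  have f0O: "f0 \<in> O_M" and g0O: "g0 \<in> O_M" using compact_support_O_M f0 g0 by blast+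
  have "0 < \<epsilon> / 2" using f(3) by simp
  then obtain n1 where n1: "\<And>n. n \<ge> n1 \<Longrightarrow>
      \<exists>G\<in>O_M. O_M_seminorm m v G < \<epsilon> / 2 \<and> (\<forall>t. G ((\<psi> ^^ n) t) = g0 t)"
    using tame_imp_pullback_small[OF tame[OF compact_Icc] esc g0(1,2) f(2)] by metis
  \<comment> \<open>From \<open>n2\<close> on, the range of the iterate misses the support of
    \<open>f0\<close>.\<close>
  obtain n2 where n2: "\<And>n t. n \<ge> n2 \<Longrightarrow> L < \<bar>(\<psi> ^^ n) t\<bar>" using esc by blast
  have "(comp_op \<psi> ^^ n) ` U \<inter> V \<noteq> {}" if n: "n \<ge> max n1 n2" for n
  proof -
    obtain G where G: "G \<in> O_M" "O_M_seminorm m v G < \<epsilon> / 2" "\<And>t. G ((\<psi> ^^ n) t) = g0 t"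
      using n1[of n] n by auto
    \<comment> \<open>The sum of \<open>G\<close> and \<open>f0\<close>, written with differences
      because \<open>O_M\<close> is known to be closed under these.\<close>
    define u where "u x = G x - (0 - f0 x)" for x
    have Z: "(\<lambda>x. 0) \<in> (O_M :: (real \<Rightarrow> complex) set)" using O_M_affine[of "0::complex" 0] by simp
    have uO: "u \<in> O_M" unfolding u_def by (intro O_M_diff G(1) Z f0O)
    have "O_M_seminorm m v (\<lambda>x. u x - f x) \<le> O_M_seminorm m v (\<lambda>x. u x - f0 x) + O_M_seminorm m v (\<lambda>x. f0 x - f x)"
      by (rule seminorm_triangle[OF uO f0O f(1,2)])
    also have "(\<lambda>x. u x - f0 x) = G" by (simp add: u_def)
    finally have "u \<in> U" using G(2) f0(3) by (intro f(4) uO) simp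
    moreover have "(comp_op \<psi> ^^ n) u = g0"
      unfolding comp_op_funpow using G(3) f0(2) n2[of n] n by (auto simp: u_def)
    moreover have "g0 \<in> V" by (rule g(4)[OF g0O g0(3)])
    ultimately show ?thesis by blast
  qed
  then show "\<forall>\<^sub>F n in sequentially. (comp_op \<psi> ^^ n) ` U \<inter> V \<noteq> {}"
    unfolding eventually_sequentially by blast
qed

end

theorem theorem13:
  fixes \<psi> :: "real \<Rightarrow> real"
  assumes "\<psi> \<in> O_M" and "\<not> surj \<psi>"
  shows "(mixing O_M_topology (comp_op \<psi>)
      \<longleftrightarrow>
        (inj \<psi> \<and> (\<forall>x. deriv \<psi> x \<noteq> 0) \<and> (\<forall>x. \<psi> x \<noteq> x) \<and>
         (\<forall>a. \<forall>k\<ge>1. \<forall>v\<in>(schwartz :: (real \<Rightarrow> complex) set).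
            (\<lambda>n. SUP x\<in>(\<psi> ^^ n) ` {min a (\<psi> a)..max a (\<psi> a)}.
               cmod (v x * complex_of_real (nth_deriv k (inv_iter \<psi> n) x))) \<longlonglongrightarrow> 0)))
    \<and> ((inj \<psi> \<and> (\<forall>x. deriv \<psi> x \<noteq> 0) \<and> (\<forall>x. \<psi> x \<noteq> x) \<and>
         (\<forall>a. \<forall>k\<ge>1. \<forall>v\<in>(schwartz :: (real \<Rightarrow> complex) set).
            (\<lambda>n. SUP x\<in>(\<psi> ^^ n) ` {min a (\<psi> a)..max a (\<psi> a)}.
               cmod (v x * complex_of_real (nth_deriv k (inv_iter \<psi> n) x))) \<longlonglongrightarrow> 0))
      \<longleftrightarrow>
        (inj \<psi> \<and> (\<forall>x. deriv \<psi> x \<noteq> 0) \<and> (\<forall>x. \<psi> x \<noteq> x) \<and>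
         (\<exists>a. \<forall>k\<ge>1. \<forall>v\<in>(schwartz :: (real \<Rightarrow> complex) set).
            (\<lambda>n. SUP x\<in>(\<psi> ^^ n) ` {min a (\<psi> a)..max a (\<psi> a)}.
               cmod (v x * complex_of_real (nth_deriv k (inv_iter \<psi> n) x))) \<longlonglongrightarrow> 0)))"
proof -
  have smooth: "smooth \<psi>" by (rule O_M_smooth[OF assms(1)])
  then have cont: "continuous_on UNIV \<psi>" using smooth_continuous_on[of \<psi> UNIV 0] by simp
  \<comment> \<open>The statement speaks of \<open>deriv\<close>, the estimates of
    \<open>nth_deriv\<close>; both agree for a smooth function.\<close>
  have deriv: "deriv \<psi> x = nth_deriv (Suc 0) \<psi> x" for x
    using smooth_has_nth_deriv[OF smooth, of 0 x]
    by (simp add: DERIV_imp_deriv has_real_derivative_iff_has_vector_derivative)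
  define H where "H \<longleftrightarrow> inj \<psi> \<and> (\<forall>x. deriv \<psi> x \<noteq> 0) \<and> (\<forall>x. \<psi> x \<noteq> x)"
  define P where "P a \<longleftrightarrow> (\<forall>k\<ge>1. \<forall>v\<in>(schwartz :: (real \<Rightarrow> complex) set).
            (\<lambda>n. SUP x\<in>(\<psi> ^^ n) ` {min a (\<psi> a)..max a (\<psi> a)}.
               cmod (v x * complex_of_real (nth_deriv k (inv_iter \<psi> n) x))) \<longlonglongrightarrow> 0)" for a
  have emb: "smooth_embedding \<psi>" if H
    using that smooth deriv by unfold_locales (auto simp: H_def)
  have esc: "\<exists>N. \<forall>n\<ge>N. \<forall>t. R < \<bar>(\<psi> ^^ n) t\<bar>" if H for R
    using iterates_escape(1)[OF cont _ _ assms(2), of R] that unfolding H_def by blast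
  have P: "P a \<longleftrightarrow> smooth_embedding.tame \<psi> {min a (\<psi> a)..max a (\<psi> a)}" if H for a
    using smooth_embedding.sup_tendsto_0_iff_inverse_growth[OF emb[OF that] compact_Icc _ esc[OF that],
        of "min a (\<psi> a)" "max a (\<psi> a)"]
    unfolding P_def smooth_embedding.tame_def[OF emb[OF that]] by simp
  \<comment> \<open>One admissible \<open>a\<close> controls all compact sets; this yields mixing as
    well as the passage from some \<open>a\<close> to every \<open>a\<close>.\<close>
  have all: "smooth_embedding.tame \<psi> K" if H "P a" "compact K" for a K
    using smooth_embedding.tame_transport[OF emb[OF that(1)] _ _ assms(2) that(3), of a] P[OF that(1)] that(1,2)
    unfolding H_def by blast
  have "H" if "mixing O_M_topology (comp_op \<psi>)"
    unfolding H_def deriv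
    using mixing_imp_inj[OF that] mixing_imp_deriv_nonzero[OF that assms(1)] mixing_imp_no_fixed_point[OF that]
    by blast
  moreover have "P a" if "H" "mixing O_M_topology (comp_op \<psi>)" for a
    unfolding P[OF that(1)] smooth_embedding.tame_def[OF emb[OF that(1)]]
    using smooth_embedding.mixing_imp_inverse_growth[OF emb[OF that(1)] that(2) compact_Icc] by blast
  moreover have "mixing O_M_topology (comp_op \<psi>)" if "H" "P a" for a
    by (rule smooth_embedding.tame_imp_mixing[OF emb[OF that(1)] assms(1) all[OF that] esc[OF that(1)]])
  moreover have "P b" if "H" "P a" for a b
    unfolding P[OF that(1)] by (rule all[OF that compact_Icc])
  ultimately have "(mixing O_M_topology (comp_op \<psi>) \<longleftrightarrow> H \<and> (\<forall>a. P a)) \<and> (H \<and> (\<forall>a. P a) \<longleftrightarrow> H \<and> (\<exists>a. P a))"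
    by blast
  then show ?thesis unfolding H_def P_def by (simp only: conj_assoc)
qed


end
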